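(* If $\mathcal{C}$ is a smooth, addable class of graphs and $\phi$ is a sentence of MSO, then the probability that $R_n(\mathcal{C})$ satisfies $\phi$ tends to a limit as $n\to\infty$.
   Context: Graphs are finite, simple and undirected; classes of graphs are closed under isomorphism. $\mathcal{C}_n$ is the set of graphs in $\mathcal{C}$ with vertex set $[n]$, and $R_n(\mathcal{C})$ is drawn uniformly from $\mathcal{C}_n$. $\mathcal{C}$ is decomposable if $G\in\mathcal{C}$ iff every connected component of $G$ is in $\mathcal{C}$; bridge-addable if for every $G\in\mathcal{C}$ and vertices $u,v$ in distinct components of $G$, adding the edge $\{u,v\}$ yields a graph in $\mathcal{C}$; addable if both decomposable and bridge-addable. $\mathcal{C}$ is smooth if $|\mathcal{C}_n|/(n|\mathcal{C}_{n-1}|)$ tends to a finite limit as $n\to\infty$. MSO formulas over graphs are built from $x\in X$ and $E(x,y)$ using Boolean connectives and first- and second-order (set) quantifiers. *)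

theory Defs
  imports "HOL-Probability.Probability_Mass_Function" "Graph_Theory.Digraph_Component"
begin

text \<open>
  A finite simple undirected graph is a \<^locale>\<open>pair_graph\<close>: finite, symmetric and loop-free; each
  undirected edge is represented by its two arcs. A class of graphs is a set of such graphs
  whose vertices are natural numbers; up to isomorphism this covers all finite graphs.
\<close>

definition graph_iso :: "('a \<Rightarrow> 'b) \<Rightarrow> 'a pair_pre_digraph \<Rightarrow> 'b pair_pre_digraph \<Rightarrow> bool" where
  "graph_iso f G H \<longleftrightarrow> bij_betw f (pverts G) (pverts H) \<and>
     (\<forall>u \<in> pverts G. \<forall>v \<in> pverts G. (u, v) \<in> parcs G \<longleftrightarrow> (f u, f v) \<in> parcs H)"

definition graph_class :: "nat pair_pre_digraph set \<Rightarrow> bool" where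
  "graph_class C \<longleftrightarrow> (\<forall>G \<in> C. pair_graph G) \<and>
     (\<forall>G H f. G \<in> C \<and> pair_graph H \<and> graph_iso f G H \<longrightarrow> H \<in> C)"

text \<open>On symmetric digraphs the strongly connected components are the connected components.
  They are nonempty, so the null graph has none.\<close>

definition components :: "'a pair_pre_digraph \<Rightarrow> 'a pair_pre_digraph set" where
  "components G = {H. with_proj H \<in> pre_digraph.sccs (with_proj G)}"

definition add_edge :: "'a \<Rightarrow> 'a \<Rightarrow> 'a pair_pre_digraph \<Rightarrow> 'a pair_pre_digraph" where
  "add_edge u v G = \<lparr> pverts = pverts G, parcs = parcs G \<union> {(u, v), (v, u)} \<rparr>"

definition decomposable :: "nat pair_pre_digraph set \<Rightarrow> bool" where
  "decomposable C \<longleftrightarrow> (\<forall>G. pair_graph G \<longrightarrow> (G \<in> C \<longleftrightarrow> (\<forall>H \<in> components G. H \<in> C)))"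

definition bridge_addable :: "nat pair_pre_digraph set \<Rightarrow> bool" where
  "bridge_addable C \<longleftrightarrow>
     (\<forall>G \<in> C. \<forall>H \<in> components G. \<forall>H' \<in> components G. \<forall>u \<in> pverts H. \<forall>v \<in> pverts H'.
        H \<noteq> H' \<longrightarrow> add_edge u v G \<in> C)"

definition addable :: "nat pair_pre_digraph set \<Rightarrow> bool" where
  "addable C \<longleftrightarrow> decomposable C \<and> bridge_addable C"

definition on_vertices :: "nat pair_pre_digraph set \<Rightarrow> nat \<Rightarrow> nat pair_pre_digraph set" where
  "on_vertices C n = {G \<in> C. pverts G = {1..n}}"

text \<open>The first conjunct says that the ratios are eventually well defined (rather than
  \<open>x / 0 = 0\<close>) and that the uniform distribution below eventually exists.\<close>

definition smooth :: "nat pair_pre_digraph set \<Rightarrow> bool" where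
  "smooth C \<longleftrightarrow> (\<forall>\<^sub>F n in sequentially. on_vertices C n \<noteq> {}) \<and>
     convergent (\<lambda>n. real (card (on_vertices C n)) / (real n * real (card (on_vertices C (n - 1)))))"

text \<open>Unspecified if \<^term>\<open>on_vertices C n\<close> is empty.\<close>

definition random_graph :: "nat pair_pre_digraph set \<Rightarrow> nat \<Rightarrow> nat pair_pre_digraph pmf" where
  "random_graph C n = pmf_of_set (on_vertices C n)"

text \<open>Element variables and set variables are two separate families, each indexed by \<^typ>\<open>nat\<close>.
  There is no atom for equality, as \<open>x = y\<close> is definable by \<open>\<forall>X. x \<in> X \<longleftrightarrow> y \<in> X\<close>.\<close>

datatype mso =
    Mem nat nat  \<comment> \<open>element variable, set variable\<close>
  | Edge nat nat
  | Neg mso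
  | Conj mso mso
  | Disj mso mso
  | Ex_elem nat mso
  | All_elem nat mso
  | Ex_set nat mso
  | All_set nat mso

primrec free_elem :: "mso \<Rightarrow> nat set" where
  "free_elem (Mem x X) = {x}"
| "free_elem (Edge x y) = {x, y}"
| "free_elem (Neg \<phi>) = free_elem \<phi>"
| "free_elem (Conj \<phi> \<psi>) = free_elem \<phi> \<union> free_elem \<psi>"
| "free_elem (Disj \<phi> \<psi>) = free_elem \<phi> \<union> free_elem \<psi>"
| "free_elem (Ex_elem x \<phi>) = free_elem \<phi> - {x}"
| "free_elem (All_elem x \<phi>) = free_elem \<phi> - {x}"
| "free_elem (Ex_set X \<phi>) = free_elem \<phi>"
| "free_elem (All_set X \<phi>) = free_elem \<phi>"

primrec free_set :: "mso \<Rightarrow> nat set" where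
  "free_set (Mem x X) = {X}"
| "free_set (Edge x y) = {}"
| "free_set (Neg \<phi>) = free_set \<phi>"
| "free_set (Conj \<phi> \<psi>) = free_set \<phi> \<union> free_set \<psi>"
| "free_set (Disj \<phi> \<psi>) = free_set \<phi> \<union> free_set \<psi>"
| "free_set (Ex_elem x \<phi>) = free_set \<phi>"
| "free_set (All_elem x \<phi>) = free_set \<phi>"
| "free_set (Ex_set X \<phi>) = free_set \<phi> - {X}"
| "free_set (All_set X \<phi>) = free_set \<phi> - {X}"

definition sentence :: "mso \<Rightarrow> bool" where
  "sentence \<phi> \<longleftrightarrow> free_elem \<phi> = {} \<and> free_set \<phi> = {}"

primrec sat :: "'a pair_pre_digraph \<Rightarrow> mso \<Rightarrow> (nat \<Rightarrow> 'a) \<Rightarrow> (nat \<Rightarrow> 'a set) \<Rightarrow> bool" where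
  "sat G (Mem x X) e s \<longleftrightarrow> e x \<in> s X"
| "sat G (Edge x y) e s \<longleftrightarrow> (e x, e y) \<in> parcs G"
| "sat G (Neg \<phi>) e s \<longleftrightarrow> \<not> sat G \<phi> e s"
| "sat G (Conj \<phi> \<psi>) e s \<longleftrightarrow> sat G \<phi> e s \<and> sat G \<psi> e s"
| "sat G (Disj \<phi> \<psi>) e s \<longleftrightarrow> sat G \<phi> e s \<or> sat G \<psi> e s"
| "sat G (Ex_elem x \<phi>) e s \<longleftrightarrow> (\<exists>a \<in> pverts G. sat G \<phi> (e(x := a)) s)"
| "sat G (All_elem x \<phi>) e s \<longleftrightarrow> (\<forall>a \<in> pverts G. sat G \<phi> (e(x := a)) s)"
| "sat G (Ex_set X \<phi>) e s \<longleftrightarrow> (\<exists>A \<subseteq> pverts G. sat G \<phi> e (s(X := A)))"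
| "sat G (All_set X \<phi>) e s \<longleftrightarrow> (\<forall>A \<subseteq> pverts G. sat G \<phi> e (s(X := A)))"

lemma sat_cong:
  assumes "\<And>x. x \<in> free_elem \<phi> \<Longrightarrow> e x = e' x" "\<And>X. X \<in> free_set \<phi> \<Longrightarrow> s X = s' X"
  shows "sat G \<phi> e s \<longleftrightarrow> sat G \<phi> e' s'"
  using assms
proof (induction \<phi> arbitrary: e e' s s')
  case (Neg \<phi>)
  show ?case using Neg.IH[of e e' s s'] Neg.prems by simp
next
  case (Conj \<phi> \<psi>)
  show ?case using Conj.IH(1,2)[of e e' s s'] Conj.prems by simp
next
  case (Disj \<phi> \<psi>)
  show ?case using Disj.IH(1,2)[of e e' s s'] Disj.prems by simp
next
  case (Ex_elem x \<phi>)
  have "sat G \<phi> (e(x := a)) s \<longleftrightarrow> sat G \<phi> (e'(x := a)) s'" for a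
    by (rule Ex_elem.IH) (use Ex_elem.prems in auto)
  then show ?case by simp
next
  case (All_elem x \<phi>)
  have "sat G \<phi> (e(x := a)) s \<longleftrightarrow> sat G \<phi> (e'(x := a)) s'" for a
    by (rule All_elem.IH) (use All_elem.prems in auto)
  then show ?case by simp
next
  case (Ex_set X \<phi>)
  have "sat G \<phi> e (s(X := A)) \<longleftrightarrow> sat G \<phi> e' (s'(X := A))" for A
    by (rule Ex_set.IH) (use Ex_set.prems in auto)
  then show ?case by simp
next
  case (All_set X \<phi>)
  have "sat G \<phi> e (s(X := A)) \<longleftrightarrow> sat G \<phi> e' (s'(X := A))" for A
    by (rule All_set.IH) (use All_set.prems in auto)
  then show ?case by simp
qed auto

text \<open>For a sentence the valuations are irrelevant.\<close>

definition satisfies :: "'a pair_pre_digraph \<Rightarrow> mso \<Rightarrow> bool" where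
  "satisfies G \<phi> \<longleftrightarrow> (\<forall>e s. sat G \<phi> e s)"

lemma satisfies_sentence: "sentence \<phi> \<Longrightarrow> satisfies G \<phi> \<longleftrightarrow> sat G \<phi> e s"
proof -
  assume "sentence \<phi>"
  then have "sat G \<phi> e' s' \<longleftrightarrow> sat G \<phi> e s" for e' s'
    by (intro sat_cong) (auto simp: sentence_def)
  then show ?thesis unfolding satisfies_def by blast
qed

lemma finite_on_vertices:
  assumes "graph_class C"
  shows "finite (on_vertices C n)"
proof (rule finite_subset)
  show "on_vertices C n \<subseteq>
    (\<lambda>E. \<lparr> pverts = {1..n}, parcs = E \<rparr>) ` Pow ({1..n} \<times> {1..n})"
  proof
    fix G assume G: "G \<in> on_vertices C n"
    then have "pair_graph G" "pverts G = {1..n}"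
      using assms unfolding on_vertices_def graph_class_def by blast+
    moreover have "parcs G \<subseteq> pverts G \<times> pverts G"
    proof -
      interpret pair_graph G by fact
      show ?thesis by (auto dest: wellformed')
    qed
    ultimately show "G \<in> (\<lambda>E. \<lparr> pverts = {1..n}, parcs = E \<rparr>) ` Pow ({1..n} \<times> {1..n})"
      by (intro image_eqI[where x = "parcs G"]) auto
  qed
qed simp

end

theory Submission
  imports Defs "HOL-Library.Multiset" "HOL-Library.Nat_Bijection"
    "HOL-Computational_Algebra.Formal_Power_Series" "HOL-Real_Asymp.Real_Asymp"
begin

text \<open>
  The proof rests on three facts. First, ranked MSO types of disjoint unions form a finite aperiodic
  commutative monoid, which yields a rooted graph \<open>H\<close> in the class such that all connected graphs of the
  class with a pendant copy of \<open>H\<close> have the same type. Second, attaching \<open>H\<close> to a graph of order \<open>n\<close>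
  without pendant copies of \<open>H\<close> is possible at \<open>n\<close> places and hardly ever gives the same result twice;
  as the counts are smooth, almost all graphs of the class therefore have a pendant copy. Third, adding
  a bridge between two components and counting the bridges of the result shows that the expected number
  of vertices outside the largest component is at most a constant. So, up to a small error, the random
  graph consists of a connected graph of known type and a fragment of bounded size, and it remains to
  see that each fragment has a limiting probability. This holds once the proportion \<open>q n\<close> of
  connected graphs converges. With \<open>A\<close> the exponential generating function of the class, \<open>\<rho>\<close> its radius
  of convergence and \<open>w\<close> the coefficients of \<open>A(\<rho>x)\<close>, the tightness of the fragment says that the
  convolution of \<open>w\<close> and \<open>q\<close> tends to \<open>1\<close>, and \<open>w\<close> has an absolutely summable convolution inverse, because
  \<open>1/A = exp(-K)\<close> is dominated coefficientwise by \<open>A = exp(K)\<close>.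
\<close>

section \<open>Monadic second-order types and their sums\<close>

text \<open>Smoothness alone does not say that the proportion of connected graphs converges, and
  this is the analytic obstacle. The relation \<open>w * q -> 1\<close> can be solved for
  \<open>q\<close> only with an absolutely summable inverse of \<open>w\<close>. Absence of zeros of
  the generating function on the closed disc of convergence would give one through Wiener's theorem;
  the domination of \<open>exp (-K)\<close> by \<open>exp K\<close> replaces that theorem.
  Summability of \<open>w\<close> itself rests on the bridge count, which in the limit bounds \<rho>
  K'(\<rho>) by 2. This 2 recurs in all bounds: the bridges of a graph form a forest, with at most
  as many edges as vertices, and each is counted in both orientations. On the logical side the
  obstacle is that a copy is attached by a bridge and not added as a component. Joining one root to
  many roots at once turns attachment into addition: what hangs on the root is a disjoint union with
  marked roots, so absorption in the monoid of types applies to it.\<close>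

definition atom_code :: "nat \<Rightarrow> nat \<Rightarrow> nat \<Rightarrow> nat" where
  "atom_code c i j = prod_encode (c, prod_encode (i, j))"

lemma atom_code_eq_iff [simp]: "atom_code c i j = atom_code c' i' j' \<longleftrightarrow> c = c' \<and> i = i' \<and> j = j'"
  by (simp add: atom_code_def)

text \<open>Kind \<open>0\<close> expresses membership when one of the colours is a singleton. Kind
  \<open>1\<close> lets a type recognise singletons, which stand for the values of element
  variables; counting up to two suffices for that.\<close>

definition atoms :: "(nat \<times> nat) set \<Rightarrow> nat \<Rightarrow> (nat \<Rightarrow> nat set) \<Rightarrow> nat set" where
  "atoms E m \<sigma> = {atom_code 0 i j | i j. i < m \<and> j < m \<and> \<sigma> i \<inter> \<sigma> j \<noteq> {}} \<union>
     {atom_code 1 i j | i j. i < m \<and> j < m \<and> 2 \<le> card (\<sigma> i \<inter> \<sigma> j)} \<union>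
     {atom_code 2 i j | i j. i < m \<and> j < m \<and> E \<inter> \<sigma> i \<times> \<sigma> j \<noteq> {}}"

text \<open>The type of rank \<open>k\<close> of a structure with colours \<open>\<sigma> 0, \<dots>, \<sigma> (m - 1)\<close> is a hereditarily finite set,
  coded as a number so that all ranks share one HOL type.\<close>

primrec tp :: "nat \<Rightarrow> nat set \<Rightarrow> (nat \<times> nat) set \<Rightarrow> nat \<Rightarrow> (nat \<Rightarrow> nat set) \<Rightarrow> nat" where
  "tp 0 V E m \<sigma> = set_encode (atoms E m \<sigma>)"
| "tp (Suc k) V E m \<sigma> = set_encode ((\<lambda>A. tp k V E (Suc m) (\<sigma>(m := A))) ` Pow V)"

text \<open>In a disjoint union two colours also share two vertices if they share one in each part;
  this is the last set.\<close>

definition atom_merge :: "nat set \<Rightarrow> nat set \<Rightarrow> nat set" where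
  "atom_merge X Y = X \<union> Y \<union> {atom_code 1 i j | i j. atom_code 0 i j \<in> X \<inter> Y}"

text \<open>A subset of a disjoint union is a pair of subsets of the parts, so at positive rank the
  sum is taken elementwise. It is defined on all numbers, so that the monoid laws hold without
  reference to structures.\<close>

primrec tadd :: "nat \<Rightarrow> nat \<Rightarrow> nat \<Rightarrow> nat" where
  "tadd 0 x y = set_encode (atom_merge (set_decode x) (set_decode y))"
| "tadd (Suc k) x y = set_encode ((\<lambda>(u, v). tadd k u v) ` (set_decode x \<times> set_decode y))"

text \<open>The type of the empty structure, which has exactly one subset.\<close>

primrec tzero :: "nat \<Rightarrow> nat" where
  "tzero 0 = 0"
| "tzero (Suc k) = set_encode {tzero k}"

lemma atoms_subset: "atoms E m \<sigma> \<subseteq> (\<lambda>(c, i, j). atom_code c i j) ` ({..2} \<times> {..<m} \<times> {..<m})"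
  unfolding atoms_def by (auto simp: image_iff)

lemma finite_atoms [simp]: "finite (atoms E m \<sigma>)"
  by (rule finite_subset[OF atoms_subset]) simp

lemma atom_code_in_atoms [simp]:
  "atom_code 0 i j \<in> atoms E m \<sigma> \<longleftrightarrow> i < m \<and> j < m \<and> \<sigma> i \<inter> \<sigma> j \<noteq> {}"
  "atom_code (Suc 0) i j \<in> atoms E m \<sigma> \<longleftrightarrow> i < m \<and> j < m \<and> 2 \<le> card (\<sigma> i \<inter> \<sigma> j)"
  "atom_code 2 i j \<in> atoms E m \<sigma> \<longleftrightarrow> i < m \<and> j < m \<and> E \<inter> \<sigma> i \<times> \<sigma> j \<noteq> {}"
  by (auto simp: atoms_def)

lemma atoms_eq_iff:
  "atoms E m \<sigma> = atoms E' m \<sigma>' \<longleftrightarrow> (\<forall>i<m. \<forall>j<m.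
     (\<sigma> i \<inter> \<sigma> j = {} \<longleftrightarrow> \<sigma>' i \<inter> \<sigma>' j = {}) \<and>
     (2 \<le> card (\<sigma> i \<inter> \<sigma> j) \<longleftrightarrow> 2 \<le> card (\<sigma>' i \<inter> \<sigma>' j)) \<and>
     (E \<inter> \<sigma> i \<times> \<sigma> j = {} \<longleftrightarrow> E' \<inter> \<sigma>' i \<times> \<sigma>' j = {}))" (is "?L \<longleftrightarrow> ?R")
proof
  assume ?L
  then have "atom_code c i j \<in> atoms E m \<sigma> \<longleftrightarrow> atom_code c i j \<in> atoms E' m \<sigma>'" for c i j
    by simp
  note at = this[of 0] this[of "Suc 0"] this[of 2]
  show ?R using at[unfolded atom_code_in_atoms] by (metis (no_types))
next
  assume ?R
  then have "i < m \<and> j < m \<and> \<sigma> i \<inter> \<sigma> j \<noteq> {} \<longleftrightarrow> i < m \<and> j < m \<and> \<sigma>' i \<inter> \<sigma>' j \<noteq> {}"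
    "i < m \<and> j < m \<and> 2 \<le> card (\<sigma> i \<inter> \<sigma> j) \<longleftrightarrow> i < m \<and> j < m \<and> 2 \<le> card (\<sigma>' i \<inter> \<sigma>' j)"
    "i < m \<and> j < m \<and> E \<inter> \<sigma> i \<times> \<sigma> j \<noteq> {} \<longleftrightarrow> i < m \<and> j < m \<and> E' \<inter> \<sigma>' i \<times> \<sigma>' j \<noteq> {}" for i j
    by metis+
  then show ?L unfolding atoms_def by presburger
qed

lemma atoms_eqD:
  assumes "atoms E m \<sigma> = atoms E' m \<sigma>'" "i < m" "j < m"
  shows "\<sigma> i \<inter> \<sigma> j = {} \<longleftrightarrow> \<sigma>' i \<inter> \<sigma>' j = {}"
    and "2 \<le> card (\<sigma> i \<inter> \<sigma> j) \<longleftrightarrow> 2 \<le> card (\<sigma>' i \<inter> \<sigma>' j)"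
    and "E \<inter> \<sigma> i \<times> \<sigma> j = {} \<longleftrightarrow> E' \<inter> \<sigma>' i \<times> \<sigma>' j = {}"
proof -
  note * = assms(1)[unfolded atoms_eq_iff, rule_format, OF assms(2,3)]
  show "\<sigma> i \<inter> \<sigma> j = {} \<longleftrightarrow> \<sigma>' i \<inter> \<sigma>' j = {}"
    and "2 \<le> card (\<sigma> i \<inter> \<sigma> j) \<longleftrightarrow> 2 \<le> card (\<sigma>' i \<inter> \<sigma>' j)"
    and "E \<inter> \<sigma> i \<times> \<sigma> j = {} \<longleftrightarrow> E' \<inter> \<sigma>' i \<times> \<sigma>' j = {}"
    by (fact *[THEN conjunct1] *[THEN conjunct2, THEN conjunct1] *[THEN conjunct2, THEN conjunct2])+
qed

lemma finite_atom_merge [simp]: "finite X \<Longrightarrow> finite Y \<Longrightarrow> finite (atom_merge X Y)"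
proof -
  assume "finite X" "finite Y"
  moreover have "{atom_code 1 i j | i j. atom_code 0 i j \<in> X \<inter> Y}
     \<subseteq> (\<lambda>z. prod_encode (1, snd (prod_decode z))) ` X"
    by (force simp: atom_code_def image_iff)
  ultimately show ?thesis unfolding atom_merge_def by (meson finite_UnI finite_imageI finite_subset)
qed

lemma atom_code_merge [simp]:
  "atom_code 0 i j \<in> atom_merge X Y \<longleftrightarrow> atom_code 0 i j \<in> X \<union> Y"
  by (auto simp: atom_merge_def)

lemma atom_merge_commute: "atom_merge X Y = atom_merge Y X"
  by (auto simp: atom_merge_def)

lemma atom_merge_assoc: "atom_merge (atom_merge X Y) Z = atom_merge X (atom_merge Y Z)"
proof -
  have "atom_merge (atom_merge X Y) Z = atom_merge X Y \<union> Z \<union>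
          {atom_code 1 i j | i j. atom_code 0 i j \<in> (X \<union> Y) \<inter> Z}"
    by (subst atom_merge_def) simp
  also have "\<dots> = X \<union> atom_merge Y Z \<union> {atom_code 1 i j | i j. atom_code 0 i j \<in> X \<inter> (Y \<union> Z)}"
    unfolding atom_merge_def by auto
  also have "\<dots> = atom_merge X (atom_merge Y Z)"
    by (subst (2) atom_merge_def) simp
  finally show ?thesis .
qed

section \<open>The commutative monoid of types of a given rank\<close>

lemma tadd_commute: "tadd k x y = tadd k y x"
proof (induction k arbitrary: x y)
  case 0
  then show ?case by (simp add: atom_merge_commute)
next
  case (Suc k)
  have "(\<lambda>(u, v). tadd k u v) ` (X \<times> Y) = (\<lambda>(u, v). tadd k u v) ` (Y \<times> X)" for X Y
    using Suc by (force simp: image_iff)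
  then show ?case by simp
qed

lemma tadd_assoc: "tadd k (tadd k x y) z = tadd k x (tadd k y z)"
proof (induction k arbitrary: x y z)
  case 0
  then show ?case by (simp add: set_encode_inverse atom_merge_assoc)
next
  case (Suc k)
  have "(\<lambda>(u, v). tadd k u v) ` ((\<lambda>(u, v). tadd k u v) ` (X \<times> Y) \<times> Z) =
        (\<lambda>(u, v). tadd k u v) ` (X \<times> (\<lambda>(u, v). tadd k u v) ` (Y \<times> Z))" (is "?l = ?r") for X Y Z
  proof -
    have "?l = (\<lambda>(a, b, c). tadd k (tadd k a b) c) ` (X \<times> Y \<times> Z)"
      by (force simp: image_iff)
    also have "\<dots> = ?r"
      unfolding Suc by (force simp: image_iff)
    finally show ?thesis .
  qed
  then show ?case by (simp add: set_encode_inverse)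
qed

lemma tadd_left_commute: "tadd k x (tadd k y z) = tadd k y (tadd k x z)"
  by (metis tadd_assoc tadd_commute)

lemma tadd_zero: "tadd k x (tzero k) = x"
proof (induction k arbitrary: x)
  case 0
  then show ?case by (simp add: atom_merge_def)
next
  case (Suc k)
  then have "(\<lambda>(u, v). tadd k u v) ` (set_decode x \<times> {tzero k}) = set_decode x"
    by (force simp: image_iff)
  then show ?case by (simp add: set_encode_inverse del: set_encode_insert)
qed

definition tsum :: "nat \<Rightarrow> nat multiset \<Rightarrow> nat" where
  "tsum k = comm_monoid_mset.F (tadd k) (tzero k)"

lemma comm_monoid_mset_tadd: "comm_monoid_mset (tadd k) (tzero k)"
  unfolding comm_monoid_mset_def
  by (intro comm_monoid.intro abel_semigroup.intro semigroup.intro abel_semigroup_axioms.intro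
      comm_monoid_axioms.intro tadd_assoc tadd_commute tadd_zero)

lemma tsum_empty [simp]: "tsum k {#} = tzero k"
  unfolding tsum_def by (rule comm_monoid_mset.empty[OF comm_monoid_mset_tadd])

lemma tsum_add_mset [simp]: "tsum k (add_mset x A) = tadd k x (tsum k A)"
  unfolding tsum_def by (rule comm_monoid_mset.add_mset[OF comm_monoid_mset_tadd])

lemma tsum_union: "tsum k (A + B) = tadd k (tsum k A) (tsum k B)"
  unfolding tsum_def by (rule comm_monoid_mset.union[OF comm_monoid_mset_tadd])

text \<open>Addition at rank \<open>Suc k\<close> is the elementwise sum of sets, so a multiple of a
  set is its iterated sumset. This reduces questions about rank \<open>Suc k\<close> to sums of rank
  \<open>k\<close>.\<close>

lemma set_decode_tsum_Suc:
  "set_decode (tsum (Suc k) (replicate_mset M x)) = {tsum k B | B. size B = M \<and> set_mset B \<subseteq> set_decode x}"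
proof (induction M)
  case 0
  then show ?case by (auto simp: set_encode_inverse simp del: set_encode_insert)
next
  case (Suc M)
  have "set_decode (tsum (Suc k) (replicate_mset (Suc M) x)) =
      (\<lambda>(u, v). tadd k u v) ` (set_decode x \<times> {tsum k B | B. size B = M \<and> set_mset B \<subseteq> set_decode x})"
    using Suc by (simp add: set_encode_inverse flip: Suc)
  also have "\<dots> = {tsum k B | B. size B = Suc M \<and> set_mset B \<subseteq> set_decode x}" (is "?l = ?r")
  proof
    show "?l \<subseteq> ?r"
    proof
      fix z assume "z \<in> ?l"
      then obtain u B where *: "u \<in> set_decode x" "size B = M" "set_mset B \<subseteq> set_decode x" "z = tadd k u (tsum k B)"
        by auto
      then show "z \<in> ?r"
        by (intro CollectI exI[of _ "add_mset u B"]) auto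
    qed
    show "?r \<subseteq> ?l"
    proof
      fix z assume "z \<in> ?r"
      then obtain B where B: "size B = Suc M" "set_mset B \<subseteq> set_decode x" "z = tsum k B"
        by auto
      then obtain u B' where "B = add_mset u B'"
        by (metis size_eq_Suc_imp_eq_union)
      with B show "z \<in> ?l" by (auto simp: image_iff)
    qed
  qed
  finally show ?case .
qed

lemma tsum_replicate_mono:
  assumes "tsum k (replicate_mset (Suc N) x) = tsum k (replicate_mset N x)" "N \<le> M"
  shows "tsum k (replicate_mset (Suc M) x) = tsum k (replicate_mset M x)"
  using assms(2,1) by (induction rule: dec_induct) (simp_all)

text \<open>Stability persists beyond a threshold by \<open>tsum_replicate_mono\<close>, so the sum
  of the individual thresholds is a common one.\<close>

lemma tsum_stable:
  assumes "finite U" "\<And>u. u \<in> U \<Longrightarrow> \<exists>N. tsum k (replicate_mset (Suc N) u) = tsum k (replicate_mset N u)"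
  obtains N where "\<And>u. u \<in> U \<Longrightarrow> tsum k (replicate_mset (Suc N) u) = tsum k (replicate_mset N u)"
proof -
  obtain N where N: "\<And>u. u \<in> U \<Longrightarrow> tsum k (replicate_mset (Suc (N u)) u) = tsum k (replicate_mset (N u) u)"
    using assms(2) by metis
  have "N u \<le> (\<Sum>u\<in>U. N u)" if "u \<in> U" for u
    using assms(1) that by (simp add: member_le_sum)
  then show ?thesis using N tsum_replicate_mono that by metis
qed

lemma multiset_pigeonhole:
  assumes "finite U" "set_mset B \<subseteq> U" "card U * N < size B"
  obtains u C where "u \<in> U" "B = C + replicate_mset (Suc N) u"
proof -
  have "\<exists>u\<in>U. Suc N \<le> count B u"
  proof (rule ccontr)
    assume "\<not> ?thesis"
    then have "\<And>u. u \<in> U \<Longrightarrow> count B u \<le> N" by (meson not_less_eq_eq)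
    then have "sum (count B) (set_mset B) \<le> card (set_mset B) * N"
      using assms(2) by (metis sum_bounded_above of_nat_id subsetD)
    also have "\<dots> \<le> card U * N" using assms by (simp add: card_mono)
    finally show False using assms(3) by (simp add: size_multiset_overloaded_eq)
  qed
  then obtain u where "u \<in> U" "Suc N \<le> count B u" by blast
  then have "replicate_mset (Suc N) u \<subseteq># B" by (meson count_le_replicate_mset_subset_eq)
  then have "B = (B - replicate_mset (Suc N) u) + replicate_mset (Suc N) u"
    by (metis subset_mset.diff_add)
  with \<open>u \<in> U\<close> show ?thesis using that by blast
qed

text \<open>The aperiodicity that keeps MSO from counting modulo a number. It passes from types of rank
  \<open>k\<close> to sets of such types, because by the pigeonhole principle a long sum of elements of a
  finite set has a summand that occurs often.\<close>

lemma tsum_aperiodic: "\<exists>N. tsum k (replicate_mset (Suc N) x) = tsum k (replicate_mset N x)"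
proof (induction k arbitrary: x)
  case 0
  \<comment> \<open>A third copy adds nothing, because atoms count no further than two; hence the
    threshold 2 at rank \<open>0\<close>.\<close>
  have "tadd 0 x (tadd 0 x x) = tadd 0 x x"
  proof -
    have "atom_merge X (atom_merge X X) = atom_merge X X" for X
      by (auto simp: atom_merge_def)
    then show ?thesis by (simp add: set_encode_inverse)
  qed
  then have "tsum 0 (replicate_mset (Suc 2) x) = tsum 0 (replicate_mset 2 x)"
    unfolding numeral_2_eq_2 by (simp del: tadd.simps tzero.simps add: tadd_zero)
  then show ?case by blast
next
  case (Suc k)
  let ?U = "set_decode x"
  obtain N where N: "\<And>u. u \<in> ?U \<Longrightarrow> tsum k (replicate_mset (Suc N) u) = tsum k (replicate_mset N u)"
    using tsum_stable[OF finite_set_decode[of x] Suc.IH] by metis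
  \<comment> \<open>More than \<open>card ?U * N\<close> summands force one of them to occur at
    least \<open>Suc N\<close> times. One copy of it can then be dropped or added without changing
    the sum, so \<open>M\<close> and \<open>Suc M\<close> summands reach the same values.\<close>
  define M where "M = Suc (card ?U * N)"
  have "set_decode (tsum (Suc k) (replicate_mset (Suc M) x)) = set_decode (tsum (Suc k) (replicate_mset M x))"
    unfolding set_decode_tsum_Suc
  proof (intro equalityI subsetI)
    fix z assume "z \<in> {tsum k B | B. size B = Suc M \<and> set_mset B \<subseteq> ?U}"
    then obtain B where B: "size B = Suc M" "set_mset B \<subseteq> ?U" and z: "z = tsum k B" by blast
    obtain u C where uC: "u \<in> ?U" "B = C + replicate_mset (Suc N) u"
      by (rule multiset_pigeonhole[of ?U B N]) (use B in \<open>auto simp: M_def\<close>)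
    then have "tsum k B = tsum k (C + replicate_mset N u)"
      using N[OF uC(1)] by (simp only: tsum_union)
    then show "z \<in> {tsum k B | B. size B = M \<and> set_mset B \<subseteq> ?U}"
      using z B uC by (intro CollectI exI[of _ "C + replicate_mset N u"]) (auto split: if_splits)
  next
    fix z assume "z \<in> {tsum k B | B. size B = M \<and> set_mset B \<subseteq> ?U}"
    then obtain B where B: "size B = M" "set_mset B \<subseteq> ?U" and z: "z = tsum k B" by blast
    obtain u C where uC: "u \<in> ?U" "B = C + replicate_mset (Suc N) u"
      by (rule multiset_pigeonhole[of ?U B N]) (use B in \<open>auto simp: M_def\<close>)
    have "tsum k (replicate_mset (Suc (Suc N)) u) = tsum k (replicate_mset (Suc N) u)"
      by (rule tsum_replicate_mono[OF N[OF uC(1)]]) simp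
    then have "tsum k B = tsum k (C + replicate_mset (Suc (Suc N)) u)"
      using uC(2) by (simp only: tsum_union)
    then show "z \<in> {tsum k B | B. size B = Suc M \<and> set_mset B \<subseteq> ?U}"
      using z B uC by (intro CollectI exI[of _ "C + replicate_mset (Suc (Suc N)) u"]) (auto split: if_splits)
  qed
  then show ?case by (metis set_decode_inverse)
qed

text \<open>Each element of \<open>Q\<close> is taken as often as a common threshold says, so one
  more copy of it changes nothing. Aperiodicity is essential here: in a group no element absorbs a
  nontrivial one.\<close>

lemma ex_absorbing_tsum:
  assumes "finite Q"
  obtains A where "set_mset A \<subseteq> Q" "\<And>q. q \<in> Q \<Longrightarrow> tadd k q (tsum k A) = tsum k A"
proof -
  obtain N where N: "\<And>u. u \<in> Q \<Longrightarrow> tsum k (replicate_mset (Suc N) u) = tsum k (replicate_mset N u)"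
    using tsum_stable[OF assms] tsum_aperiodic by metis
  define A where "A = repeat_mset N (mset_set Q)"
  have "tadd k q (tsum k A) = tsum k A" if "q \<in> Q" for q
  proof -
    have "A = repeat_mset N (mset_set (Q - {q})) + replicate_mset N q"
      using assms that by (intro multiset_eqI) (auto simp: A_def count_mset_set')
    then obtain C where A: "A = C + replicate_mset N q" by blast
    have "tadd k q (tsum k A) = tsum k (C + replicate_mset (Suc N) q)"
      unfolding A tsum_union by (simp add: tadd_left_commute)
    then show ?thesis unfolding A tsum_union N[OF that] .
  qed
  moreover have "set_mset A \<subseteq> Q"
  proof
    fix q assume "q \<in># A"
    then have "0 < N * count (mset_set Q) q"
      by (simp only: A_def count_greater_zero_iff[symmetric] count_repeat_mset)
    then show "q \<in> Q" using assms by (simp add: count_mset_set' split: if_splits)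
  qed
  ultimately show ?thesis using that by blast
qed

text \<open>For a fixed number of colours there are finitely many atoms, and a type of rank
  \<open>Suc k\<close> is a set of types of rank \<open>k\<close> with one more colour.\<close>

lemma finite_tp_image: "finite {tp k V E m \<sigma> | V E \<sigma>. finite V}"
proof (induction k arbitrary: m)
  case 0
  have "{tp 0 V E m \<sigma> | V E \<sigma>. finite V} \<subseteq>
      set_encode ` Pow ((\<lambda>(c, i, j). atom_code c i j) ` ({..2} \<times> {..<m} \<times> {..<m}))"
  proof
    fix t assume "t \<in> {tp 0 V E m \<sigma> | V E \<sigma>. finite V}"
    then obtain E \<sigma> where "t = set_encode (atoms E m \<sigma>)" by auto
    then show "t \<in> set_encode ` Pow ((\<lambda>(c, i, j). atom_code c i j) ` ({..2} \<times> {..<m} \<times> {..<m}))"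
      using atoms_subset by (metis PowI imageI)
  qed
  then show ?case by (rule finite_subset) simp
next
  case (Suc k)
  have "{tp (Suc k) V E m \<sigma> | V E \<sigma>. finite V} \<subseteq>
      set_encode ` Pow {tp k V E (Suc m) \<sigma> | V E \<sigma>. finite V}"
  proof
    fix t assume "t \<in> {tp (Suc k) V E m \<sigma> | V E \<sigma>. finite V}"
    then obtain V E \<sigma> where "finite V"
        "t = set_encode ((\<lambda>A. tp k V E (Suc m) (\<sigma>(m := A))) ` Pow V)" by auto
    then show "t \<in> set_encode ` Pow {tp k V E (Suc m) \<sigma> | V E \<sigma>. finite V}"
      by (intro image_eqI[of t set_encode "(\<lambda>A. tp k V E (Suc m) (\<sigma>(m := A))) ` Pow V"]) blast+
  qed
  then show ?case by (rule finite_subset) (intro finite_imageI, unfold finite_Pow_iff, rule Suc)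
qed

lemma tp_Suc_eq_iff:
  assumes "finite V" "finite V'"
  shows "tp (Suc k) V E m \<sigma> = tp (Suc k) V' E' m \<sigma>' \<longleftrightarrow>
    (\<lambda>A. tp k V E (Suc m) (\<sigma>(m := A))) ` Pow V = (\<lambda>A. tp k V' E' (Suc m) (\<sigma>'(m := A))) ` Pow V'"
  using assms by (simp add: set_encode_eq)

lemma tp_Suc_eqD:
  assumes "tp (Suc k) V E m \<sigma> = tp (Suc k) V' E' m \<sigma>'" "finite V" "finite V'" "A \<subseteq> V"
  obtains A' where "A' \<subseteq> V'" "tp k V E (Suc m) (\<sigma>(m := A)) = tp k V' E' (Suc m) (\<sigma>'(m := A'))"
proof -
  have "tp k V E (Suc m) (\<sigma>(m := A)) \<in> (\<lambda>A. tp k V' E' (Suc m) (\<sigma>'(m := A))) ` Pow V'"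
    using assms unfolding tp_Suc_eq_iff[OF assms(2,3)] by blast
  then show ?thesis using that by blast
qed

lemma tp_eq_atoms:
  assumes "tp k V E m \<sigma> = tp k V' E' m \<sigma>'" "finite V" "finite V'"
  shows "atoms E m \<sigma> = atoms E' m \<sigma>'"
  using assms
proof (induction k arbitrary: m \<sigma> \<sigma>')
  case 0
  then show ?case by (simp add: set_encode_eq)
next
  case (Suc k)
  \<comment> \<open>The new colour only serves to go down one rank; the empty set is always
    available.\<close>
  obtain A' where "A' \<subseteq> V'" "tp k V E (Suc m) (\<sigma>(m := {})) = tp k V' E' (Suc m) (\<sigma>'(m := A'))"
    by (rule tp_Suc_eqD[OF Suc.prems empty_subsetI])
  then have "atoms E (Suc m) (\<sigma>(m := {})) = atoms E' (Suc m) (\<sigma>'(m := A'))"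
    using Suc by blast
  note at = atoms_eqD[OF this, OF less_SucI less_SucI]
  show ?case unfolding atoms_eq_iff
  proof (intro allI impI)
    fix i j assume ij: "i < m" "j < m"
    have upd: "(\<sigma>(m := {})) i = \<sigma> i" "(\<sigma>(m := {})) j = \<sigma> j" "(\<sigma>'(m := A')) i = \<sigma>' i" "(\<sigma>'(m := A')) j = \<sigma>' j"
      using ij by simp_all
    show "(\<sigma> i \<inter> \<sigma> j = {} \<longleftrightarrow> \<sigma>' i \<inter> \<sigma>' j = {}) \<and>
      (2 \<le> card (\<sigma> i \<inter> \<sigma> j) \<longleftrightarrow> 2 \<le> card (\<sigma>' i \<inter> \<sigma>' j)) \<and>
      (E \<inter> \<sigma> i \<times> \<sigma> j = {} \<longleftrightarrow> E' \<inter> \<sigma>' i \<times> \<sigma>' j = {})"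
      using at[OF ij, unfolded upd] by argo
  qed
qed

lemma tp_cong:
  assumes "\<And>i. i < m \<Longrightarrow> \<sigma> i = \<sigma>' i"
  shows "tp k V E m \<sigma> = tp k V E m \<sigma>'"
  using assms
proof (induction k arbitrary: m \<sigma> \<sigma>')
  case 0
  have "atoms E m \<sigma> = atoms E m \<sigma>'" unfolding atoms_eq_iff
  proof (intro allI impI)
    fix i j assume "i < m" "j < m"
    from 0[OF this(1)] 0[OF this(2)]
    show "(\<sigma> i \<inter> \<sigma> j = {} \<longleftrightarrow> \<sigma>' i \<inter> \<sigma>' j = {}) \<and>
      (2 \<le> card (\<sigma> i \<inter> \<sigma> j) \<longleftrightarrow> 2 \<le> card (\<sigma>' i \<inter> \<sigma>' j)) \<and>
      (E \<inter> \<sigma> i \<times> \<sigma> j = {} \<longleftrightarrow> E \<inter> \<sigma>' i \<times> \<sigma>' j = {})" by simp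
  qed
  then show ?case by simp
next
  case (Suc k)
  have "tp k V E (Suc m) (\<sigma>(m := A)) = tp k V E (Suc m) (\<sigma>'(m := A))" for A
    by (rule Suc.IH) (auto simp: less_Suc_eq Suc.prems)
  then show ?case by simp
qed

text \<open>The composition theorem of Feferman and Vaught for disjoint unions: a choice of a subset
  of the union is an independent choice in each part.\<close>

lemma tp_union:
  assumes "finite V1" "finite V2" "V1 \<inter> V2 = {}" "E1 \<subseteq> V1 \<times> V1" "E2 \<subseteq> V2 \<times> V2"
    and "\<And>i. i < m \<Longrightarrow> \<sigma>1 i \<subseteq> V1" "\<And>i. i < m \<Longrightarrow> \<sigma>2 i \<subseteq> V2"
  shows "tp k (V1 \<union> V2) (E1 \<union> E2) m (\<lambda>i. \<sigma>1 i \<union> \<sigma>2 i) = tadd k (tp k V1 E1 m \<sigma>1) (tp k V2 E2 m \<sigma>2)"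
  using assms(6,7)
proof (induction k arbitrary: m \<sigma>1 \<sigma>2)
  case 0
  have disj: "\<sigma>1 i \<inter> \<sigma>2 j = {}" "\<sigma>2 j \<inter> \<sigma>1 i = {}" "E1 \<inter> \<sigma>2 j \<times> X = {}" "E1 \<inter> X \<times> \<sigma>2 j = {}"
      "E2 \<inter> \<sigma>1 j \<times> X = {}" "E2 \<inter> X \<times> \<sigma>1 j = {}"
    if "i < m" "j < m" for i j X
    using 0[OF that(1)] 0[OF that(2)] assms(3-5) by blast+
  have card: "card ((\<sigma>1 i \<union> \<sigma>2 i) \<inter> (\<sigma>1 j \<union> \<sigma>2 j)) = card (\<sigma>1 i \<inter> \<sigma>1 j) + card (\<sigma>2 i \<inter> \<sigma>2 j)"
    if "i < m" "j < m" for i j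
  proof -
    have "(\<sigma>1 i \<union> \<sigma>2 i) \<inter> (\<sigma>1 j \<union> \<sigma>2 j) = (\<sigma>1 i \<inter> \<sigma>1 j) \<union> (\<sigma>2 i \<inter> \<sigma>2 j)"
      using disj that by blast
    moreover have "finite (\<sigma>1 i)" "finite (\<sigma>2 i)"
      using finite_subset[OF 0(1)[OF that(1)] assms(1)] finite_subset[OF 0(2)[OF that(1)] assms(2)] .
    moreover have "(\<sigma>1 i \<inter> \<sigma>1 j) \<inter> (\<sigma>2 i \<inter> \<sigma>2 j) = {}"
      using disj(1)[OF that(1,1)] by blast
    ultimately show ?thesis by (simp add: card_Un_disjoint)
  qed
  have ge2: "2 \<le> card A + card B \<longleftrightarrow> 2 \<le> card A \<or> 2 \<le> card B \<or> A \<noteq> {} \<and> B \<noteq> {}"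
    if "finite A" "finite B" for A B :: "nat set"
  proof -
    have "A \<noteq> {} \<longleftrightarrow> 1 \<le> card A" "B \<noteq> {} \<longleftrightarrow> 1 \<le> card B"
      using that by (simp_all add: Suc_le_eq card_gt_0_iff)
    then show ?thesis by linarith
  qed
  have fin: "finite (\<sigma>1 i \<inter> X)" "finite (\<sigma>2 i \<inter> X)" if "i < m" for i X
    using 0 that assms(1,2) by (meson finite_Int finite_subset)+
  have 1: "i < m \<and> j < m \<and> (\<sigma>1 i \<union> \<sigma>2 i) \<inter> (\<sigma>1 j \<union> \<sigma>2 j) \<noteq> {} \<longleftrightarrow>
      (i < m \<and> j < m \<and> \<sigma>1 i \<inter> \<sigma>1 j \<noteq> {}) \<or> (i < m \<and> j < m \<and> \<sigma>2 i \<inter> \<sigma>2 j \<noteq> {})" for i j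
  proof (cases "i < m \<and> j < m")
    case True
    then have "(\<sigma>1 i \<union> \<sigma>2 i) \<inter> (\<sigma>1 j \<union> \<sigma>2 j) = (\<sigma>1 i \<inter> \<sigma>1 j) \<union> (\<sigma>2 i \<inter> \<sigma>2 j)"
      using disj(1,2)[of i j] disj(1,2)[of j i] by blast
    then show ?thesis using True by (simp only: Un_empty) argo
  qed argo
  have 2: "i < m \<and> j < m \<and> 2 \<le> card ((\<sigma>1 i \<union> \<sigma>2 i) \<inter> (\<sigma>1 j \<union> \<sigma>2 j)) \<longleftrightarrow>
      ((i < m \<and> j < m \<and> 2 \<le> card (\<sigma>1 i \<inter> \<sigma>1 j)) \<or> (i < m \<and> j < m \<and> 2 \<le> card (\<sigma>2 i \<inter> \<sigma>2 j))) \<or>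
      ((i < m \<and> j < m \<and> \<sigma>1 i \<inter> \<sigma>1 j \<noteq> {}) \<and> (i < m \<and> j < m \<and> \<sigma>2 i \<inter> \<sigma>2 j \<noteq> {}))" for i j
  proof (cases "i < m \<and> j < m")
    case True
    then show ?thesis by (simp only: card ge2 fin) argo
  qed argo
  have 3: "i < m \<and> j < m \<and> (E1 \<union> E2) \<inter> (\<sigma>1 i \<union> \<sigma>2 i) \<times> (\<sigma>1 j \<union> \<sigma>2 j) \<noteq> {} \<longleftrightarrow>
      (i < m \<and> j < m \<and> E1 \<inter> \<sigma>1 i \<times> \<sigma>1 j \<noteq> {}) \<or> (i < m \<and> j < m \<and> E2 \<inter> \<sigma>2 i \<times> \<sigma>2 j \<noteq> {})" for i j
  proof (cases "i < m \<and> j < m")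
    case True
    then have "(E1 \<union> E2) \<inter> (\<sigma>1 i \<union> \<sigma>2 i) \<times> (\<sigma>1 j \<union> \<sigma>2 j) = (E1 \<inter> \<sigma>1 i \<times> \<sigma>1 j) \<union> (E2 \<inter> \<sigma>2 i \<times> \<sigma>2 j)"
      using disj(3-6)[of i i] disj(3-6)[of j j]
      by (simp add: Sigma_Un_distrib1 Sigma_Un_distrib2 Int_Un_distrib Int_Un_distrib2)
    then show ?thesis using True by (simp only: Un_empty) argo
  qed argo
  have Un: "{f i j | i j. P i j \<or> Q i j} = {f i j | i j. P i j} \<union> {f i j | i j. Q i j}"
    for f :: "nat \<Rightarrow> nat \<Rightarrow> nat" and P Q by blast
  have "atoms (E1 \<union> E2) m (\<lambda>i. \<sigma>1 i \<union> \<sigma>2 i) = atom_merge (atoms E1 m \<sigma>1) (atoms E2 m \<sigma>2)"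
    unfolding atom_merge_def Int_iff atom_code_in_atoms
    unfolding atoms_def 1 2 3 Un by (simp only: Un_ac)
  then show ?case by (simp add: set_encode_inverse)
next
  case (Suc k)
  have step: "tp k (V1 \<union> V2) (E1 \<union> E2) (Suc m) ((\<lambda>i. \<sigma>1 i \<union> \<sigma>2 i)(m := A1 \<union> A2)) =
     tadd k (tp k V1 E1 (Suc m) (\<sigma>1(m := A1))) (tp k V2 E2 (Suc m) (\<sigma>2(m := A2)))"
    if "A1 \<subseteq> V1" "A2 \<subseteq> V2" for A1 A2
  proof -
    have "(\<lambda>i. \<sigma>1 i \<union> \<sigma>2 i)(m := A1 \<union> A2) = (\<lambda>i. (\<sigma>1(m := A1)) i \<union> (\<sigma>2(m := A2)) i)" by (rule ext) simp
    moreover have "tp k (V1 \<union> V2) (E1 \<union> E2) (Suc m) (\<lambda>i. (\<sigma>1(m := A1)) i \<union> (\<sigma>2(m := A2)) i) =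
       tadd k (tp k V1 E1 (Suc m) (\<sigma>1(m := A1))) (tp k V2 E2 (Suc m) (\<sigma>2(m := A2)))"
    proof (rule Suc.IH)
      fix i assume "i < Suc m"
      then show "(\<sigma>1(m := A1)) i \<subseteq> V1" "(\<sigma>2(m := A2)) i \<subseteq> V2"
        using Suc.prems[of i] that by (cases "i = m", simp_all)+
    qed
    ultimately show ?thesis by simp
  qed
  have "Pow (V1 \<union> V2) = (\<lambda>(A1, A2). A1 \<union> A2) ` (Pow V1 \<times> Pow V2)"
  proof (intro equalityI subsetI)
    fix A assume "A \<in> Pow (V1 \<union> V2)"
    then have "A = (A \<inter> V1) \<union> (A \<inter> V2)" "A \<inter> V1 \<subseteq> V1" "A \<inter> V2 \<subseteq> V2" by auto
    then show "A \<in> (\<lambda>(A1, A2). A1 \<union> A2) ` (Pow V1 \<times> Pow V2)" by blast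
  qed auto
  then have "(\<lambda>A. tp k (V1 \<union> V2) (E1 \<union> E2) (Suc m) ((\<lambda>i. \<sigma>1 i \<union> \<sigma>2 i)(m := A))) ` Pow (V1 \<union> V2) =
    (\<lambda>(A1, A2). tadd k (tp k V1 E1 (Suc m) (\<sigma>1(m := A1))) (tp k V2 E2 (Suc m) (\<sigma>2(m := A2)))) ` (Pow V1 \<times> Pow V2)"
    by (simp only: image_image) (intro image_cong refl, clarsimp simp: step simp del: fun_upd_apply)
  also have "\<dots> = (\<lambda>(u, v). tadd k u v) ` (((\<lambda>A. tp k V1 E1 (Suc m) (\<sigma>1(m := A))) ` Pow V1) \<times>
      ((\<lambda>A. tp k V2 E2 (Suc m) (\<sigma>2(m := A))) ` Pow V2))"
    by (force simp: image_iff)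
  finally show ?case using assms(1,2) by (simp add: set_encode_inverse)
qed

lemma tp_iso:
  assumes "inj_on f V" "E \<subseteq> V \<times> V" "\<And>i. i < m \<Longrightarrow> \<sigma> i \<subseteq> V"
  shows "tp k (f ` V) (map_prod f f ` E) m (\<lambda>i. f ` \<sigma> i) = tp k V E m \<sigma>"
  using assms(3)
proof (induction k arbitrary: m \<sigma>)
  case 0
  have "f ` \<sigma> i \<inter> f ` \<sigma> j = f ` (\<sigma> i \<inter> \<sigma> j)" "inj_on f (\<sigma> i \<inter> \<sigma> j)" if "i < m" "j < m" for i j
  proof -
    have "\<sigma> i \<subseteq> V" "\<sigma> j \<subseteq> V" using 0 that by blast+
    then show "f ` \<sigma> i \<inter> f ` \<sigma> j = f ` (\<sigma> i \<inter> \<sigma> j)"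
      by (rule inj_on_image_Int[OF assms(1), symmetric])
    show "inj_on f (\<sigma> i \<inter> \<sigma> j)"
      by (rule inj_on_subset[OF assms(1)]) (use \<open>\<sigma> i \<subseteq> V\<close> in blast)
  qed
  moreover have "map_prod f f ` E \<inter> f ` \<sigma> i \<times> f ` \<sigma> j = map_prod f f ` (E \<inter> \<sigma> i \<times> \<sigma> j)" if "i < m" "j < m" for i j
  proof -
    have "map_prod f f ` E \<inter> map_prod f f ` (\<sigma> i \<times> \<sigma> j) = map_prod f f ` (E \<inter> \<sigma> i \<times> \<sigma> j)"
      proof (rule inj_on_image_Int[symmetric, of _ "V \<times> V"])
        show "\<sigma> i \<times> \<sigma> j \<subseteq> V \<times> V" using 0[OF that(1)] 0[OF that(2)] by blast
      qed (use assms map_prod_inj_on[of f V f V] in auto)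
    then show ?thesis by (simp add: map_prod_surj_on[OF refl refl])
  qed
  ultimately have "atoms (map_prod f f ` E) m (\<lambda>i. f ` \<sigma> i) = atoms E m \<sigma>"
    unfolding atoms_eq_iff by (simp add: card_image)
  then show ?case by simp
next
  case (Suc k)
  have "tp k (f ` V) (map_prod f f ` E) (Suc m) ((\<lambda>i. f ` \<sigma> i)(m := f ` A)) = tp k V E (Suc m) (\<sigma>(m := A))"
    if "A \<subseteq> V" for A
  proof -
    have "(\<lambda>i. f ` \<sigma> i)(m := f ` A) = (\<lambda>i. f ` (\<sigma>(m := A)) i)" by (rule ext) simp
    moreover have "tp k (f ` V) (map_prod f f ` E) (Suc m) (\<lambda>i. f ` (\<sigma>(m := A)) i) = tp k V E (Suc m) (\<sigma>(m := A))"
    proof (rule Suc.IH)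
      fix i assume "i < Suc m"
      then show "(\<sigma>(m := A)) i \<subseteq> V" using Suc.prems[of i] that by (cases "i = m") simp_all
    qed
    ultimately show ?thesis by simp
  qed
  then have "(\<lambda>A. tp k (f ` V) (map_prod f f ` E) (Suc m) ((\<lambda>i. f ` \<sigma> i)(m := A))) ` Pow (f ` V) =
     (\<lambda>A. tp k V E (Suc m) (\<sigma>(m := A))) ` Pow V"
    unfolding image_Pow_surj[OF refl, of f V, symmetric]
    by (simp only: image_image) (intro image_cong refl, simp del: fun_upd_apply)
  then show ?case by simp
qed

section \<open>Joins of structures\<close>

text \<open>Typically \<open>R1\<close> is a single root and \<open>R2\<close> collects the roots of
  many graphs hung onto it. With two singletons a bridge is added.\<close>

definition joinE :: "('a \<times> 'a) set \<Rightarrow> 'a set \<Rightarrow> ('a \<times> 'a) set \<Rightarrow> 'a set \<Rightarrow> ('a \<times> 'a) set" where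
  "joinE E1 R1 E2 R2 = E1 \<union> E2 \<union> R1 \<times> R2 \<union> R2 \<times> R1"

lemma joinE_commute: "joinE E1 R1 E2 R2 = joinE E2 R2 E1 R1"
  by (auto simp: joinE_def)

lemma joinE_Un: "joinE E1 R (E2 \<union> E3) (R2 \<union> R3) = joinE (joinE E1 R E2 R2) R E3 R3"
  by (auto simp: joinE_def)

text \<open>A new edge runs between two colours iff one colour meets the roots on one side and the
  other colour the roots on the other side. So the atoms of the join are determined by those of its
  parts once the roots are a colour themselves.\<close>

lemma atoms_join:
  fixes V1 V2 :: "nat set"
  assumes "finite V1" "finite V2" "V1 \<inter> V2 = {}" "E1 \<subseteq> V1 \<times> V1" "E2 \<subseteq> V2 \<times> V2"
    and "R1 \<subseteq> V1" "R2 \<subseteq> V2" "S1 \<subseteq> V1" "T1 \<subseteq> V1" "S2 \<subseteq> V2" "T2 \<subseteq> V2"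
  shows "(S1 \<union> S2) \<inter> (T1 \<union> T2) = {} \<longleftrightarrow> S1 \<inter> T1 = {} \<and> S2 \<inter> T2 = {}"
    and "2 \<le> card ((S1 \<union> S2) \<inter> (T1 \<union> T2)) \<longleftrightarrow> 2 \<le> card (S1 \<inter> T1) \<or> 2 \<le> card (S2 \<inter> T2) \<or>
           S1 \<inter> T1 \<noteq> {} \<and> S2 \<inter> T2 \<noteq> {}"
    and "joinE E1 R1 E2 R2 \<inter> (S1 \<union> S2) \<times> (T1 \<union> T2) = {} \<longleftrightarrow>
           E1 \<inter> S1 \<times> T1 = {} \<and> E2 \<inter> S2 \<times> T2 = {} \<and>
           (R1 \<inter> S1 = {} \<or> R2 \<inter> T2 = {}) \<and> (R2 \<inter> S2 = {} \<or> R1 \<inter> T1 = {})"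
proof -
  have eq: "(S1 \<union> S2) \<inter> (T1 \<union> T2) = (S1 \<inter> T1) \<union> (S2 \<inter> T2)"
  proof -
    have "S1 \<inter> T2 = {}" "S2 \<inter> T1 = {}" using assms(3,8-11) by blast+
    then show ?thesis by (simp add: Int_Un_distrib Int_Un_distrib2)
  qed
  show "(S1 \<union> S2) \<inter> (T1 \<union> T2) = {} \<longleftrightarrow> S1 \<inter> T1 = {} \<and> S2 \<inter> T2 = {}"
    unfolding eq by simp
  have fin: "finite (S1 \<inter> T1)" "finite (S2 \<inter> T2)" "(S1 \<inter> T1) \<inter> (S2 \<inter> T2) = {}"
    using finite_subset[OF assms(8,1)] finite_subset[OF assms(10,2)] assms(3,8,10) by blast+
  have "S1 \<inter> T1 \<noteq> {} \<longleftrightarrow> 1 \<le> card (S1 \<inter> T1)" "S2 \<inter> T2 \<noteq> {} \<longleftrightarrow> 1 \<le> card (S2 \<inter> T2)"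
    using fin(1,2) by (simp_all add: Suc_le_eq card_gt_0_iff)
  then show "2 \<le> card ((S1 \<union> S2) \<inter> (T1 \<union> T2)) \<longleftrightarrow> 2 \<le> card (S1 \<inter> T1) \<or> 2 \<le> card (S2 \<inter> T2) \<or>
           S1 \<inter> T1 \<noteq> {} \<and> S2 \<inter> T2 \<noteq> {}"
    unfolding eq card_Un_disjoint[OF fin] by linarith
  have E: "E1 \<inter> (S1 \<union> S2) \<times> (T1 \<union> T2) = E1 \<inter> S1 \<times> T1"
    using assms(3,4,10,11) by blast
  have E': "E2 \<inter> (S1 \<union> S2) \<times> (T1 \<union> T2) = E2 \<inter> S2 \<times> T2"
    using assms(3,5,8,9) by blast
  have R1: "R1 \<inter> (S1 \<union> S2) = R1 \<inter> S1" "R1 \<inter> (T1 \<union> T2) = R1 \<inter> T1"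
    using assms(3,6,10,11) by blast+
  have R2: "R2 \<inter> (S1 \<union> S2) = R2 \<inter> S2" "R2 \<inter> (T1 \<union> T2) = R2 \<inter> T2"
    using assms(3,7,8,9) by blast+
  show "joinE E1 R1 E2 R2 \<inter> (S1 \<union> S2) \<times> (T1 \<union> T2) = {} \<longleftrightarrow>
           E1 \<inter> S1 \<times> T1 = {} \<and> E2 \<inter> S2 \<times> T2 = {} \<and>
           (R1 \<inter> S1 = {} \<or> R2 \<inter> T2 = {}) \<and> (R2 \<inter> S2 = {} \<or> R1 \<inter> T1 = {})"
    unfolding joinE_def Int_Un_distrib2 Un_empty E E' Times_Int_Times R1 R2 Times_empty by argo
qed

text \<open>Colour \<open>0\<close> marks the vertices that are joined. In the join it keeps only the part in the left
  structure; with an empty left structure this erases the marks of the right one.\<close>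

lemma tp_join_cong:
  fixes V1 V2 V2' :: "nat set"
  assumes "finite V1" "finite V2" "finite V2'" "V1 \<inter> V2 = {}" "V1 \<inter> V2' = {}"
    and "E1 \<subseteq> V1 \<times> V1" "E2 \<subseteq> V2 \<times> V2" "E2' \<subseteq> V2' \<times> V2'"
    and "0 < m" "\<And>i. i < m \<Longrightarrow> \<sigma>1 i \<subseteq> V1" "\<And>i. i < m \<Longrightarrow> \<sigma>2 i \<subseteq> V2" "\<And>i. i < m \<Longrightarrow> \<sigma>2' i \<subseteq> V2'"
    and "tp k V2 E2 m \<sigma>2 = tp k V2' E2' m \<sigma>2'"
  shows "tp k (V1 \<union> V2) (joinE E1 (\<sigma>1 0) E2 (\<sigma>2 0)) m (\<lambda>i. \<sigma>1 i \<union> (if i = 0 then {} else \<sigma>2 i)) =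
    tp k (V1 \<union> V2') (joinE E1 (\<sigma>1 0) E2' (\<sigma>2' 0)) m (\<lambda>i. \<sigma>1 i \<union> (if i = 0 then {} else \<sigma>2' i))"
  using assms(9-13)
proof (induction k arbitrary: m \<sigma>1 \<sigma>2 \<sigma>2')
  case 0
  have "atoms E2 m \<sigma>2 = atoms E2' m \<sigma>2'" using tp_eq_atoms 0(5) assms(2,3) by blast
  then have at: "(\<sigma>2 i \<inter> \<sigma>2 j = {} \<longleftrightarrow> \<sigma>2' i \<inter> \<sigma>2' j = {})"
      "(2 \<le> card (\<sigma>2 i \<inter> \<sigma>2 j) \<longleftrightarrow> 2 \<le> card (\<sigma>2' i \<inter> \<sigma>2' j))"
      "(E2 \<inter> \<sigma>2 i \<times> \<sigma>2 j = {} \<longleftrightarrow> E2' \<inter> \<sigma>2' i \<times> \<sigma>2' j = {})"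
    if "i < m" "j < m" for i j using that by (rule atoms_eqD)+
  have "atoms (joinE E1 (\<sigma>1 0) E2 (\<sigma>2 0)) m (\<lambda>i. \<sigma>1 i \<union> (if i = 0 then {} else \<sigma>2 i)) =
    atoms (joinE E1 (\<sigma>1 0) E2' (\<sigma>2' 0)) m (\<lambda>i. \<sigma>1 i \<union> (if i = 0 then {} else \<sigma>2' i))"
    unfolding atoms_eq_iff
  proof (intro allI impI)
    fix i j assume ij: "i < m" "j < m"
    define S2 T2 S2' T2' where def: "S2 = (if i = 0 then {} else \<sigma>2 i)" "T2 = (if j = 0 then {} else \<sigma>2 j)"
      "S2' = (if i = 0 then {} else \<sigma>2' i)" "T2' = (if j = 0 then {} else \<sigma>2' j)"
    \<comment> \<open>The intersections with the roots come from the atoms with first index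
      \<open>0\<close>, which exist because \<open>0 < m\<close>.\<close>
    have eqs: "S2 \<inter> T2 = {} \<longleftrightarrow> S2' \<inter> T2' = {}" "2 \<le> card (S2 \<inter> T2) \<longleftrightarrow> 2 \<le> card (S2' \<inter> T2')"
      "E2 \<inter> S2 \<times> T2 = {} \<longleftrightarrow> E2' \<inter> S2' \<times> T2' = {}"
      "\<sigma>2 0 \<inter> T2 = {} \<longleftrightarrow> \<sigma>2' 0 \<inter> T2' = {}" "\<sigma>2 0 \<inter> S2 = {} \<longleftrightarrow> \<sigma>2' 0 \<inter> S2' = {}"
      unfolding def using at ij 0(1) by simp_all
    have sub: "\<sigma>1 i \<subseteq> V1" "\<sigma>1 j \<subseteq> V1" "S2 \<subseteq> V2" "T2 \<subseteq> V2" "S2' \<subseteq> V2'" "T2' \<subseteq> V2'"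
      "\<sigma>1 0 \<subseteq> V1" "\<sigma>2 0 \<subseteq> V2" "\<sigma>2' 0 \<subseteq> V2'"
      unfolding def using 0 ij by auto
    note l = atoms_join[OF assms(1,2,4,6,7) sub(7,8,1,2,3,4)]
    note r = atoms_join[OF assms(1,3,5,6,8) sub(7,9,1,2,5,6)]
    show "((\<sigma>1 i \<union> (if i = 0 then {} else \<sigma>2 i)) \<inter> (\<sigma>1 j \<union> (if j = 0 then {} else \<sigma>2 j)) = {} \<longleftrightarrow>
        (\<sigma>1 i \<union> (if i = 0 then {} else \<sigma>2' i)) \<inter> (\<sigma>1 j \<union> (if j = 0 then {} else \<sigma>2' j)) = {}) \<and>
      (2 \<le> card ((\<sigma>1 i \<union> (if i = 0 then {} else \<sigma>2 i)) \<inter> (\<sigma>1 j \<union> (if j = 0 then {} else \<sigma>2 j))) \<longleftrightarrow>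
        2 \<le> card ((\<sigma>1 i \<union> (if i = 0 then {} else \<sigma>2' i)) \<inter> (\<sigma>1 j \<union> (if j = 0 then {} else \<sigma>2' j)))) \<and>
      (joinE E1 (\<sigma>1 0) E2 (\<sigma>2 0) \<inter> (\<sigma>1 i \<union> (if i = 0 then {} else \<sigma>2 i)) \<times> (\<sigma>1 j \<union> (if j = 0 then {} else \<sigma>2 j)) = {} \<longleftrightarrow>
        joinE E1 (\<sigma>1 0) E2' (\<sigma>2' 0) \<inter> (\<sigma>1 i \<union> (if i = 0 then {} else \<sigma>2' i)) \<times> (\<sigma>1 j \<union> (if j = 0 then {} else \<sigma>2' j)) = {})"
      unfolding def[symmetric] l r eqs by argo
  qed
  then show ?case by simp
next
  case (Suc k)
  let ?\<tau> = "\<lambda>\<sigma>2 i. \<sigma>1 i \<union> (if i = 0 then {} else \<sigma>2 i)"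
  have key: "tp k (V1 \<union> V2) (joinE E1 (\<sigma>1 0) E2 (\<sigma>2 0)) (Suc m) ((?\<tau> \<sigma>2)(m := A1 \<union> A2)) =
      tp k (V1 \<union> V2') (joinE E1 (\<sigma>1 0) E2' (\<sigma>2' 0)) (Suc m) ((?\<tau> \<sigma>2')(m := A1 \<union> A2'))"
    if A: "A1 \<subseteq> V1" "A2 \<subseteq> V2" "A2' \<subseteq> V2'" and eq: "tp k V2 E2 (Suc m) (\<sigma>2(m := A2)) = tp k V2' E2' (Suc m) (\<sigma>2'(m := A2'))"
    for A1 A2 A2'
  proof -
    have upd: "(?\<tau> \<sigma>)(m := A1 \<union> B) = (\<lambda>i. (\<sigma>1(m := A1)) i \<union> (if i = 0 then {} else (\<sigma>(m := B)) i))" for \<sigma> B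
      using Suc.prems(1) by (intro ext) simp
    have z: "\<sigma>1 0 = (\<sigma>1(m := A1)) 0" "\<sigma>2 0 = (\<sigma>2(m := A2)) 0" "\<sigma>2' 0 = (\<sigma>2'(m := A2')) 0"
      using Suc.prems(1) by simp_all
    have "tp k (V1 \<union> V2) (joinE E1 ((\<sigma>1(m := A1)) 0) E2 ((\<sigma>2(m := A2)) 0)) (Suc m) (\<lambda>i. (\<sigma>1(m := A1)) i \<union> (if i = 0 then {} else (\<sigma>2(m := A2)) i)) =
      tp k (V1 \<union> V2') (joinE E1 ((\<sigma>1(m := A1)) 0) E2' ((\<sigma>2'(m := A2')) 0)) (Suc m) (\<lambda>i. (\<sigma>1(m := A1)) i \<union> (if i = 0 then {} else (\<sigma>2'(m := A2')) i))"
    proof (rule Suc.IH[OF _ _ _ _ eq])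
      fix i assume "i < Suc m"
      then show "(\<sigma>1(m := A1)) i \<subseteq> V1" "(\<sigma>2(m := A2)) i \<subseteq> V2" "(\<sigma>2'(m := A2')) i \<subseteq> V2'"
        using Suc.prems(2-4)[of i] A by (cases "i = m", simp_all)+
    qed simp
    then show ?thesis unfolding upd z[symmetric] .
  qed
  show ?case
    unfolding tp_Suc_eq_iff[OF finite_UnI[OF assms(1,2)] finite_UnI[OF assms(1,3)]]
  proof (intro equalityI subsetI)
    fix t assume "t \<in> (\<lambda>A. tp k (V1 \<union> V2) (joinE E1 (\<sigma>1 0) E2 (\<sigma>2 0)) (Suc m) ((?\<tau> \<sigma>2)(m := A))) ` Pow (V1 \<union> V2)"
    then obtain A where A: "A \<subseteq> V1 \<union> V2" and t: "t = tp k (V1 \<union> V2) (joinE E1 (\<sigma>1 0) E2 (\<sigma>2 0)) (Suc m) ((?\<tau> \<sigma>2)(m := A))"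
      by blast
    \<comment> \<open>The part of \<open>A\<close> in the common structure \<open>V1\<close> is
      kept, and the part in \<open>V2\<close> is answered through the equality of types.\<close>
    obtain A2' where A2': "A2' \<subseteq> V2'" "tp k V2 E2 (Suc m) (\<sigma>2(m := A \<inter> V2)) = tp k V2' E2' (Suc m) (\<sigma>2'(m := A2'))"
      using tp_Suc_eqD[OF Suc.prems(5) assms(2,3), of "A \<inter> V2"] by blast
    have "A \<inter> V1 \<union> A \<inter> V2 = A" using A by blast
    then have "t = tp k (V1 \<union> V2') (joinE E1 (\<sigma>1 0) E2' (\<sigma>2' 0)) (Suc m) ((?\<tau> \<sigma>2')(m := (A \<inter> V1) \<union> A2'))"
      using key[of "A \<inter> V1", OF Int_lower2 Int_lower2 A2'] t by simp
    then show "t \<in> (\<lambda>A. tp k (V1 \<union> V2') (joinE E1 (\<sigma>1 0) E2' (\<sigma>2' 0)) (Suc m) ((?\<tau> \<sigma>2')(m := A))) ` Pow (V1 \<union> V2')"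
      using A2'(1) by (intro image_eqI) blast+
  next
    fix t assume "t \<in> (\<lambda>A. tp k (V1 \<union> V2') (joinE E1 (\<sigma>1 0) E2' (\<sigma>2' 0)) (Suc m) ((?\<tau> \<sigma>2')(m := A))) ` Pow (V1 \<union> V2')"
    then obtain A where A: "A \<subseteq> V1 \<union> V2'" and t: "t = tp k (V1 \<union> V2') (joinE E1 (\<sigma>1 0) E2' (\<sigma>2' 0)) (Suc m) ((?\<tau> \<sigma>2')(m := A))"
      by blast
    obtain A2 where A2: "A2 \<subseteq> V2" "tp k V2' E2' (Suc m) (\<sigma>2'(m := A \<inter> V2')) = tp k V2 E2 (Suc m) (\<sigma>2(m := A2))"
      using tp_Suc_eqD[OF Suc.prems(5)[symmetric] assms(3,2), of "A \<inter> V2'"] by blast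
    have "A \<inter> V1 \<union> A \<inter> V2' = A" using A by blast
    then have "t = tp k (V1 \<union> V2) (joinE E1 (\<sigma>1 0) E2 (\<sigma>2 0)) (Suc m) ((?\<tau> \<sigma>2)(m := (A \<inter> V1) \<union> A2))"
      using key[of "A \<inter> V1", OF Int_lower2 A2(1) Int_lower2 A2(2)[symmetric]] t by simp
    then show "t \<in> (\<lambda>A. tp k (V1 \<union> V2) (joinE E1 (\<sigma>1 0) E2 (\<sigma>2 0)) (Suc m) ((?\<tau> \<sigma>2)(m := A))) ` Pow (V1 \<union> V2)"
      using A2(1) by (intro image_eqI) blast+
  qed
qed

section \<open>Types determine the truth of formulas\<close>

primrec qr :: "mso \<Rightarrow> nat" where
  "qr (Mem x X) = 0"
| "qr (Edge x y) = 0"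
| "qr (Neg \<phi>) = qr \<phi>"
| "qr (Conj \<phi> \<psi>) = max (qr \<phi>) (qr \<psi>)"
| "qr (Disj \<phi> \<psi>) = max (qr \<phi>) (qr \<psi>)"
| "qr (Ex_elem x \<phi>) = Suc (qr \<phi>)"
| "qr (All_elem x \<phi>) = Suc (qr \<phi>)"
| "qr (Ex_set X \<phi>) = Suc (qr \<phi>)"
| "qr (All_set X \<phi>) = Suc (qr \<phi>)"

text \<open>Element variables are represented by singleton colours.\<close>

definition coded :: "mso \<Rightarrow> nat \<Rightarrow> (nat \<Rightarrow> nat set) \<Rightarrow> (nat \<Rightarrow> nat) \<Rightarrow> (nat \<Rightarrow> nat set) \<Rightarrow>
    (nat \<Rightarrow> nat) \<Rightarrow> (nat \<Rightarrow> nat) \<Rightarrow> bool" where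
  "coded \<phi> m \<sigma> e s ix jx \<longleftrightarrow>
     (\<forall>x \<in> free_elem \<phi>. ix x < m \<and> \<sigma> (ix x) = {e x}) \<and> (\<forall>X \<in> free_set \<phi>. jx X < m \<and> \<sigma> (jx X) = s X)"

lemma coded_elem:
  assumes "coded (Ex_elem x \<phi>) m \<sigma> e s ix jx"
  shows "coded \<phi> (Suc m) (\<sigma>(m := {a})) (e(x := a)) s (ix(x := m)) jx"
proof -
  have "ix y < m" "ix y \<noteq> m" "\<sigma> (ix y) = {e y}" if "y \<in> free_elem \<phi>" "y \<noteq> x" for y
    using assms that by (auto simp: coded_def)
  moreover have "jx X < m" "jx X \<noteq> m" "\<sigma> (jx X) = s X" if "X \<in> free_set \<phi>" for X
    using assms that by (auto simp: coded_def)
  ultimately show ?thesis unfolding coded_def by (simp add: less_SucI)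
qed

lemma coded_set:
  assumes "coded (Ex_set X \<phi>) m \<sigma> e s ix jx"
  shows "coded \<phi> (Suc m) (\<sigma>(m := A)) e (s(X := A)) ix (jx(X := m))"
proof -
  have "ix y < m" "ix y \<noteq> m" "\<sigma> (ix y) = {e y}" if "y \<in> free_elem \<phi>" for y
    using assms that by (auto simp: coded_def)
  moreover have "jx Y < m" "jx Y \<noteq> m" "\<sigma> (jx Y) = s Y" if "Y \<in> free_set \<phi>" "Y \<noteq> X" for Y
    using assms that by (auto simp: coded_def)
  ultimately show ?thesis unfolding coded_def by (simp add: less_SucI)
qed

text \<open>The atoms of the last colour with itself say that it is nonempty and does not have two
  elements, so only a singleton can answer a singleton.\<close>

lemma tp_eq_singleton:
  assumes "tp k V E (Suc m) (\<sigma>(m := {a})) = tp k V' E' (Suc m) (\<sigma>'(m := A'))" "finite V" "finite V'" "A' \<subseteq> V'"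
  obtains a' where "a' \<in> V'" "A' = {a'}"
proof -
  have "atoms E (Suc m) (\<sigma>(m := {a})) = atoms E' (Suc m) (\<sigma>'(m := A'))"
    using tp_eq_atoms[OF assms(1-3)] .
  then have "((\<sigma>(m := {a})) m \<inter> (\<sigma>(m := {a})) m = {} \<longleftrightarrow> (\<sigma>'(m := A')) m \<inter> (\<sigma>'(m := A')) m = {}) \<and>
     (2 \<le> card ((\<sigma>(m := {a})) m \<inter> (\<sigma>(m := {a})) m) \<longleftrightarrow> 2 \<le> card ((\<sigma>'(m := A')) m \<inter> (\<sigma>'(m := A')) m))"
    unfolding atoms_eq_iff by blast
  then have "A' \<noteq> {}" "\<not> 2 \<le> card A'" by simp_all
  moreover have "finite A'" using assms(3,4) by (rule finite_subset[rotated])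
  ultimately have "card A' = 1" by (metis One_nat_def Suc_leI card_gt_0_iff le_antisym not_less_eq_eq numeral_2_eq_2)
  then obtain a' where "A' = {a'}" by (rule card_1_singletonE)
  with assms(4) that show ?thesis by blast
qed

lemma back_and_forth:
  assumes "\<And>a. D a \<Longrightarrow> \<exists>a'. D' a' \<and> P a = P' a'" "\<And>a'. D' a' \<Longrightarrow> \<exists>a. D a \<and> P a = P' a'"
  shows "(\<exists>a. D a \<and> P a) \<longleftrightarrow> (\<exists>a'. D' a' \<and> P' a')" "(\<forall>a. D a \<longrightarrow> P a) \<longleftrightarrow> (\<forall>a'. D' a' \<longrightarrow> P' a')"
  using assms by metis+

lemma tp_quantify_set:
  assumes eq: "tp (Suc k) V E m \<sigma> = tp (Suc k) V' E' m \<sigma>'" and fin: "finite V" "finite V'"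
    and Q: "\<And>A A'. tp k V E (Suc m) (\<sigma>(m := A)) = tp k V' E' (Suc m) (\<sigma>'(m := A')) \<Longrightarrow> Q A \<longleftrightarrow> Q' A'"
  shows "(\<exists>A. A \<subseteq> V \<and> Q A) \<longleftrightarrow> (\<exists>A. A \<subseteq> V' \<and> Q' A)" "(\<forall>A. A \<subseteq> V \<longrightarrow> Q A) \<longleftrightarrow> (\<forall>A. A \<subseteq> V' \<longrightarrow> Q' A)"
proof -
  have 1: "\<exists>A'. A' \<subseteq> V' \<and> Q A = Q' A'" if A: "A \<subseteq> V" for A
    using tp_Suc_eqD[OF eq fin A] Q by metis
  have 2: "\<exists>A. A \<subseteq> V \<and> Q A = Q' A'" if A: "A' \<subseteq> V'" for A'
    using tp_Suc_eqD[OF eq[symmetric] fin(2,1) A] Q by metis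
  show "(\<exists>A. A \<subseteq> V \<and> Q A) \<longleftrightarrow> (\<exists>A. A \<subseteq> V' \<and> Q' A)" by (rule back_and_forth(1)[OF 1 2])
  show "(\<forall>A. A \<subseteq> V \<longrightarrow> Q A) \<longleftrightarrow> (\<forall>A. A \<subseteq> V' \<longrightarrow> Q' A)" by (rule back_and_forth(2)[OF 1 2])
qed

lemma tp_quantify_elem:
  assumes eq: "tp (Suc k) V E m \<sigma> = tp (Suc k) V' E' m \<sigma>'" and fin: "finite V" "finite V'"
    and Q: "\<And>a a'. tp k V E (Suc m) (\<sigma>(m := {a})) = tp k V' E' (Suc m) (\<sigma>'(m := {a'})) \<Longrightarrow> Q a \<longleftrightarrow> Q' a'"
  shows "(\<exists>a. a \<in> V \<and> Q a) \<longleftrightarrow> (\<exists>a. a \<in> V' \<and> Q' a)" "(\<forall>a. a \<in> V \<longrightarrow> Q a) \<longleftrightarrow> (\<forall>a. a \<in> V' \<longrightarrow> Q' a)"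
proof -
  have 1: "\<exists>a'. a' \<in> V' \<and> Q a = Q' a'" if "a \<in> V" for a
  proof -
    have "{a} \<subseteq> V" using that by simp
    then obtain A' where A': "A' \<subseteq> V'" "tp k V E (Suc m) (\<sigma>(m := {a})) = tp k V' E' (Suc m) (\<sigma>'(m := A'))"
      using tp_Suc_eqD[OF eq fin] by metis
    obtain a' where a': "a' \<in> V'" "A' = {a'}" by (rule tp_eq_singleton[OF A'(2) fin A'(1)])
    show ?thesis using Q[OF A'(2)[unfolded a'(2)]] a'(1) by blast
  qed
  have 2: "\<exists>a. a \<in> V \<and> Q a = Q' a'" if "a' \<in> V'" for a'
  proof -
    have "{a'} \<subseteq> V'" using that by simp
    then obtain A where A: "A \<subseteq> V" "tp k V' E' (Suc m) (\<sigma>'(m := {a'})) = tp k V E (Suc m) (\<sigma>(m := A))"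
      using tp_Suc_eqD[OF eq[symmetric] fin(2,1)] by metis
    obtain a where a: "a \<in> V" "A = {a}" by (rule tp_eq_singleton[OF A(2) fin(2,1) A(1)])
    show ?thesis using Q[OF A(2)[unfolded a(2), symmetric]] a(1) by blast
  qed
  show "(\<exists>a. a \<in> V \<and> Q a) \<longleftrightarrow> (\<exists>a. a \<in> V' \<and> Q' a)" by (rule back_and_forth(1)[OF 1 2])
  show "(\<forall>a. a \<in> V \<longrightarrow> Q a) \<longleftrightarrow> (\<forall>a. a \<in> V' \<longrightarrow> Q' a)" by (rule back_and_forth(2)[OF 1 2])
qed

text \<open>The Ehrenfeucht-Fraisse argument for MSO. An element quantifier is a set quantifier
  restricted to singletons, so both kinds use up one rank.\<close>

lemma sat_tp_eq:
  assumes "finite V" "finite V'" "tp k V E m \<sigma> = tp k V' E' m \<sigma>'" "qr \<phi> \<le> k"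
    and "coded \<phi> m \<sigma> e s ix jx" "coded \<phi> m \<sigma>' e' s' ix jx"
  shows "sat \<lparr>pverts = V, parcs = E\<rparr> \<phi> e s \<longleftrightarrow> sat \<lparr>pverts = V', parcs = E'\<rparr> \<phi> e' s'"
  using assms(3-)
proof (induction \<phi> arbitrary: k m \<sigma> \<sigma>' e s e' s' ix jx)
  case (Mem x X)
  have "atoms E m \<sigma> = atoms E' m \<sigma>'" using tp_eq_atoms[OF Mem(1) assms(1,2)] .
  moreover have "ix x < m" "jx X < m" using Mem by (simp_all add: coded_def)
  ultimately have *: "\<sigma> (ix x) \<inter> \<sigma> (jx X) = {} \<longleftrightarrow> \<sigma>' (ix x) \<inter> \<sigma>' (jx X) = {}"
    by (rule atoms_eqD(1))
  have "\<sigma> (ix x) = {e x}" "\<sigma> (jx X) = s X" "\<sigma>' (ix x) = {e' x}" "\<sigma>' (jx X) = s' X"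
    using Mem(3,4) by (simp_all add: coded_def)
  note * [unfolded this]
  then have "e x \<in> s X \<longleftrightarrow> e' x \<in> s' X" by blast
  then show ?case by simp
next
  case (Edge x y)
  have "atoms E m \<sigma> = atoms E' m \<sigma>'" using tp_eq_atoms[OF Edge(1) assms(1,2)] .
  moreover have "ix x < m" "ix y < m" using Edge by (simp_all add: coded_def)
  ultimately have "E \<inter> \<sigma> (ix x) \<times> \<sigma> (ix y) = {} \<longleftrightarrow> E' \<inter> \<sigma>' (ix x) \<times> \<sigma>' (ix y) = {}" by (rule atoms_eqD(3))
  then show ?case using Edge by (simp add: coded_def)
next
  case (Neg \<phi>)
  then show ?case using Neg.IH[OF Neg.prems(1)] by (simp add: coded_def)
next
  case (Conj \<phi> \<psi>)
  have "coded \<phi> m \<sigma> e s ix jx" "coded \<phi> m \<sigma>' e' s' ix jx" "coded \<psi> m \<sigma> e s ix jx" "coded \<psi> m \<sigma>' e' s' ix jx"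
    using Conj.prems by (simp_all add: coded_def)
  then show ?case using Conj.IH(1)[OF Conj.prems(1)] Conj.IH(2)[OF Conj.prems(1)] Conj.prems(2) by simp
next
  case (Disj \<phi> \<psi>)
  have "coded \<phi> m \<sigma> e s ix jx" "coded \<phi> m \<sigma>' e' s' ix jx" "coded \<psi> m \<sigma> e s ix jx" "coded \<psi> m \<sigma>' e' s' ix jx"
    using Disj.prems by (simp_all add: coded_def)
  then show ?case using Disj.IH(1)[OF Disj.prems(1)] Disj.IH(2)[OF Disj.prems(1)] Disj.prems(2) by simp
next
  case (Ex_elem x \<phi>)
  obtain k' where k: "k = Suc k'" "qr \<phi> \<le> k'" using Ex_elem.prems(2) by (cases k) auto
  show ?case unfolding sat.simps pair_pre_digraph.select_convs Bex_def Ball_def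
    by (rule tp_quantify_elem(1)[OF Ex_elem.prems(1)[unfolded k(1)] assms(1,2)])
      (rule Ex_elem.IH[OF _ k(2) coded_elem[OF Ex_elem.prems(3)] coded_elem[OF Ex_elem.prems(4)]])
next
  case (All_elem x \<phi>)
  have co: "coded (Ex_elem x \<phi>) m \<sigma> e s ix jx" "coded (Ex_elem x \<phi>) m \<sigma>' e' s' ix jx"
    using All_elem.prems by (simp_all add: coded_def)
  obtain k' where k: "k = Suc k'" "qr \<phi> \<le> k'" using All_elem.prems(2) by (cases k) auto
  show ?case unfolding sat.simps pair_pre_digraph.select_convs Bex_def Ball_def
    by (rule tp_quantify_elem(2)[OF All_elem.prems(1)[unfolded k(1)] assms(1,2)])
      (rule All_elem.IH[OF _ k(2) coded_elem[OF co(1)] coded_elem[OF co(2)]])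
next
  case (Ex_set X \<phi>)
  obtain k' where k: "k = Suc k'" "qr \<phi> \<le> k'" using Ex_set.prems(2) by (cases k) auto
  show ?case unfolding sat.simps pair_pre_digraph.select_convs Bex_def Ball_def
    by (rule tp_quantify_set(1)[OF Ex_set.prems(1)[unfolded k(1)] assms(1,2)])
      (rule Ex_set.IH[OF _ k(2) coded_set[OF Ex_set.prems(3)] coded_set[OF Ex_set.prems(4)]])
next
  case (All_set X \<phi>)
  have co: "coded (Ex_set X \<phi>) m \<sigma> e s ix jx" "coded (Ex_set X \<phi>) m \<sigma>' e' s' ix jx"
    using All_set.prems by (simp_all add: coded_def)
  obtain k' where k: "k = Suc k'" "qr \<phi> \<le> k'" using All_set.prems(2) by (cases k) auto
  show ?case unfolding sat.simps pair_pre_digraph.select_convs Bex_def Ball_def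
    by (rule tp_quantify_set(2)[OF All_set.prems(1)[unfolded k(1)] assms(1,2)])
      (rule All_set.IH[OF _ k(2) coded_set[OF co(1)] coded_set[OF co(2)]])
qed

section \<open>Graphs and components\<close>

definition ugraph :: "'a set \<Rightarrow> ('a \<times> 'a) set \<Rightarrow> bool" where
  "ugraph V E \<longleftrightarrow> finite V \<and> E \<subseteq> V \<times> V \<and> sym E \<and> irrefl E"

definition component_of :: "('a \<times> 'a) set \<Rightarrow> 'a \<Rightarrow> 'a set" where
  "component_of E x = E\<^sup>* `` {x}"

definition conn :: "'a set \<Rightarrow> ('a \<times> 'a) set \<Rightarrow> bool" where
  "conn V E \<longleftrightarrow> V \<noteq> {} \<and> (\<forall>x\<in>V. component_of E x = V)"

abbreviation induced :: "('a \<times> 'a) set \<Rightarrow> 'a set \<Rightarrow> ('a \<times> 'a) set" where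
  "induced E S \<equiv> E \<inter> S \<times> S"

lemma ugraphD:
  assumes "ugraph V E"
  shows "finite V" "E \<subseteq> V \<times> V" "sym E" "irrefl E" "finite E"
  using assms finite_subset[of E "V \<times> V"] by (auto simp: ugraph_def)

lemma in_comp_iff: "y \<in> component_of E x \<longleftrightarrow> (x, y) \<in> E\<^sup>*"
  by (simp add: component_of_def)

lemma self_in_comp [simp]: "x \<in> component_of E x"
  by (simp add: component_of_def)

lemma comp_subset_closed:
  assumes "E `` S \<subseteq> S" "x \<in> S"
  shows "component_of E x \<subseteq> S"
  using Image_closed_trancl[OF assms(1)] assms(2) unfolding component_of_def by blast

lemma comp_subset: "E \<subseteq> V \<times> V \<Longrightarrow> x \<in> V \<Longrightarrow> component_of E x \<subseteq> V"
  by (rule comp_subset_closed) blast+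

lemma comp_closed: "y \<in> component_of E x \<Longrightarrow> (y, z) \<in> E \<Longrightarrow> z \<in> component_of E x"
  unfolding component_of_def by (meson ImageE ImageI rtrancl.rtrancl_into_rtrancl)

lemma comp_mono: "E \<subseteq> E' \<Longrightarrow> component_of E x \<subseteq> component_of E' x"
  unfolding component_of_def using rtrancl_mono by blast

lemma comp_sym:
  assumes "sym E" "y \<in> component_of E x"
  shows "x \<in> component_of E y"
  using assms sym_rtrancl unfolding in_comp_iff by (metis symD)

lemma comp_eq:
  assumes "sym E" "y \<in> component_of E x"
  shows "component_of E y = component_of E x"
  using assms comp_sym[OF assms] unfolding in_comp_iff component_of_def by (auto intro: rtrancl_trans)

lemma comp_Un:
  assumes "E1 \<subseteq> V1 \<times> V1" "E2 \<subseteq> V2 \<times> V2" "V1 \<inter> V2 = {}" "x \<in> V1"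
  shows "component_of (E1 \<union> E2) x = component_of E1 x"
proof
  have "component_of E1 x \<subseteq> V1" by (rule comp_subset[OF assms(1,4)])
  then have "(E1 \<union> E2) `` component_of E1 x \<subseteq> component_of E1 x"
    using assms(2,3) comp_closed[of _ E1 x] by blast
  then show "component_of (E1 \<union> E2) x \<subseteq> component_of E1 x" by (rule comp_subset_closed) simp
qed (rule comp_mono, blast)

text \<open>A path from \<open>x\<close> never leaves the component of \<open>x\<close>, so it
  survives the restriction.\<close>

lemma comp_induced_comp:
  assumes "y \<in> component_of E x"
  shows "y \<in> component_of (induced E (component_of E x)) x"
proof -
  have "(x, y) \<in> E\<^sup>*" using assms by (simp add: in_comp_iff)
  then show ?thesis
  proof induction
    case (step y z)
    then have "y \<in> component_of E x" "z \<in> component_of E x"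
      unfolding in_comp_iff by (meson rtrancl.rtrancl_into_rtrancl)+
    with step show ?case by (intro comp_closed[OF step.IH]) blast
  qed simp
qed

lemma connI:
  assumes "sym E" "E \<subseteq> V \<times> V" "x \<in> V" "\<And>y. y \<in> V \<Longrightarrow> y \<in> component_of E x"
  shows "conn V E"
proof -
  have "component_of E x = V" using assms(4) comp_subset[OF assms(2,3)] by blast
  then show ?thesis using assms(3) comp_eq[OF assms(1)] unfolding conn_def by blast
qed

lemma connD: "conn V E \<Longrightarrow> x \<in> V \<Longrightarrow> component_of E x = V"
  by (simp add: conn_def)

lemma sym_induced: "sym E \<Longrightarrow> sym (induced E S)"
  by (auto simp: sym_def)

lemma ugraph_induced: "ugraph V E \<Longrightarrow> S \<subseteq> V \<Longrightarrow> ugraph S (induced E S)"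
  unfolding ugraph_def by (auto simp: sym_induced irrefl_def intro: finite_subset)

lemma conn_comp:
  assumes "sym E"
  shows "conn (component_of E x) (induced E (component_of E x))"
  by (rule connI[of _ _ x]) (simp_all add: sym_induced assms comp_induced_comp)

lemma ugraph_Un:
  assumes "ugraph V1 E1" "ugraph V2 E2"
  shows "ugraph (V1 \<union> V2) (E1 \<union> E2)"
  using assms unfolding ugraph_def by (auto simp: sym_Un irrefl_def)

lemma sym_joinE: "sym E1 \<Longrightarrow> sym E2 \<Longrightarrow> sym (joinE E1 R1 E2 R2)"
  unfolding joinE_def sym_def by blast

lemma ugraph_joinE:
  assumes "ugraph V1 E1" "ugraph V2 E2" "V1 \<inter> V2 = {}" "R1 \<subseteq> V1" "R2 \<subseteq> V2"
  shows "ugraph (V1 \<union> V2) (joinE E1 R1 E2 R2)"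
  unfolding ugraph_def
proof (intro conjI)
  show "irrefl (joinE E1 R1 E2 R2)"
    using assms unfolding ugraph_def irrefl_def joinE_def by blast
  show "sym (joinE E1 R1 E2 R2)" using assms by (simp add: sym_joinE ugraph_def)
  show "joinE E1 R1 E2 R2 \<subseteq> (V1 \<union> V2) \<times> (V1 \<union> V2)"
    using ugraphD(2)[OF assms(1)] ugraphD(2)[OF assms(2)] assms(4,5) unfolding joinE_def by blast
qed (use assms in \<open>auto simp: ugraph_def\<close>)

lemma conn_joinE:
  assumes "ugraph V1 E1" "ugraph V2 E2" "V1 \<inter> V2 = {}" "conn V1 E1" "conn V2 E2" "x \<in> V1" "y \<in> V2"
  shows "conn (V1 \<union> V2) (joinE E1 {x} E2 {y})"
proof (rule connI[of _ _ x])
  let ?E = "joinE E1 {x} E2 {y}"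
  have g: "ugraph (V1 \<union> V2) ?E" using assms by (intro ugraph_joinE) auto
  then show "sym ?E" "?E \<subseteq> (V1 \<union> V2) \<times> (V1 \<union> V2)" by (simp_all add: ugraphD)
  show "x \<in> V1 \<union> V2" using assms by simp
  have 1: "V1 \<subseteq> component_of ?E x"
    using comp_mono[of E1 ?E x] connD[OF assms(4,6)] by (auto simp: joinE_def)
  have "y \<in> component_of ?E x" by (rule comp_closed[of x]) (simp_all add: joinE_def)
  then have 2: "V2 \<subseteq> component_of ?E x"
    using comp_mono[of E2 ?E y] connD[OF assms(5,7)] comp_eq[OF \<open>sym ?E\<close>] by (auto simp: joinE_def)
  show "z \<in> component_of ?E x" if "z \<in> V1 \<union> V2" for z using that 1 2 by blast
qed

lemma rtrancl_map_prod:
  "(x, y) \<in> E\<^sup>* \<Longrightarrow> (f x, f y) \<in> (map_prod f f ` E)\<^sup>*"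
proof (induction rule: rtrancl_induct)
  case (step y z)
  then have "(f y, f z) \<in> map_prod f f ` E" by force
  with step.IH show ?case by (rule rtrancl.rtrancl_into_rtrancl)
qed simp

lemma sym_map_prod: "sym E \<Longrightarrow> sym (map_prod f f ` E)"
  by (force simp: sym_def)

lemma conn_image:
  assumes "ugraph V E" "conn V E"
  shows "conn (f ` V) (map_prod f f ` E)"
proof -
  obtain x where x: "x \<in> V" using assms by (auto simp: conn_def)
  show ?thesis
  proof (rule connI[of _ _ "f x"])
    show "sym (map_prod f f ` E)" using assms by (simp add: sym_map_prod ugraphD)
    show "map_prod f f ` E \<subseteq> f ` V \<times> f ` V" using ugraphD(2)[OF assms(1)] by force
    show "f x \<in> f ` V" using x by simp
    fix y assume "y \<in> f ` V"
    then obtain z where "z \<in> V" "y = f z" by blast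
    then show "y \<in> component_of (map_prod f f ` E) (f x)"
      using connD[OF assms(2) x] rtrancl_map_prod unfolding in_comp_iff[symmetric]
      by (metis in_comp_iff)
  qed
qed

lemma map_prod_joinE:
  "map_prod f f ` joinE E1 R1 E2 R2 = joinE (map_prod f f ` E1) (f ` R1) (map_prod f f ` E2) (f ` R2)"
  unfolding joinE_def by (simp add: image_Un map_prod_surj_on[OF refl refl])

lemma fresh_copy:
  fixes V W :: "nat set"
  assumes "finite W"
  obtains f :: "nat \<Rightarrow> nat" where "inj f" "f ` V \<inter> W = {}"
proof -
  define f where "f x = x + Suc (Max (insert 0 W))" for x
  have "inj f" by (auto simp: f_def inj_def)
  moreover have "f x \<notin> W" for x
  proof
    assume "f x \<in> W"
    then have "f x \<le> Max (insert 0 W)" using assms by (intro Max_ge) auto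
    then show False by (simp add: f_def)
  qed
  ultimately show ?thesis using that by blast
qed

section \<open>Types of graphs with marked roots\<close>

definition rtp :: "nat \<Rightarrow> nat set \<Rightarrow> (nat \<times> nat) set \<Rightarrow> nat set \<Rightarrow> nat" where
  "rtp k V E R = tp k V E 1 (\<lambda>_. R)"

lemma rtp_Un:
  assumes "ugraph V1 E1" "ugraph V2 E2" "V1 \<inter> V2 = {}" "R1 \<subseteq> V1" "R2 \<subseteq> V2"
  shows "rtp k (V1 \<union> V2) (E1 \<union> E2) (R1 \<union> R2) = tadd k (rtp k V1 E1 R1) (rtp k V2 E2 R2)"
  unfolding rtp_def using assms by (intro tp_union) (simp_all add: ugraphD)

lemma rtp_iso:
  assumes "inj_on f V" "ugraph V E" "R \<subseteq> V"
  shows "rtp k (f ` V) (map_prod f f ` E) (f ` R) = rtp k V E R"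
  unfolding rtp_def using assms by (intro tp_iso) (simp_all add: ugraphD)

lemma rtp_join_cong:
  assumes "ugraph V1 E1" "ugraph V2 E2" "ugraph V2' E2'" "V1 \<inter> V2 = {}" "V1 \<inter> V2' = {}"
    and "S \<subseteq> V1" "R2 \<subseteq> V2" "R2' \<subseteq> V2'" "rtp k V2 E2 R2 = rtp k V2' E2' R2'"
  shows "rtp k (V1 \<union> V2) (joinE E1 S E2 R2) S = rtp k (V1 \<union> V2') (joinE E1 S E2' R2') S"
proof -
  have "tp k (V1 \<union> V2) (joinE E1 S E2 R2) 1 (\<lambda>i. S \<union> (if i = 0 then {} else R2)) =
    tp k (V1 \<union> V2') (joinE E1 S E2' R2') 1 (\<lambda>i. S \<union> (if i = 0 then {} else R2'))"
    by (rule tp_join_cong[of V1 V2 V2' E1 E2 E2' 1 "\<lambda>_. S" "\<lambda>_. R2" "\<lambda>_. R2'", folded rtp_def])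
       (use assms in \<open>simp_all add: ugraphD\<close>)
  moreover have "tp k V E 1 (\<lambda>i. S \<union> (if i = 0 then {} else R)) = rtp k V E S" for V E R
    unfolding rtp_def by (rule tp_cong) simp
  ultimately show ?thesis by simp
qed

lemma rtp_forget:
  assumes "ugraph V E" "ugraph V' E'" "R \<subseteq> V" "R' \<subseteq> V'" "rtp k V E R = rtp k V' E' R'"
  shows "rtp k V E {} = rtp k V' E' {}"
  using rtp_join_cong[of "{}" "{}" V E V' E' "{}" R R' k] assms
  by (simp add: joinE_def ugraph_def irrefl_def)

definition pendant :: "nat set \<Rightarrow> (nat \<times> nat) set \<Rightarrow> nat \<Rightarrow> nat set \<Rightarrow> (nat \<times> nat) set \<Rightarrow> bool" where
  "pendant VH EH s V E \<longleftrightarrow> (\<exists>f v. inj_on f VH \<and> f ` VH \<subseteq> V \<and> v \<in> V - f ` VH \<and>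
     induced E (f ` VH) = map_prod f f ` EH \<and> E \<inter> f ` VH \<times> (V - f ` VH) = {(f s, v)})"

section \<open>Constructions in an addable class\<close>

locale addable_class =
  fixes P :: "nat set \<Rightarrow> (nat \<times> nat) set \<Rightarrow> bool"
  assumes P_ugraph: "P V E \<Longrightarrow> ugraph V E"
    and P_iso: "P V E \<Longrightarrow> inj_on f V \<Longrightarrow> P (f ` V) (map_prod f f ` E)"
    and P_iff_comp: "ugraph V E \<Longrightarrow> P V E \<longleftrightarrow> (\<forall>x\<in>V. P (component_of E x) (induced E (component_of E x)))"
    and P_bridge: "P V E \<Longrightarrow> x \<in> V \<Longrightarrow> y \<in> V \<Longrightarrow> y \<notin> component_of E x \<Longrightarrow> P V (E \<union> {(x, y), (y, x)})"
begin

lemma P_empty: "P {} {}"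
  using P_iff_comp[of "{}" "{}"] by (simp add: ugraph_def irrefl_def)

lemma P_Un_iff:
  assumes "ugraph V1 E1" "ugraph V2 E2" "V1 \<inter> V2 = {}"
  shows "P (V1 \<union> V2) (E1 \<union> E2) \<longleftrightarrow> P V1 E1 \<and> P V2 E2"
proof -
  have *: "component_of (E \<union> F) x = component_of E x \<and> induced (E \<union> F) (component_of E x) = induced E (component_of E x)"
    if "x \<in> V" "ugraph V E" "ugraph W F" "V \<inter> W = {}" for x E F V W
  proof -
    have "component_of E x \<subseteq> V" using that by (simp add: comp_subset ugraphD)
    then have "F \<inter> component_of E x \<times> component_of E x = {}"
      using ugraphD(2)[OF that(3)] that(4) by blast
    then show ?thesis
      using comp_Un[OF ugraphD(2)[OF that(2)] ugraphD(2)[OF that(3)] that(4,1)] by (simp add: Int_Un_distrib2)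
  qed
  have 1: "component_of (E1 \<union> E2) x = component_of E1 x \<and> induced (E1 \<union> E2) (component_of E1 x) = induced E1 (component_of E1 x)" if "x \<in> V1" for x
    by (rule *[OF that assms])
  have 2: "component_of (E1 \<union> E2) x = component_of E2 x \<and> induced (E1 \<union> E2) (component_of E2 x) = induced E2 (component_of E2 x)" if "x \<in> V2" for x
    using *[OF that assms(2,1)] assms(3) by (simp add: Un_commute Int_commute)
  show ?thesis
    unfolding P_iff_comp[OF ugraph_Un[OF assms(1,2)]] P_iff_comp[OF assms(1)] P_iff_comp[OF assms(2)] ball_Un
    using 1 2 by simp
qed

lemma P_comp:
  assumes "P V E" "x \<in> V"
  shows "P (component_of E x) (induced E (component_of E x))"
  using assms P_iff_comp[OF P_ugraph[OF assms(1)]] by blast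

lemma P_joinE:
  assumes "P V1 E1" "P V2 E2" "V1 \<inter> V2 = {}" "x \<in> V1" "y \<in> V2"
  shows "P (V1 \<union> V2) (joinE E1 {x} E2 {y})"
proof -
  note g = P_ugraph[OF assms(1)] P_ugraph[OF assms(2)]
  have "P (V1 \<union> V2) (E1 \<union> E2)" using P_Un_iff[OF g assms(3)] assms by blast
  moreover have "y \<notin> component_of (E1 \<union> E2) x"
  proof -
    have "component_of (E1 \<union> E2) x = component_of E1 x" by (rule comp_Un[OF ugraphD(2)[OF g(1)] ugraphD(2)[OF g(2)] assms(3,4)])
    also have "\<dots> \<subseteq> V1" using g assms by (simp add: comp_subset ugraphD)
    finally show ?thesis using assms(3,5) by blast
  qed
  ultimately have "P (V1 \<union> V2) ((E1 \<union> E2) \<union> {(x, y), (y, x)})"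
    using assms(4,5) by (intro P_bridge) auto
  moreover have "(E1 \<union> E2) \<union> {(x, y), (y, x)} = joinE E1 {x} E2 {y}"
    by (auto simp: joinE_def)
  ultimately show ?thesis by simp
qed

text \<open>For every member of \<open>A\<close> a fresh copy of a graph of that type is hung onto
  \<open>s\<close>. Each copy is attached by one bridge, so the result stays connected and in the
  class; seen without \<open>K\<close>, the copies form a disjoint union, whose type is the
  sum.\<close>

lemma ex_attached_tsum:
  assumes "P VK EK" "conn VK EK" "s \<in> VK"
    and "set_mset A \<subseteq> {rtp k V E {r} | V E r. P V E \<and> conn V E \<and> r \<in> V}"
  shows "\<exists>V2 E2 R. ugraph V2 E2 \<and> VK \<inter> V2 = {} \<and> R \<subseteq> V2 \<and> rtp k V2 E2 R = tsum k A \<and>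
    P (VK \<union> V2) (joinE EK {s} E2 R) \<and> conn (VK \<union> V2) (joinE EK {s} E2 R)"
  using assms(4)
proof (induction A)
  case empty
  have "rtp k {} {} {} = tzero k"
  proof -
    have "tp k {} {} m (\<lambda>_. {}) = tzero k" for m
    proof (induction k arbitrary: m)
      case 0
      show ?case by (simp add: atoms_def)
    next
      case (Suc k)
      have "(\<lambda>_::nat. {}::nat set)(m := {}) = (\<lambda>_. {})" by auto
      then show ?case by (simp add: Suc del: fun_upd_apply)
    qed
    then show ?thesis by (simp add: rtp_def)
  qed
  moreover have "joinE EK {s} {} {} = EK" by (simp add: joinE_def)
  moreover have "ugraph ({}::nat set) {}" by (simp add: ugraph_def irrefl_def)
  ultimately show ?case using assms by (intro exI[of _ "{}"]) simp
next
  case (add q A)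
  from add obtain V2 E2 R where IH: "ugraph V2 E2" "VK \<inter> V2 = {}" "R \<subseteq> V2" "rtp k V2 E2 R = tsum k A"
    "P (VK \<union> V2) (joinE EK {s} E2 R)" "conn (VK \<union> V2) (joinE EK {s} E2 R)" by auto
  from add.prems obtain V E r where q: "q = rtp k V E {r}" "P V E" "conn V E" "r \<in> V" by auto
  have fin: "finite (VK \<union> V2)" using P_ugraph[OF IH(5)] ugraphD(1) by blast
  obtain f where f: "inj f" "f ` V \<inter> (VK \<union> V2) = {}" by (rule fresh_copy[OF fin])
  have inj: "inj_on f V" using f(1) by (rule inj_on_subset) simp
  define V' E' where V': "V' = f ` V" "E' = map_prod f f ` E"
  have P': "P V' E'" "conn V' E'" "f r \<in> V'"
    unfolding V' using P_iso[OF q(2) inj] conn_image[OF P_ugraph[OF q(2)] q(3)] q(4) by auto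
  have g': "ugraph V' E'" by (rule P_ugraph[OF P'(1)])
  have disj: "V2 \<inter> V' = {}" "(VK \<union> V2) \<inter> V' = {}" "VK \<inter> (V2 \<union> V') = {}" using f(2) IH(2) unfolding V' by blast+
  have eqE: "joinE EK {s} (E2 \<union> E') (R \<union> {f r}) = joinE (joinE EK {s} E2 R) {s} E' {f r}"
    by (rule joinE_Un)
  have eqV: "VK \<union> (V2 \<union> V') = (VK \<union> V2) \<union> V'" by blast
  have "rtp k (V2 \<union> V') (E2 \<union> E') (R \<union> {f r}) = tadd k (tsum k A) (rtp k V' E' {f r})"
    unfolding IH(4)[symmetric] by (rule rtp_Un[OF IH(1) g' disj(1) IH(3)]) (use P'(3) in simp)
  also have "rtp k V' E' {f r} = q"
    unfolding V' q(1) using rtp_iso[OF inj P_ugraph[OF q(2)], of "{r}" k] q(4) by simp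
  finally have "rtp k (V2 \<union> V') (E2 \<union> E') (R \<union> {f r}) = tsum k (add_mset q A)"
    by (simp add: tadd_commute)
  moreover have "P (VK \<union> (V2 \<union> V')) (joinE EK {s} (E2 \<union> E') (R \<union> {f r}))"
    unfolding eqE eqV using assms(3) P' IH disj(2) by (intro P_joinE) auto
  moreover have "conn (VK \<union> (V2 \<union> V')) (joinE EK {s} (E2 \<union> E') (R \<union> {f r}))"
    unfolding eqE eqV using assms(3) P' IH disj(2) g' P_ugraph[OF IH(5)] by (intro conn_joinE) auto
  moreover have "ugraph (V2 \<union> V') (E2 \<union> E')" by (rule ugraph_Un[OF IH(1) g'])
  moreover have "R \<union> {f r} \<subseteq> V2 \<union> V'" using IH(3) P'(3) by blast
  ultimately show ?case using disj(3) by blast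
qed

end

lemma ugraph_image:
  assumes "ugraph V E" "inj_on f V"
  shows "ugraph (f ` V) (map_prod f f ` E)"
  unfolding ugraph_def
proof (intro conjI)
  show "map_prod f f ` E \<subseteq> f ` V \<times> f ` V" using ugraphD(2)[OF assms(1)] by force
  show "irrefl (map_prod f f ` E)"
    unfolding irrefl_def
  proof (intro allI notI)
    fix a assume "(a, a) \<in> map_prod f f ` E"
    then obtain x y where xy: "(x, y) \<in> E" "f x = f y" by auto
    then have "x \<in> V" "y \<in> V" using ugraphD(2)[OF assms(1)] by auto
    then have "x = y" using xy(2) assms(2) by (simp add: inj_on_def)
    with xy(1) ugraphD(4)[OF assms(1)] show False by (simp add: irrefl_def)
  qed
qed (use assms in \<open>simp_all add: ugraphD sym_map_prod\<close>)

context addable_class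
begin

text \<open>Write \<open>G \<lhd> R\<close> for the graph \<open>G\<close> whose root is joined to the roots of \<open>R\<close>. The universal graph is
  \<open>H = K \<lhd> R\<close>, where the type of \<open>R\<close> absorbs every type of a rooted connected graph of the class. If
  \<open>G\<close> has a pendant copy of \<open>H\<close>, then \<open>G = K \<lhd> (R + X)\<close> for some rooted \<open>X\<close>. Here \<open>X\<close> need not belong
  to the class, but \<open>H\<close> and \<open>G\<close> do, so up to equality of types and up to the choice of the root
  \<open>G = K \<lhd> (R + H + X) = G \<lhd> H = H \<lhd> G = K \<lhd> (R + G) = K \<lhd> R = H\<close>.\<close>

lemma ex_universal_pendant:
  assumes "P VK EK" "conn VK EK"
  obtains VH EH s where "P VH EH" "conn VH EH" "s \<in> VH"
    "\<And>V E. P V E \<Longrightarrow> conn V E \<Longrightarrow> pendant VH EH s V E \<Longrightarrow> rtp k V E {} = rtp k VH EH {}"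
proof -
  obtain s where s: "s \<in> VK" using assms(2) by (auto simp: conn_def)
  define Q where "Q = {rtp k V E {r} | V E r. P V E \<and> conn V E \<and> r \<in> V}"
  have "Q \<subseteq> {tp k V E 1 \<sigma> | V E \<sigma>. finite V}"
  proof
    fix q assume "q \<in> Q"
    then obtain V E r where "q = tp k V E 1 (\<lambda>_. {r})" "finite V"
      unfolding Q_def rtp_def using ugraphD(1)[OF P_ugraph] by blast
    then show "q \<in> {tp k V E 1 \<sigma> | V E \<sigma>. finite V}" by blast
  qed
  then have "finite Q" by (rule finite_subset[OF _ finite_tp_image])
  then obtain A where A: "set_mset A \<subseteq> Q" "\<And>q. q \<in> Q \<Longrightarrow> tadd k q (tsum k A) = tsum k A"
    by (rule ex_absorbing_tsum[where k = k]) blast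
  obtain V2 E2 R where R: "ugraph V2 E2" "VK \<inter> V2 = {}" "R \<subseteq> V2" "rtp k V2 E2 R = tsum k A"
      "P (VK \<union> V2) (joinE EK {s} E2 R)" "conn (VK \<union> V2) (joinE EK {s} E2 R)"
    using ex_attached_tsum[OF assms s A(1)[unfolded Q_def]] by blast
  define VH EH where H: "VH = VK \<union> V2" "EH = joinE EK {s} E2 R"
  have PH: "P VH EH" "conn VH EH" "s \<in> VH" using R(5,6) s by (simp_all add: H)
  note gH = P_ugraph[OF PH(1)]
  note gK = P_ugraph[OF assms(1)]
  have univ: "rtp k V E {} = rtp k VH EH {}" if G: "P V E" "conn V E" "pendant VH EH s V E" for V E
  proof -
    obtain f v where f: "inj_on f VH" "f ` VH \<subseteq> V" "v \<in> V - f ` VH"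
        "induced E (f ` VH) = map_prod f f ` EH" "E \<inter> f ` VH \<times> (V - f ` VH) = {(f s, v)}"
      using G(3) unfolding pendant_def by (elim exE conjE)
    note gG = P_ugraph[OF G(1)]
    obtain g where g: "inj g" "g ` VH \<inter> V = {}" by (rule fresh_copy[OF ugraphD(1)[OF gG]])
    have g_on: "inj_on g S" for S using g(1) by (rule inj_on_subset) simp
    \<comment> \<open>\<open>X\<close> is the rest of \<open>G\<close> outside the pendant copy, and
      \<open>B\<close> is a copy of \<open>H\<close> disjoint from \<open>G\<close>, which is to be
      absorbed.\<close>
    define X FX where X: "X = V - f ` VH" "FX = induced E X"
    define VB EB where B: "VB = g ` VH" "EB = map_prod g g ` EH"
    have gX: "ugraph X FX" unfolding X by (rule ugraph_induced[OF gG]) blast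
    have PB: "P VB EB" unfolding B by (rule P_iso[OF PH(1) g_on])
    have cB: "conn VB EB" unfolding B by (rule conn_image[OF gH PH(2)])
    note gB = P_ugraph[OF PB]
    define r where "r = f s"
    define t where "t = g s"
    have r: "r \<in> V" using PH(3) f(2) by (auto simp: r_def)
    have t: "t \<in> VB" using PH(3) by (auto simp: B t_def)
    have fK: "inj_on f VK" and f2: "inj_on f V2" using f(1) by (rule inj_on_subset, simp add: H)+
    define VK' EK' V2' E2' R' where K': "VK' = f ` VK" "EK' = map_prod f f ` EK"
      "V2' = f ` V2" "E2' = map_prod f f ` E2" "R' = f ` R"
    define VK'' EK'' V2'' E2'' R'' where K'': "VK'' = g ` VK" "EK'' = map_prod g g ` EK"
      "V2'' = g ` V2" "E2'' = map_prod g g ` E2" "R'' = g ` R"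
    have gs: "ugraph VK' EK'" "ugraph V2' E2'" "ugraph VK'' EK''" "ugraph V2'' E2''"
      unfolding K' K'' using gK R(1) fK f2 g_on by (simp_all add: ugraph_image)
    have fH: "f ` VH = VK' \<union> V2'" "map_prod f f ` EH = joinE EK' {r} E2' R'"
      unfolding H K' r_def by (auto simp: map_prod_joinE)
    have gHB: "VB = VK'' \<union> V2''" "EB = joinE EK'' {t} E2'' R''"
      unfolding B H K'' t_def by (auto simp: map_prod_joinE)
    have rts: "r \<in> VK'" "t \<in> VK''" "R' \<subseteq> V2'" "R'' \<subseteq> V2''" "v \<in> X"
      unfolding K' K'' r_def t_def X(1) using s R(3) f(3) by auto
    have "VK' \<inter> V2' = f ` (VK \<inter> V2)" "VK'' \<inter> V2'' = g ` (VK \<inter> V2)"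
      unfolding K' K'' by (rule inj_on_image_Int[symmetric, of _ VH], use f(1) g_on H in auto)+
    then have d1: "VK' \<inter> V2' = {}" "VK'' \<inter> V2'' = {}" by (simp_all add: R(2))
    have d2: "VK' \<inter> X = {}" "V2' \<inter> X = {}" using fH(1) by (auto simp: X)
    have V: "V = VK' \<union> (V2' \<union> X)" using f(2) fH(1) by (auto simp: X)
    have d3: "VB \<inter> V = {}" using g(2) by (simp add: B)
    have types: "rtp k V2' E2' R' = tsum k A" "rtp k V2'' E2'' R'' = tsum k A"
      unfolding K' K'' using rtp_iso[OF f2 R(1,3)] rtp_iso[OF g_on R(1,3)] R(4) by simp_all
    have tB: "rtp k VB EB {t} = rtp k VH EH {s}"
      unfolding B t_def using rtp_iso[OF g_on gH, of "{s}"] PH(3) by simp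
    have qB: "rtp k VB EB {t} \<in> Q" and qG: "rtp k V E {r} \<in> Q"
      unfolding Q_def using PB cB t G(1,2) r by blast+
    have E: "E = joinE (map_prod f f ` EH) {r} FX {v}"
    proof -
      have "E \<subseteq> V \<times> V" using gG by (rule ugraphD)
      then have "E = induced E (f ` VH) \<union> FX \<union> E \<inter> f ` VH \<times> X \<union> E \<inter> X \<times> f ` VH"
        unfolding X using f(2) by blast
      moreover have "E \<inter> f ` VH \<times> X = {(r, v)}" using f(5) by (simp add: X r_def)
      moreover have "E \<inter> X \<times> f ` VH = {(v, r)}"
      proof -
        have "E \<inter> X \<times> f ` VH = (E \<inter> f ` VH \<times> X)\<inverse>"
          using ugraphD(3)[OF gG] by (auto dest: symD)
        then show ?thesis unfolding \<open>E \<inter> f ` VH \<times> X = {(r, v)}\<close> by blast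
      qed
      ultimately have "E = map_prod f f ` EH \<union> FX \<union> {(r, v)} \<union> {(v, r)}" by (simp only: f(4))
      then show ?thesis by (simp add: joinE_def)
    qed
    have E': "E = joinE EK' {r} (E2' \<union> FX) (R' \<union> {v})"
      by (subst E, subst fH(2), subst joinE_Un) simp
    have g2X: "ugraph (V2' \<union> X) (E2' \<union> FX)" by (rule ugraph_Un[OF gs(2) gX])
    have subX: "R' \<union> {v} \<subseteq> V2' \<union> X" using rts by blast
    have dXB: "(V2' \<union> X) \<inter> VB = {}" using d3 V by blast
    have sub_t: "{t} \<subseteq> VB" and sub_r: "{r} \<subseteq> V" "{r} \<subseteq> VK'" using t r rts by simp_all
    have t1: "rtp k (V2' \<union> X) (E2' \<union> FX) (R' \<union> {v}) = tadd k (tsum k A) (rtp k X FX {v})"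
      using rtp_Un[OF gs(2) gX d2(2) rts(3), of "{v}" k] rts(5) by (simp only: types) simp
    \<comment> \<open>The roots at \<open>V2'\<close> have the absorbing type, so adding the rooted
      connected graph \<open>B\<close> to \<open>V2'\<close> and \<open>X\<close> does not change
      the type. Joined to \<open>K\<close> this becomes \<open>G = G \<lhd> B\<close> in
      \<open>step1\<close>.\<close>
    have "rtp k ((V2' \<union> X) \<union> VB) ((E2' \<union> FX) \<union> EB) ((R' \<union> {v}) \<union> {t}) =
        tadd k (tadd k (tsum k A) (rtp k X FX {v})) (rtp k VB EB {t})"
      unfolding t1[symmetric] by (rule rtp_Un[OF g2X gB dXB subX sub_t])
    also have "\<dots> = tadd k (tadd k (rtp k VB EB {t}) (tsum k A)) (rtp k X FX {v})"
      by (metis tadd_assoc tadd_commute)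
    also have "\<dots> = rtp k (V2' \<union> X) (E2' \<union> FX) (R' \<union> {v})"
      by (simp only: A(2)[OF qB] t1)
    finally have abs1: "rtp k (V2' \<union> X) (E2' \<union> FX) (R' \<union> {v}) =
        rtp k ((V2' \<union> X) \<union> VB) ((E2' \<union> FX) \<union> EB) ((R' \<union> {v}) \<union> {t})" ..
    have "rtp k (VK' \<union> (V2' \<union> X)) (joinE EK' {r} (E2' \<union> FX) (R' \<union> {v})) {r} =
        rtp k (VK' \<union> ((V2' \<union> X) \<union> VB)) (joinE EK' {r} ((E2' \<union> FX) \<union> EB) ((R' \<union> {v}) \<union> {t})) {r}"
    proof (rule rtp_join_cong[OF gs(1) g2X _ _ _ sub_r(2) subX _ abs1])
      show "ugraph ((V2' \<union> X) \<union> VB) ((E2' \<union> FX) \<union> EB)" by (rule ugraph_Un[OF g2X gB])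
      show "VK' \<inter> (V2' \<union> X) = {}" using d1 d2 by blast
      show "VK' \<inter> ((V2' \<union> X) \<union> VB) = {}" using d1 d2 d3 V by blast
      show "(R' \<union> {v}) \<union> {t} \<subseteq> (V2' \<union> X) \<union> VB" using subX sub_t by blast
    qed
    also have "VK' \<union> ((V2' \<union> X) \<union> VB) = V \<union> VB" using V by blast
    also have "joinE EK' {r} ((E2' \<union> FX) \<union> EB) ((R' \<union> {v}) \<union> {t}) = joinE E {r} EB {t}"
      by (simp only: E' joinE_Un)
    also have "VK' \<union> (V2' \<union> X) = V" using V ..
    also have "joinE EK' {r} (E2' \<union> FX) (R' \<union> {v}) = E" using E' ..
    finally have step1: "rtp k V E {r} = rtp k (V \<union> VB) (joinE E {r} EB {t}) {r}" .
    have d2G: "V2'' \<inter> V = {}" using d3 gHB(1) by blast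
    \<comment> \<open>The same graph seen from the root of \<open>B\<close>: here \<open>G\<close>
      hangs next to \<open>R''\<close> on the copy \<open>K''\<close> of \<open>K\<close>, and
      \<open>R''\<close> absorbs \<open>G\<close>.\<close>
    have "rtp k (V2'' \<union> V) (E2'' \<union> E) (R'' \<union> {r}) = tadd k (tsum k A) (rtp k V E {r})"
      using rtp_Un[OF gs(4) gG d2G rts(4) sub_r(1)] by (simp only: types)
    also have "\<dots> = rtp k V2'' E2'' R''"
      using A(2)[OF qG] by (simp only: types tadd_commute)
    finally have abs2: "rtp k (V2'' \<union> V) (E2'' \<union> E) (R'' \<union> {r}) = rtp k V2'' E2'' R''" .
    have sub_t': "{t} \<subseteq> VK''" using rts by simp
    have "rtp k (VK'' \<union> (V2'' \<union> V)) (joinE EK'' {t} (E2'' \<union> E) (R'' \<union> {r})) {t} =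
        rtp k (VK'' \<union> V2'') (joinE EK'' {t} E2'' R'') {t}"
    proof (rule rtp_join_cong[OF gs(3) _ gs(4) _ d1(2) sub_t' _ rts(4) abs2])
      show "ugraph (V2'' \<union> V) (E2'' \<union> E)" by (rule ugraph_Un[OF gs(4) gG])
      show "VK'' \<inter> (V2'' \<union> V) = {}" using d1 d3 gHB(1) by blast
      show "R'' \<union> {r} \<subseteq> V2'' \<union> V" using rts sub_r by blast
    qed
    also have "VK'' \<union> (V2'' \<union> V) = V \<union> VB" using gHB(1) by blast
    also have "joinE EK'' {t} (E2'' \<union> E) (R'' \<union> {r}) = joinE E {r} EB {t}"
      by (simp only: gHB(2) joinE_Un joinE_commute[of E])
    finally have step2: "rtp k (V \<union> VB) (joinE E {r} EB {t}) {t} = rtp k VB EB {t}"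
      by (simp only: gHB)
    have gGB: "ugraph (V \<union> VB) (joinE E {r} EB {t})"
      by (rule ugraph_joinE[OF gG gB _ sub_r(1) sub_t]) (use d3 in blast)
    \<comment> \<open>The two steps describe the joined graph with different roots, so they can be
      linked only after the roots are forgotten.\<close>
    have "rtp k V E {} = rtp k (V \<union> VB) (joinE E {r} EB {t}) {}"
      by (rule rtp_forget[OF gG gGB sub_r(1) _ step1]) (use sub_r(1) in blast)
    also have "\<dots> = rtp k VH EH {}"
      by (rule rtp_forget[OF gGB gH _ _ step2[unfolded tB]]) (use sub_t PH(3) in blast)+
    finally show ?thesis .
  qed
  show ?thesis by (rule that[OF PH univ])
qed

end

section \<open>Counting by components\<close>

text \<open>Besides closure under isomorphism it demands graphs, so that a finite vertex set carries
  finitely many edge sets and the count depends only on its size.\<close>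

definition invariant :: "(nat set \<Rightarrow> (nat \<times> nat) set \<Rightarrow> bool) \<Rightarrow> bool" where
  "invariant F \<longleftrightarrow> (\<forall>V E. F V E \<longrightarrow> ugraph V E) \<and>
     (\<forall>V E f. F V E \<longrightarrow> inj_on f V \<longrightarrow> F (f ` V) (map_prod f f ` E))"

definition cnt :: "(nat set \<Rightarrow> (nat \<times> nat) set \<Rightarrow> bool) \<Rightarrow> nat \<Rightarrow> nat" where
  "cnt F n = card {E. F {1..n} E}"

lemma finite_invariant:
  assumes "invariant F" "finite V"
  shows "finite {E. F V E}"
proof (rule finite_subset)
  show "{E. F V E} \<subseteq> Pow (V \<times> V)" using assms(1) ugraphD(2) unfolding invariant_def by blast
qed (simp add: assms)

lemma card_invariant_le:
  assumes "invariant F" "finite W" "bij_betw f V W"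
  shows "card {E. F V E} \<le> card {E. F W E}"
proof (rule card_inj_on_le[of "image (map_prod f f)"])
  have f: "inj_on f V" "f ` V = W" using assms(3) by (simp_all add: bij_betw_def)
  show "image (map_prod f f) ` {E. F V E} \<subseteq> {E. F W E}"
    using assms(1) f unfolding invariant_def by auto
  have "inj_on (map_prod f f) (V \<times> V)" by (rule map_prod_inj_on[OF f(1) f(1)])
  then have "inj_on (image (map_prod f f)) (Pow (V \<times> V))" by (rule inj_on_image_Pow)
  moreover have "{E. F V E} \<subseteq> Pow (V \<times> V)" using assms(1) ugraphD(2) unfolding invariant_def by blast
  ultimately show "inj_on (image (map_prod f f)) {E. F V E}" by (rule inj_on_subset)
qed (rule finite_invariant[OF assms(1,2)])

lemma card_invariant:
  assumes "invariant F" "finite V"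
  shows "card {E. F V E} = cnt F (card V)"
proof -
  obtain f where f: "bij_betw f V {1..card V}"
    using finite_same_card_bij[OF assms(2), of "{1..card V}"] by auto
  show ?thesis unfolding cnt_def
    using card_invariant_le[OF assms(1) _ f] card_invariant_le[OF assms(1,2) bij_betw_inv_into[OF f]] by simp
qed

section \<open>Bridges and disconnected pairs of vertices\<close>

definition bridges :: "('a \<times> 'a) set \<Rightarrow> ('a \<times> 'a) set" where
  "bridges E = {(x, y) \<in> E. y \<notin> component_of (E - {(x, y), (y, x)}) x}"

text \<open>A path from \<open>r\<close> survives the deletion until it first uses the deleted edge,
  and at that moment it stands at \<open>x\<close> or \<open>y\<close>.\<close>

lemma comp_Diff_edge:
  assumes "sym E" "w \<in> component_of E r"
  shows "w \<in> component_of (E - {(x, y), (y, x)}) r \<or> x \<in> component_of (E - {(x, y), (y, x)}) r \<or> y \<in> component_of (E - {(x, y), (y, x)}) r"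
proof -
  have "(r, w) \<in> E\<^sup>*" using assms(2) by (simp add: in_comp_iff)
  then show ?thesis
  proof induction
    case (step a b)
    show ?case
    proof (cases "a \<in> component_of (E - {(x, y), (y, x)}) r")
      case True
      show ?thesis
      proof (cases "(a, b) \<in> {(x, y), (y, x)}")
        case True
        with \<open>a \<in> component_of _ r\<close> show ?thesis by blast
      next
        case False
        with step.hyps(2) have "(a, b) \<in> E - {(x, y), (y, x)}" by blast
        from comp_closed[OF True this] show ?thesis by blast
      qed
    qed (use step.IH in blast)
  qed simp
qed

text \<open>Root every component. In the graph without the bridge, exactly one end of the bridge is still
  connected to the root, and the other end determines the bridge.\<close>

lemma card_bridges_le:
  assumes "ugraph V E"
  shows "card (bridges E) \<le> 2 * card V"
proof -
  note g = ugraphD[OF assms]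
  define del where "del x y = E - {(x, y), (y, x)}" for x y
  define root where "root x = (SOME r. r \<in> component_of E x)" for x
  have root: "root x \<in> component_of E x" for x unfolding root_def by (rule someI[of _ x]) simp
  have root_eq: "root x = root y" if "y \<in> component_of E x" for x y
    unfolding root_def comp_eq[OF g(3) that] ..
  define D where "D = {(x, y) \<in> bridges E. x \<in> component_of (del x y) (root y)}"
  have D: "(x, y) \<in> D \<longleftrightarrow> (x, y) \<in> E \<and> y \<notin> component_of (del x y) x \<and> x \<in> component_of (del x y) (root y)" for x y
    by (auto simp: D_def bridges_def del_def)
  have sym_del: "sym (del x y)" for x y using g(3) by (auto simp: del_def sym_def)
  have "inj_on snd D"
  proof (rule inj_onI)
    fix p q assume pq: "p \<in> D" "q \<in> D" "snd p = snd q"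
    show "p = q"
    proof (rule ccontr)
      assume "p \<noteq> q"
      obtain x w x' where "p = (x, w)" "q = (x', w)" using pq(3) by (metis prod.collapse)
      with pq \<open>p \<noteq> q\<close> have xw: "(x, w) \<in> D" "(x', w) \<in> D" and neq: "x \<noteq> x'" by blast+
      \<comment> \<open>Without the bridge \<open>(x, w)\<close> the side of the root avoids
        \<open>w\<close>. It therefore uses no edge at \<open>w\<close> and survives the deletion of
        \<open>(x', w)\<close> as well; but then the edge \<open>(x, w)\<close> leads to
        \<open>w\<close>.\<close>
      have sub: "y \<in> component_of (del x' w) (root w)" if "y \<in> component_of (del x w) (root w)" for y
      proof -
        have notw: "w \<notin> component_of (del x w) (root w)"
          using xw(1) comp_eq[OF sym_del] unfolding D by (metis comp_sym sym_del)
        have "(root w, y) \<in> (del x w)\<^sup>*" using that by (simp add: in_comp_iff)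
        then show ?thesis
        proof induction
          case (step a b)
          then have "a \<in> component_of (del x w) (root w)" "b \<in> component_of (del x w) (root w)"
            unfolding in_comp_iff by (meson rtrancl.rtrancl_into_rtrancl)+
          with notw have "a \<noteq> w" "b \<noteq> w" by blast+
          then have "(a, b) \<in> del x' w" using step.hyps(2) by (auto simp: del_def)
          then show ?case by (rule comp_closed[OF step.IH])
        qed simp
      qed
      have "x \<in> component_of (del x' w) (root w)" using sub xw(1) D by blast
      moreover have "(x, w) \<in> del x' w"
      proof -
        have "x \<noteq> w" using xw(1) g(4) unfolding D irrefl_def by blast
        then show ?thesis using xw(1) neq unfolding D del_def by blast
      qed
      ultimately have "w \<in> component_of (del x' w) (root w)" by (rule comp_closed)
      then show False using xw(2) comp_eq[OF sym_del] unfolding D by (metis comp_sym sym_del)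
    qed
  qed
  moreover have DV: "snd ` D \<subseteq> V" using g(2) unfolding D_def bridges_def by auto
  ultimately have cD: "card D \<le> card V" using card_inj_on_le[OF _ _ g(1)] by blast
  have finD: "finite D" using g(5) by (rule finite_subset[rotated]) (auto simp: D_def bridges_def)
  have "bridges E \<subseteq> D \<union> D\<inverse>"
  proof (rule subrelI)
    fix x y assume b: "(x, y) \<in> bridges E"
    then have xy: "(x, y) \<in> E" "y \<notin> component_of (del x y) x" by (auto simp: bridges_def del_def)
    have yx: "(y, x) \<in> E" using xy(1) g(3) by (auto dest: symD)
    have del_sym: "del y x = del x y" by (auto simp: del_def)
    have ryx: "root y = root x" using root_eq[of y x] comp_closed[OF self_in_comp xy(1)] by simp
    have "x \<notin> component_of (del x y) y" using xy(2) comp_sym[OF sym_del] by blast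
    have "y \<in> component_of E (root y)" using root comp_sym[OF g(3)] by blast
    from comp_Diff_edge[OF g(3) this, of x y, folded del_def]
    have "x \<in> component_of (del x y) (root y) \<or> y \<in> component_of (del x y) (root y)" by blast
    then show "(x, y) \<in> D \<union> D\<inverse>"
    proof
      assume "x \<in> component_of (del x y) (root y)"
      then show ?thesis using D xy by blast
    next
      assume "y \<in> component_of (del x y) (root y)"
      then have "(y, x) \<in> D" unfolding D del_sym using yx \<open>x \<notin> component_of (del x y) y\<close> ryx by simp
      then show ?thesis by blast
    qed
  qed
  then have "card (bridges E) \<le> card (D \<union> D\<inverse>)" by (rule card_mono[rotated]) (simp add: finD)
  also have "\<dots> \<le> card D + card (D\<inverse>)" by (rule card_Un_le)
  also have "\<dots> \<le> 2 * card V" using cD by simp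
  finally show ?thesis .
qed

section \<open>Splitting off a component\<close>

definition has_comp :: "('a \<times> 'a) set \<Rightarrow> 'a set \<Rightarrow> bool" where
  "has_comp E S \<longleftrightarrow> S \<noteq> {} \<and> (\<forall>x\<in>S. component_of E x = S)"

text \<open>No vertex set is mentioned: a vertex without neighbours forms a component
  \<open>{x}\<close> even if it is outside the graph, so \<open>S \<subseteq> V\<close> has to be
  demanded separately.\<close>

lemma has_comp_iff: "sym E \<Longrightarrow> has_comp E S \<longleftrightarrow> (\<exists>x. component_of E x = S)"
  unfolding has_comp_def using comp_eq self_in_comp by (metis ex_in_conv)

lemma has_comp_split:
  assumes "ugraph V E" "has_comp E S"
  shows "E = induced E S \<union> induced E (V - S)"
proof -
  have "y \<in> S" if "(x, y) \<in> E" "x \<in> S" for x y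
    using that assms(2) comp_closed[of x E x y] by (simp add: has_comp_def)
  moreover from this have "x \<in> S" if "(x, y) \<in> E" "y \<in> S" for x y
    using that ugraphD(3)[OF assms(1)] by (meson symD)
  ultimately show ?thesis using ugraphD(2)[OF assms(1)] by blast
qed

lemma conn_has_comp:
  assumes "sym E" "has_comp E S"
  shows "conn S (induced E S)"
proof -
  obtain x where "component_of E x = S" using assms has_comp_iff by blast
  then show ?thesis using conn_comp[OF assms(1), of x] by simp
qed

lemma has_comp_Un:
  assumes "ugraph S E1" "ugraph W E2" "S \<inter> W = {}" "conn S E1"
  shows "has_comp (E1 \<union> E2) S"
  unfolding has_comp_def
proof (intro conjI ballI)
  show "S \<noteq> {}" using assms(4) by (simp add: conn_def)
  show "component_of (E1 \<union> E2) x = S" if "x \<in> S" for x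
    using comp_Un[OF ugraphD(2)[OF assms(1)] ugraphD(2)[OF assms(2)] assms(3) that]
      connD[OF assms(4) that] by simp
qed

context addable_class
begin

lemma invariant_P: "invariant P"
  unfolding invariant_def using P_ugraph P_iso by blast

lemma invariant_conn: "invariant (\<lambda>V E. P V E \<and> conn V E)"
  unfolding invariant_def using P_ugraph P_iso conn_image by blast

definition c :: "nat \<Rightarrow> nat" where "c = cnt P"

definition kc :: "nat \<Rightarrow> nat" where "kc = cnt (\<lambda>V E. P V E \<and> conn V E)"

lemma finite_P: "finite V \<Longrightarrow> finite {E. P V E}"
  by (rule finite_invariant[OF invariant_P])

lemma card_P: "finite V \<Longrightarrow> card {E. P V E} = c (card V)"
  unfolding c_def by (rule card_invariant[OF invariant_P])

text \<open>Double counting of the triples \<open>(E, x, y)\<close> with \<open>y\<close> outside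
  the component of \<open>x\<close>. Adding the edge makes it a bridge of another graph of the
  class, and this graph together with \<open>(x, y)\<close> returns \<open>E\<close>; so there are
  at most as many triples as graphs with a chosen oriented bridge.\<close>

lemma sum_disconnected_le:
  assumes "finite V"
  shows "(\<Sum>E | P V E. \<Sum>x\<in>V. card (V - component_of E x)) \<le> 2 * card V * c (card V)"
proof -
  define A where "A = (SIGMA E:{E. P V E}. SIGMA x:V. V - component_of E x)"
  define B where "B = (SIGMA E:{E. P V E}. bridges E)"
  have fin: "finite {E. P V E}" by (rule finite_P[OF assms])
  have finb: "finite (bridges E)" if "P V E" for E
    by (rule finite_subset[OF _ ugraphD(5)[OF P_ugraph[OF that]]]) (auto simp: bridges_def)
  have notE: "(x, y) \<notin> E" "(y, x) \<notin> E" if "P V E" "y \<notin> component_of E x" for E x y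
    using that comp_closed[OF self_in_comp, of x y E] ugraphD(3)[OF P_ugraph[OF that(1)]]
    by (auto dest: symD)
  have "card A \<le> card B"
  proof (rule card_inj_on_le)
    let ?f = "\<lambda>(E, x, y). (E \<union> {(x, y), (y, x)}, x, y)"
    show "inj_on ?f A"
    proof (rule inj_onI)
      fix p q assume pq: "p \<in> A" "q \<in> A" "?f p = ?f q"
      obtain E x y E' x' y' where p: "p = (E, x, y)" "q = (E', x', y')" by (metis prod_cases3)
      have eq: "x = x'" "y = y'" "E \<union> {(x, y), (y, x)} = E' \<union> {(x, y), (y, x)}"
        using pq(3) unfolding p by auto
      have "P V E" "y \<notin> component_of E x" "P V E'" "y \<notin> component_of E' x"
        using pq(1,2) unfolding p eq(1,2) A_def by auto
      then have "(x, y) \<notin> E" "(y, x) \<notin> E" "(x, y) \<notin> E'" "(y, x) \<notin> E'" using notE by blast+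
      then have "E = E'" using eq(3) by blast
      then show "p = q" unfolding p eq by simp
    qed
    show "?f ` A \<subseteq> B"
    proof (rule image_subsetI, clarify)
      fix E x y assume "(E, x, y) \<in> A"
      then have 1: "P V E" "x \<in> V" "y \<in> V" "y \<notin> component_of E x" by (auto simp: A_def)
      have "E \<union> {(x, y), (y, x)} - {(x, y), (y, x)} = E" using notE[OF 1(1,4)] by blast
      then have "(x, y) \<in> bridges (E \<union> {(x, y), (y, x)})" using 1(4) by (simp add: bridges_def)
      then show "(E \<union> {(x, y), (y, x)}, x, y) \<in> B" using P_bridge[OF 1] by (simp add: B_def)
    qed
    show "finite B" unfolding B_def using fin finb by blast
  qed
  also have "card B = (\<Sum>E | P V E. card (bridges E))"
    unfolding B_def using fin finb by (intro card_SigmaI) auto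
  also have "\<dots> \<le> (\<Sum>E | P V E. 2 * card V)"
    using card_bridges_le[OF P_ugraph] by (intro sum_mono) blast
  also have "\<dots> = 2 * card V * c (card V)" by (simp add: card_P[OF assms])
  also have "card A = (\<Sum>E | P V E. card (SIGMA x:V. V - component_of E x))"
    unfolding A_def using fin assms by (intro card_SigmaI) auto
  also have "\<dots> = (\<Sum>E | P V E. \<Sum>x\<in>V. card (V - component_of E x))"
    using assms by (intro sum.cong refl card_SigmaI) auto
  finally show ?thesis by simp
qed

end

lemma has_compD: "has_comp E S \<Longrightarrow> x \<in> S \<Longrightarrow> component_of E x = S"
  by (simp add: has_comp_def)

lemma has_comp_unique:
  assumes "has_comp E S" "has_comp E S'" "S \<noteq> S'"
  shows "S \<inter> S' = {}"
proof (rule ccontr)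
  assume "S \<inter> S' \<noteq> {}"
  then obtain x where "x \<in> S" "x \<in> S'" by blast
  from has_compD[OF assms(1) this(1)] has_compD[OF assms(2) this(2)] have "S = S'" by simp
  with assms(3) show False by simp
qed

context addable_class
begin

lemma P_has_comp:
  assumes "P V E" "S \<subseteq> V" "has_comp E S"
  shows "P S (induced E S)" "conn S (induced E S)" "P (V - S) (induced E (V - S))"
proof -
  note g = P_ugraph[OF assms(1)]
  have "P (S \<union> (V - S)) (induced E S \<union> induced E (V - S))"
    using assms(1) has_comp_split[OF g assms(3)] assms(2) by (simp add: Un_absorb1)
  then show "P S (induced E S)" "P (V - S) (induced E (V - S))"
    using P_Un_iff[of S "induced E S" "V - S" "induced E (V - S)"] ugraph_induced[OF g] assms(2) by auto
  show "conn S (induced E S)" by (rule conn_has_comp[OF ugraphD(3)[OF g] assms(3)])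
qed

text \<open>Restriction to \<open>S\<close> and to the rest is inverse to the union of edge sets,
  and decomposability keeps the union in the class. \<open>F1\<close> and \<open>F2\<close> leave
  room for further conditions on the two parts.\<close>

lemma card_has_comp:
  assumes "S \<subseteq> V"
    and F1: "\<And>E. F1 E \<Longrightarrow> P S E \<and> conn S E" and F2: "\<And>E. F2 E \<Longrightarrow> P (V - S) E"
  shows "card {E. P V E \<and> has_comp E S \<and> F1 (induced E S) \<and> F2 (induced E (V - S))} =
    card {E. F1 E} * card {E. F2 E}" (is "card ?X = _")
proof -
  let ?f = "\<lambda>E. (induced E S, induced E (V - S))"
  have inv: "induced (E1 \<union> E2) S = E1" "induced (E1 \<union> E2) (V - S) = E2" "P V (E1 \<union> E2)" "has_comp (E1 \<union> E2) S"
    if "F1 E1" "F2 E2" for E1 E2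
  proof -
    have *: "P S E1" "conn S E1" "P (V - S) E2" using F1[OF that(1)] F2[OF that(2)] by blast+
    note g = P_ugraph[OF *(1)] P_ugraph[OF *(3)]
    show "induced (E1 \<union> E2) S = E1" "induced (E1 \<union> E2) (V - S) = E2"
    proof -
      have "induced E1 S = E1" "induced E2 S = {}" "induced E1 (V - S) = {}" "induced E2 (V - S) = E2"
        using ugraphD(2)[OF g(1)] ugraphD(2)[OF g(2)] by fast+
      then show "induced (E1 \<union> E2) S = E1" "induced (E1 \<union> E2) (V - S) = E2"
        by (simp_all add: Int_Un_distrib2)
    qed
    show "P V (E1 \<union> E2)" using P_Un_iff[OF g] * assms(1) by (simp add: Un_absorb1)
    show "has_comp (E1 \<union> E2) S" by (rule has_comp_Un[OF g _ *(2)]) simp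
  qed
  have "bij_betw ?f ?X ({E. F1 E} \<times> {E. F2 E})"
  proof (rule bij_betw_byWitness[where f' = "\<lambda>(a, b). a \<union> b"])
    show "\<forall>E\<in>?X. (case ?f E of (a, b) \<Rightarrow> a \<union> b) = E"
    proof
      fix E assume "E \<in> ?X"
      then have "P V E" "has_comp E S" by blast+
      from has_comp_split[OF P_ugraph[OF this(1)] this(2)]
      show "(case ?f E of (a, b) \<Rightarrow> a \<union> b) = E" by (simp only: prod.case)
    qed
    show "\<forall>p\<in>{E. F1 E} \<times> {E. F2 E}. ?f (case p of (a, b) \<Rightarrow> a \<union> b) = p"
    proof
      fix p assume "p \<in> {E. F1 E} \<times> {E. F2 E}"
      then obtain E1 E2 where p: "p = (E1, E2)" "F1 E1" "F2 E2" by (cases p) simp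
      show "?f (case p of (a, b) \<Rightarrow> a \<union> b) = p"
        unfolding p(1) prod.case inv(1,2)[OF p(2,3)] ..
    qed
    show "?f ` ?X \<subseteq> {E. F1 E} \<times> {E. F2 E}" by blast
    show "(\<lambda>(a, b). a \<union> b) ` ({E. F1 E} \<times> {E. F2 E}) \<subseteq> ?X"
    proof (rule image_subsetI)
      fix p assume "p \<in> {E. F1 E} \<times> {E. F2 E}"
      then obtain E1 E2 where p: "p = (E1, E2)" "F1 E1" "F2 E2" by (cases p) simp
      show "(case p of (a, b) \<Rightarrow> a \<union> b) \<in> ?X"
        unfolding p(1) prod.case mem_Collect_eq inv(1,2)[OF p(2,3)] using inv(3,4)[OF p(2,3)] p(2,3) by simp
    qed
  qed
  then have "card ?X = card ({E. F1 E} \<times> {E. F2 E})" by (rule bij_betw_same_card)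
  then show ?thesis by (simp only: card_cartesian_product)
qed

section \<open>Counting vertices by the size of their component\<close>

lemma card_conn: "finite V \<Longrightarrow> card {E. P V E \<and> conn V E} = kc (card V)"
  unfolding kc_def by (rule card_invariant[OF invariant_conn])

lemma kc_le: "kc n \<le> c n"
  unfolding kc_def c_def cnt_def by (rule card_mono) (auto intro: finite_P)

lemma c_0: "c 0 = 1"
proof -
  have "{E. P {} E} = {{}}" using P_empty ugraphD(2)[OF P_ugraph, of "{}"] by auto
  then show ?thesis using card_P[of "{}"] by simp
qed

text \<open>Double counting over the possible vertex sets \<open>S\<close> of a component of size
  \<open>j\<close>, each of which contributes \<open>j\<close> vertices whenever it occurs.\<close>

lemma sum_component_size:
  assumes "finite V" "0 < j"
  shows "(\<Sum>E | P V E. card {x\<in>V. card (component_of E x) = j}) =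
    (card V choose j) * (j * kc j * c (card V - j))"
proof -
  let ?K = "{S. S \<subseteq> V \<and> card S = j}"
  have finK: "finite ?K" using assms(1) by simp
  have fin: "finite {E. P V E}" by (rule finite_P[OF assms(1)])
  have 1: "card {x\<in>V. card (component_of E x) = j} = (\<Sum>S\<in>?K. if has_comp E S then j else 0)" if "P V E" for E
  proof -
    note g = ugraphD[OF P_ugraph[OF that]]
    have "{x\<in>V. card (component_of E x) = j} = \<Union> {S \<in> ?K. has_comp E S}" (is "?l = ?r")
    proof
      show "?l \<subseteq> ?r"
      proof
        fix x assume x: "x \<in> ?l"
        then have "component_of E x \<subseteq> V" by (intro comp_subset[OF g(2)]) simp
        moreover have "has_comp E (component_of E x)" unfolding has_comp_iff[OF g(3)] by (rule exI) (rule refl)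
        ultimately have "component_of E x \<in> {S \<in> ?K. has_comp E S}" using x by simp
        then show "x \<in> ?r" by (rule UnionI) simp
      qed
      show "?r \<subseteq> ?l" unfolding has_comp_def by auto
    qed
    also have "card \<dots> = (\<Sum>S\<in>{S \<in> ?K. has_comp E S}. card S)"
    proof (rule card_Union_disjoint)
      show "pairwise disjnt {S \<in> ?K. has_comp E S}"
        unfolding pairwise_def disjnt_def using has_comp_unique by blast
      show "finite S" if "S \<in> {S \<in> ?K. has_comp E S}" for S
        using that assms(1) by (auto intro: finite_subset)
    qed
    also have "\<dots> = (\<Sum>S\<in>{S \<in> ?K. has_comp E S}. j)" by (rule sum.cong) auto
    also have "\<dots> = (\<Sum>S\<in>?K. if has_comp E S then j else 0)" by (rule sum.inter_filter[OF finK])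
    finally show ?thesis .
  qed
  have "(\<Sum>E | P V E. card {x\<in>V. card (component_of E x) = j}) =
      (\<Sum>E | P V E. \<Sum>S\<in>?K. if has_comp E S then j else 0)"
    by (rule sum.cong) (simp_all add: 1)
  also have "\<dots> = (\<Sum>S\<in>?K. \<Sum>E | P V E. if has_comp E S then j else 0)" by (rule sum.swap)
  also have "\<dots> = (\<Sum>S\<in>?K. j * kc j * c (card V - j))"
  proof (rule sum.cong)
    fix S assume S: "S \<in> ?K"
    then have finS: "finite S" using assms(1) by (auto intro: finite_subset)
    have cVS: "card (V - S) = card V - j" using S finS by (simp add: card_Diff_subset)
    have "(\<Sum>E | P V E. if has_comp E S then j else 0) = (\<Sum>E\<in>{E \<in> {E. P V E}. has_comp E S}. j)"
      by (rule sum.inter_filter[OF fin, symmetric])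
    also have "\<dots> = j * card {E. P V E \<and> has_comp E S}" by simp
    also have "{E. P V E \<and> has_comp E S} =
        {E. P V E \<and> has_comp E S \<and> (P S (induced E S) \<and> conn S (induced E S)) \<and> P (V - S) (induced E (V - S))}"
      using P_has_comp S by blast
    also have "card \<dots> = card {E. P S E \<and> conn S E} * card {E. P (V - S) E}"
      using S by (intro card_has_comp) auto
    also have "\<dots> = kc j * c (card V - j)"
      using S finS assms(1) by (simp add: card_conn card_P cVS)
    finally show "(\<Sum>E | P V E. if has_comp E S then j else 0) = j * kc j * c (card V - j)" by simp
  qed simp
  also have "\<dots> = (card V choose j) * (j * kc j * c (card V - j))"
    by (simp add: n_subsets[OF assms(1)])
  finally show ?thesis .
qed

lemma sum_component_size':
  assumes "0 < j"
  shows "(\<Sum>E | P {1..n} E. card {x\<in>{1..n}. card (component_of E x) = j}) =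
    (n choose j) * (j * kc j * c (n - j))"
  using sum_component_size[OF finite_atLeastAtMost assms, of 1 n] by (simp only: card_atLeastAtMost) simp

lemma card_comp_bounds:
  assumes "P {1..n} E" "x \<in> {1..n}"
  shows "0 < card (component_of E x)" "card (component_of E x) \<le> n" "component_of E x \<subseteq> {1..n}"
proof -
  show s: "component_of E x \<subseteq> {1..n}" by (rule comp_subset[OF ugraphD(2)[OF P_ugraph[OF assms(1)]] assms(2)])
  then have "finite (component_of E x)" using finite_subset by blast
  then show "0 < card (component_of E x)" using self_in_comp[of x E] by (metis card_gt_0_iff empty_iff)
  show "card (component_of E x) \<le> n" using card_mono[OF _ s] by simp
qed

text \<open>Summed over all sizes \<open>j\<close>, every vertex of every graph is counted
  once.\<close>

lemma vertex_recurrence: "n * c n = (\<Sum>j=1..n. (n choose j) * (j * kc j * c (n - j)))"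
proof -
  have fin: "finite {E. P {1..n} E}" by (rule finite_P) simp
  have "(\<Sum>j=1..n. (n choose j) * (j * kc j * c (n - j))) =
     (\<Sum>j=1..n. \<Sum>E | P {1..n} E. card {x\<in>{1..n}. card (component_of E x) = j})"
    by (intro sum.cong refl sum_component_size'[symmetric]) simp
  also have "\<dots> = (\<Sum>E | P {1..n} E. \<Sum>j=1..n. card {x\<in>{1..n}. card (component_of E x) = j})"
    by (rule sum.swap)
  also have "\<dots> = (\<Sum>E | P {1..n} E. n)"
  proof (rule sum.cong)
    fix E assume "E \<in> {E. P {1..n} E}"
    then have E: "P {1..n} E" by simp
    have "(\<Sum>j=1..n. card {x\<in>{1..n}. card (component_of E x) = j}) =
        card (\<Union>j\<in>{1..n}. {x\<in>{1..n}. card (component_of E x) = j})"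
      by (rule card_UN_disjoint[symmetric]) auto
    also have "(\<Union>j\<in>{1..n}. {x\<in>{1..n}. card (component_of E x) = j}) = {1..n}"
    proof (intro equalityI subsetI)
      fix x assume "x \<in> {1..n}"
      then show "x \<in> (\<Union>j\<in>{1..n}. {x\<in>{1..n}. card (component_of E x) = j})"
        using card_comp_bounds(1,2)[OF E, of x] by (auto simp: Suc_le_eq)
    qed auto
    finally show "(\<Sum>j=1..n. card {x\<in>{1..n}. card (component_of E x) = j}) = n" by simp
  qed simp
  also have "\<dots> = n * c n" using card_P[of "{1..n}"] by simp
  finally show ?thesis by simp
qed

lemma sum_disconnected_le': "(\<Sum>E | P {1..n} E. \<Sum>x=1..n. n - card (component_of E x)) \<le> 2 * n * c n"
proof -
  have "(\<Sum>E | P {1..n} E. \<Sum>x=1..n. n - card (component_of E x)) =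
     (\<Sum>E | P {1..n} E. \<Sum>x\<in>{1..n}. card ({1..n} - component_of E x))"
  proof (intro sum.cong refl)
    fix E x assume "E \<in> {E. P {1..n} E}" and x: "x \<in> {1..n}"
    then have E: "P {1..n} E" by simp
    note b = card_comp_bounds(3)[OF E x]
    show "n - card (component_of E x) = card ({1..n} - component_of E x)"
      using card_Diff_subset[OF finite_subset[OF b] b] by simp
  qed
  also have "\<dots> \<le> 2 * n * c n" using sum_disconnected_le[of "{1..n}"] by simp
  finally show ?thesis .
qed

text \<open>A vertex in a component of size at most \<open>t\<close> has at least
  \<open>n - t\<close> vertices outside its component, so such vertices are few by
  \<open>sum_disconnected_le'\<close>. This will bound the derivative of the generating function of
  the connected graphs.\<close>

lemma small_components:
  assumes "t \<le> n"
  shows "(n - t) * (\<Sum>j=1..t. (n choose j) * (j * kc j * c (n - j))) \<le> 2 * n * c n"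
proof -
  have "(n - t) * (\<Sum>j=1..t. (n choose j) * (j * kc j * c (n - j))) =
     (n - t) * (\<Sum>j=1..t. \<Sum>E | P {1..n} E. card {x\<in>{1..n}. card (component_of E x) = j})"
    by (intro arg_cong2[where f = times] refl sum.cong sum_component_size'[symmetric]) simp
  also have "\<dots> = (n - t) * (\<Sum>E | P {1..n} E. \<Sum>j=1..t. card {x\<in>{1..n}. card (component_of E x) = j})"
    by (intro arg_cong2[where f = times] refl sum.swap)
  also have "\<dots> = (\<Sum>E | P {1..n} E. (n - t) * (\<Sum>j=1..t. card {x\<in>{1..n}. card (component_of E x) = j}))"
    by (rule sum_distrib_left)
  also have "\<dots> \<le> (\<Sum>E | P {1..n} E. \<Sum>x=1..n. n - card (component_of E x))"
  proof (rule sum_mono)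
    fix E assume "E \<in> {E. P {1..n} E}"
    have "(\<Sum>j=1..t. card {x\<in>{1..n}. card (component_of E x) = j}) =
        card (\<Union>j\<in>{1..t}. {x\<in>{1..n}. card (component_of E x) = j})"
      by (rule card_UN_disjoint[symmetric]) auto
    also have "\<dots> \<le> card {x\<in>{1..n}. card (component_of E x) \<le> t}"
      by (rule card_mono) auto
    finally have "(n - t) * (\<Sum>j=1..t. card {x\<in>{1..n}. card (component_of E x) = j}) \<le>
        (n - t) * card {x\<in>{1..n}. card (component_of E x) \<le> t}" by simp
    also have "\<dots> = (\<Sum>x\<in>{x\<in>{1..n}. card (component_of E x) \<le> t}. n - t)" by simp
    also have "\<dots> \<le> (\<Sum>x\<in>{x\<in>{1..n}. card (component_of E x) \<le> t}. n - card (component_of E x))"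
      by (rule sum_mono) auto
    also have "\<dots> \<le> (\<Sum>x=1..n. n - card (component_of E x))"
      by (rule sum_mono2) auto
    finally show "(n - t) * (\<Sum>j=1..t. card {x\<in>{1..n}. card (component_of E x) = j}) \<le>
        (\<Sum>x=1..n. n - card (component_of E x))" .
  qed
  also have "\<dots> \<le> 2 * n * c n" by (rule sum_disconnected_le')
  finally show ?thesis .
qed

text \<open>Markov's inequality: in such a graph each of the \<open>n\<close> vertices has at least
  \<open>t\<close> vertices outside its component.\<close>

lemma card_no_big_component:
  "t * n * card {E. P {1..n} E \<and> (\<forall>x\<in>{1..n}. card (component_of E x) + t < n)} \<le> 2 * n * c n"
proof -
  let ?B = "{E. P {1..n} E \<and> (\<forall>x\<in>{1..n}. card (component_of E x) + t < n)}"
  have "t * n * card ?B = (\<Sum>E\<in>?B. \<Sum>x=1..n. t)" by simp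
  also have "\<dots> \<le> (\<Sum>E\<in>?B. \<Sum>x=1..n. n - card (component_of E x))"
  proof (intro sum_mono)
    fix E x assume "E \<in> ?B" "x \<in> {1..n}"
    then have "card (component_of E x) + t < n" by blast
    then show "t \<le> n - card (component_of E x)" by simp
  qed
  also have "\<dots> \<le> (\<Sum>E | P {1..n} E. \<Sum>x=1..n. n - card (component_of E x))"
    by (rule sum_mono2) (auto intro: finite_P)
  also have "\<dots> \<le> 2 * n * c n" by (rule sum_disconnected_le')
  finally show ?thesis .
qed

text \<open>Splitting off a component of size at least \<open>n - t\<close>, which is unique as \<open>2 t < n\<close>. The type of the
  large component is unknown only if it satisfies \<open>B\<close>.\<close>

lemma card_by_big_component:
  assumes t: "2 * t < n"
    and inv: "invariant (\<lambda>V E. P V E \<and> \<Phi> V E)" "invariant (\<lambda>V E. P V E \<and> conn V E \<and> B V E)"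
    and \<Psi>: "\<And>S E. P {1..n} E \<Longrightarrow> S \<subseteq> {1..n} \<Longrightarrow> has_comp E S \<Longrightarrow> \<not> B S (induced E S) \<Longrightarrow>
      \<Psi> E \<longleftrightarrow> \<Phi> ({1..n} - S) (induced E ({1..n} - S))"
  shows "\<bar>real (card {E. P {1..n} E \<and> \<Psi> E}) -
      (\<Sum>i\<le>t. (n choose i) * (real (kc (n - i)) * cnt (\<lambda>V E. P V E \<and> \<Phi> V E) i))\<bar> \<le>
    card {E. P {1..n} E \<and> (\<forall>x\<in>{1..n}. card (component_of E x) + t < n)} +
      (\<Sum>i\<le>t. (n choose i) * (real (cnt (\<lambda>V E. P V E \<and> conn V E \<and> B V E) (n - i)) * c i))"
proof -
  let ?V = "{1..n}"
  let ?nb = "{E. P ?V E \<and> (\<forall>x\<in>?V. card (component_of E x) + t < n)}"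
  let ?g = "cnt (\<lambda>V E. P V E \<and> \<Phi> V E)" and ?b = "cnt (\<lambda>V E. P V E \<and> conn V E \<and> B V E)"
  define J where "J i = {S. S \<subseteq> ?V \<and> card S = n - i}" for i
  define X where "X S = {E. P ?V E \<and> has_comp E S \<and> \<Psi> E}" for S
  have finP: "finite {E. P ?V E}" by (rule finite_P) simp
  have finX: "finite (X S)" for S by (rule finite_subset[OF _ finP]) (auto simp: X_def)
  have finJ: "finite (J i)" for i by (simp add: J_def)
  have Sne: "S \<noteq> {}" "finite S" "card (?V - S) = i" if "i \<le> t" "S \<in> J i" for i S
  proof -
    have S: "S \<subseteq> ?V" "card S = n - i" using that by (simp_all add: J_def)
    show fS: "finite S" using S(1) finite_subset by blast
    show "S \<noteq> {}" using S(2) t that(1) by auto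
    show "card (?V - S) = i" using card_Diff_subset[OF fS S(1)] S(2) t that(1) by simp
  qed
  have cX: "\<bar>real (card (X S)) - real (kc (n - i)) * ?g i\<bar> \<le> real (?b (n - i)) * c i" if "i \<le> t" "S \<in> J i" for i S
  proof -
    note Sf = Sne[OF that]
    have S: "S \<subseteq> ?V" "card S = n - i" using that by (simp_all add: J_def)
    have finVS: "finite (?V - S)" by simp
    define Y where "Y = {E. P ?V E \<and> has_comp E S \<and> \<Phi> (?V - S) (induced E (?V - S))}"
    define Z where "Z = {E. P ?V E \<and> has_comp E S \<and> B S (induced E S)}"
    have Y: "Y = {E. P ?V E \<and> has_comp E S \<and> (P S (induced E S) \<and> conn S (induced E S)) \<and>
        (P (?V - S) (induced E (?V - S)) \<and> \<Phi> (?V - S) (induced E (?V - S)))}"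
      unfolding Y_def by (intro Collect_cong) (use P_has_comp[OF _ S(1)] in blast)
    have "card Y = card {E. P S E \<and> conn S E} * card {E. P (?V - S) E \<and> \<Phi> (?V - S) E}"
      unfolding Y
      by (rule card_has_comp[where ?F1.0 = "\<lambda>E. P S E \<and> conn S E" and
          ?F2.0 = "\<lambda>E. P (?V - S) E \<and> \<Phi> (?V - S) E", OF S(1)]) blast+
    also have "\<dots> = kc (n - i) * ?g i"
      by (simp only: card_conn[OF Sf(2)] card_invariant[OF inv(1) finVS] S(2) Sf(3))
    finally have cY: "card Y = kc (n - i) * ?g i" .
    have Z: "Z = {E. P ?V E \<and> has_comp E S \<and> (P S (induced E S) \<and> conn S (induced E S) \<and> B S (induced E S)) \<and>
        P (?V - S) (induced E (?V - S))}"
      unfolding Z_def by (intro Collect_cong) (use P_has_comp[OF _ S(1)] in blast)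
    have "card Z = card {E. P S E \<and> conn S E \<and> B S E} * card {E. P (?V - S) E}"
      unfolding Z
      by (rule card_has_comp[where ?F1.0 = "\<lambda>E. P S E \<and> conn S E \<and> B S E" and
          ?F2.0 = "\<lambda>E. P (?V - S) E", OF S(1)]) blast+
    also have "\<dots> = ?b (n - i) * c i"
      by (simp only: card_P[OF finVS] card_invariant[OF inv(2) Sf(2)] S(2) Sf(3))
    finally have cZ: "card Z = ?b (n - i) * c i" .
    \<comment> \<open>By the assumption on \<Psi> the sets \<open>X S\<close> and \<open>Y\<close>
      can differ only inside \<open>Z\<close>, and this is the source of the second error
      term.\<close>
    have sub: "X S \<subseteq> Y \<union> Z" "Y \<subseteq> X S \<union> Z"
      unfolding X_def Y_def Z_def using \<Psi> S(1) by blast+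
    have fin: "finite Y" "finite Z"
      by (rule finite_subset[OF _ finP]; auto simp: Y_def Z_def)+
    have "card (X S) \<le> card (Y \<union> Z)" by (rule card_mono) (use sub fin in auto)
    also have "\<dots> \<le> card Y + card Z" by (rule card_Un_le)
    finally have le1: "card (X S) \<le> card Y + card Z" .
    have "card Y \<le> card (X S \<union> Z)" by (rule card_mono) (use sub fin finX in auto)
    also have "\<dots> \<le> card (X S) + card Z" by (rule card_Un_le)
    finally have le2: "card Y \<le> card (X S) + card Z" .
    have "\<bar>real (card (X S)) - real (card Y)\<bar> \<le> real (card Z)" using le1 le2 by linarith
    then show ?thesis by (simp add: cY cZ)
  qed
  have disjX: "X S \<inter> X S' = {}" if "i \<le> t" "S \<in> J i" "i' \<le> t" "S' \<in> J i'" "S \<noteq> S'" for i S i' S'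
  proof (rule ccontr)
    assume "X S \<inter> X S' \<noteq> {}"
    then obtain E where "has_comp E S" "has_comp E S'" by (auto simp: X_def)
    then have "S \<inter> S' = {}" using has_comp_unique that(5) by blast
    moreover have "S \<union> S' \<subseteq> ?V" using that by (auto simp: J_def)
    ultimately have "card S + card S' \<le> card ?V"
      using card_Un_disjoint[of S S'] Sne(2) that card_mono[of ?V "S \<union> S'"] by simp
    then show False using that t by (simp add: J_def)
  qed
  have big: "{E. P ?V E \<and> \<Psi> E} - ?nb \<subseteq> (\<Union>i\<le>t. \<Union>S\<in>J i. X S)"
  proof
    fix E assume "E \<in> {E. P ?V E \<and> \<Psi> E} - ?nb"
    then obtain x where E: "P ?V E" "\<Psi> E" "x \<in> ?V" "n \<le> card (component_of E x) + t" by (auto simp: not_less)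
    let ?S = "component_of E x"
    note b = card_comp_bounds[OF E(1,3)]
    have "?S \<in> J (n - card ?S)" using b by (simp add: J_def)
    moreover have "n - card ?S \<le> t" using E(4) by simp
    moreover have "E \<in> X ?S" using E has_comp_iff[OF ugraphD(3)[OF P_ugraph[OF E(1)]]] by (auto simp: X_def)
    ultimately show "E \<in> (\<Union>i\<le>t. \<Union>S\<in>J i. X S)" by blast
  qed
  have cU: "card (\<Union>i\<le>t. \<Union>S\<in>J i. X S) = (\<Sum>i\<le>t. \<Sum>S\<in>J i. card (X S))"
  proof -
    have "card (\<Union>i\<le>t. \<Union>S\<in>J i. X S) = (\<Sum>i\<le>t. card (\<Union>S\<in>J i. X S))"
    proof (rule card_UN_disjoint)
      show "\<forall>i\<in>{..t}. \<forall>j\<in>{..t}. i \<noteq> j \<longrightarrow> (\<Union>S\<in>J i. X S) \<inter> (\<Union>S\<in>J j. X S) = {}"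
      proof (intro ballI impI)
        fix i j assume ij: "i \<in> {..t}" "j \<in> {..t}" "i \<noteq> j"
        have "X S \<inter> X S' = {}" if "S \<in> J i" "S' \<in> J j" for S S'
        proof (rule disjX[of i S j S'])
          show "S \<noteq> S'" using that ij t by (auto simp: J_def)
        qed (use that ij in auto)
        then show "(\<Union>S\<in>J i. X S) \<inter> (\<Union>S\<in>J j. X S) = {}" by blast
      qed
    qed (use finX finJ in auto)
    also have "\<dots> = (\<Sum>i\<le>t. \<Sum>S\<in>J i. card (X S))"
    proof (rule sum.cong)
      fix i assume "i \<in> {..t}"
      then show "card (\<Union>S\<in>J i. X S) = (\<Sum>S\<in>J i. card (X S))"
        using disjX finX finJ by (intro card_UN_disjoint) auto
    qed simp
    finally show ?thesis .
  qed
  let ?U = "\<Union>i\<le>t. \<Union>S\<in>J i. X S"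
  have finU: "finite ?U" using finX finJ by blast
  have fnb: "finite ?nb" by (rule finite_subset[OF _ finP]) auto
  have UP: "?U \<subseteq> {E. P ?V E \<and> \<Psi> E}" unfolding X_def by auto
  have finPsi: "finite {E. P ?V E \<and> \<Psi> E}" by (rule finite_subset[OF _ finP]) auto
  have "card {E. P ?V E \<and> \<Psi> E} \<le> card (?nb \<union> ?U)"
    by (rule card_mono) (use big fnb finU in auto)
  also have "\<dots> \<le> card ?nb + card ?U" by (rule card_Un_le)
  finally have l1: "real (card {E. P ?V E \<and> \<Psi> E}) \<le> real (card ?nb) + real (card ?U)" by linarith
  have l2: "real (card ?U) \<le> real (card {E. P ?V E \<and> \<Psi> E})" using card_mono[OF finPsi UP] by simp
  have cJ: "card (J i) = n choose i" if "i \<le> t" for i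
    using n_subsets[of ?V "n - i"] binomial_symmetric[of i n] that t by (simp add: J_def)
  have "real (card ?U) - (\<Sum>i\<le>t. (n choose i) * (real (kc (n - i)) * ?g i)) =
      (\<Sum>i\<le>t. \<Sum>S\<in>J i. real (card (X S)) - real (kc (n - i)) * ?g i)"
    unfolding cU by (simp add: sum_subtractf cJ)
  also have "\<bar>\<dots>\<bar> \<le> (\<Sum>i\<le>t. \<Sum>S\<in>J i. real (?b (n - i)) * c i)"
    by (rule order_trans[OF sum_abs sum_mono], rule order_trans[OF sum_abs sum_mono]) (use cX in auto)
  also have "\<dots> = (\<Sum>i\<le>t. (n choose i) * (real (?b (n - i)) * c i))"
    by (simp add: cJ)
  finally show ?thesis using l1 l2 by linarith
qed

end

section \<open>Pendant copies\<close>

lemma map_prod_Times: "map_prod f f ` (A \<times> B) = f ` A \<times> f ` B"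
  by (simp add: map_prod_surj_on[OF refl refl])

lemma map_prod_Int_Times:
  assumes "inj_on f V" "E \<subseteq> V \<times> V" "A \<subseteq> V" "B \<subseteq> V"
  shows "map_prod f f ` E \<inter> f ` A \<times> f ` B = map_prod f f ` (E \<inter> A \<times> B)"
proof -
  have inj: "inj_on (map_prod f f) (V \<times> V)" by (rule map_prod_inj_on[OF assms(1,1)])
  have "A \<times> B \<subseteq> V \<times> V" using assms(3,4) by (rule Sigma_mono)
  from inj_on_image_Int[OF inj assms(2) this] show ?thesis by (simp only: map_prod_Times)
qed

lemma pendant_image:
  assumes "pendant VH EH s V E" "inj_on f V" "E \<subseteq> V \<times> V"
  shows "pendant VH EH s (f ` V) (map_prod f f ` E)"
proof -
  obtain g v where g: "inj_on g VH" "g ` VH \<subseteq> V" "v \<in> V - g ` VH"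
     "induced E (g ` VH) = map_prod g g ` EH" "E \<inter> g ` VH \<times> (V - g ` VH) = {(g s, v)}"
    using assms(1) unfolding pendant_def by (elim exE conjE)
  have im: "(f \<circ> g) ` VH = f ` g ` VH" by (simp add: image_comp)
  have diff: "f ` V - f ` g ` VH = f ` (V - g ` VH)"
    using inj_on_image_set_diff[OF assms(2), of V "g ` VH"] g(2) by simp
  show ?thesis unfolding pendant_def
  proof (intro exI conjI)
    show "inj_on (f \<circ> g) VH" using g(1) inj_on_subset[OF assms(2) g(2)] by (rule comp_inj_on)
    show "(f \<circ> g) ` VH \<subseteq> f ` V" unfolding im using g(2) by (rule image_mono)
    show "f v \<in> f ` V - (f \<circ> g) ` VH" unfolding im diff using g(3) by (rule imageI)
    show "induced (map_prod f f ` E) ((f \<circ> g) ` VH) = map_prod (f \<circ> g) (f \<circ> g) ` EH"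
      unfolding im map_prod_Int_Times[OF assms(2,3) g(2,2)] g(4) by (simp add: image_comp map_prod.comp)
    show "map_prod f f ` E \<inter> (f \<circ> g) ` VH \<times> (f ` V - (f \<circ> g) ` VH) = {((f \<circ> g) s, f v)}"
      unfolding im diff map_prod_Int_Times[OF assms(2,3) g(2) Diff_subset] g(5) by simp
  qed
qed

lemma map_prod_inv_into:
  assumes "inj_on f V" "E \<subseteq> V \<times> V"
  shows "map_prod (inv_into V f) (inv_into V f) ` map_prod f f ` E = E"
proof -
  have "map_prod (inv_into V f) (inv_into V f) (map_prod f f e) = e" if "e \<in> E" for e
    using that assms by (cases e) auto
  then show ?thesis unfolding image_image by simp
qed

lemma pendant_image_iff:
  assumes "inj_on f V" "E \<subseteq> V \<times> V"
  shows "pendant VH EH s (f ` V) (map_prod f f ` E) \<longleftrightarrow> pendant VH EH s V E"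
proof
  assume p: "pendant VH EH s (f ` V) (map_prod f f ` E)"
  have "map_prod f f ` E \<subseteq> f ` V \<times> f ` V"
    using image_mono[OF assms(2), of "map_prod f f"] by (simp only: map_prod_Times)
  from pendant_image[OF p inj_on_inv_into[OF subset_refl] this]
  show "pendant VH EH s V E"
    by (simp only: map_prod_inv_into[OF assms] inv_into_image_cancel[OF assms(1) subset_refl])
qed (rule pendant_image[OF _ assms])

text \<open>Attaching a pendant copy on \<open>W\<close> at \<open>v\<close> to a graph without pendant copies creates few other
  pendant copies \<open>W'\<close>: each of them consists of vertices of \<open>W\<close> and possibly the component of \<open>v\<close>.\<close>

lemma pendant_copy_cases:
  assumes W: "ugraph W EW" "conn W EW" "t \<in> W" and U: "ugraph U E0" "v \<in> U" "W \<inter> U = {}"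
    and E: "E = joinE EW {t} E0 {v}"
    and np: "\<not> pendant VH EH s U E0"
    and W': "W' \<subseteq> W \<union> U" "card W' = card W" "conn W' (induced E W')"
    and f: "inj_on f VH" "f ` VH = W'" "induced E W' = map_prod f f ` EH"
    and cut: "E \<inter> W' \<times> (W \<union> U - W') = {(f s, v')}"
  shows "W' \<inter> U = {} \<or> W' \<inter> U = component_of E0 v"
proof (cases "W' \<inter> U = {}")
  case False
  then obtain x0 where x0: "x0 \<in> W'" "x0 \<in> U" by blast
  have EWsub: "EW \<subseteq> W \<times> W" and E0sub: "E0 \<subseteq> U \<times> U" using W(1) U(1) by (simp_all add: ugraphD)
  have sym0: "sym E0" using U(1) by (rule ugraphD)
  have fromU: "(x, y) \<in> E0 \<or> (x = v \<and> y = t)" if "(x, y) \<in> E" "x \<in> U" for x y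
    using that EWsub W(3) U(2,3) unfolding E joinE_def by blast
  have E0E: "E0 \<subseteq> E" and EWE: "EW \<subseteq> E" unfolding E joinE_def by blast+
  have leave: "x = f s \<and> y = v'" if "(x, y) \<in> E" "x \<in> W'" "y \<in> W \<union> U" "y \<notin> W'" for x y
  proof -
    have "(x, y) \<in> E \<inter> W' \<times> (W \<union> U - W')" using that by simp
    then show ?thesis unfolding cut by simp
  qed
  have cutin: "(f s, v') \<in> E" "f s \<in> W'" "v' \<in> W \<union> U" "v' \<notin> W'"
  proof -
    have "(f s, v') \<in> E \<inter> W' \<times> (W \<union> U - W')" unfolding cut by simp
    then show "(f s, v') \<in> E" "f s \<in> W'" "v' \<in> W \<union> U" "v' \<notin> W'" by simp_all
  qed
  \<comment> \<open>Only \<open>v\<close> links \<open>U\<close> to \<open>W\<close>, so a vertex of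
    \<open>U\<close> outside the component of \<open>v\<close> cannot reach \<open>v\<close> inside
    the connected set \<open>W'\<close>.\<close>
  have inC: "x \<in> component_of E0 v" if "x \<in> W'" "x \<in> U" "v \<in> W'" for x
  proof (rule ccontr)
    assume "x \<notin> component_of E0 v"
    then have v: "v \<notin> component_of E0 x" using comp_sym[OF sym0] by blast
    have sub: "component_of E0 x \<subseteq> U" by (rule comp_subset[OF E0sub that(2)])
    have "induced E W' `` component_of E0 x \<subseteq> component_of E0 x"
    proof
      fix b assume "b \<in> induced E W' `` component_of E0 x"
      then obtain a where a: "a \<in> component_of E0 x" "(a, b) \<in> E" by blast
      then have "(a, b) \<in> E0" using fromU[of a b] sub v by blast
      with a(1) show "b \<in> component_of E0 x" by (rule comp_closed)
    qed
    then have "component_of (induced E W') x \<subseteq> component_of E0 x" by (rule comp_subset_closed) simp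
    then have "W' \<subseteq> component_of E0 x" by (simp only: connD[OF W'(3) that(1)])
    with v that(3) show False by blast
  qed
  \<comment> \<open>The only edge that leaves \<open>W'\<close> ends in \<open>W\<close>, so no edge
    of \<open>E0\<close> leaves \<open>W' \<inter> U\<close>, which is then a whole
    component.\<close>
  have goal: "W' \<inter> U = component_of E0 v" if v: "v \<in> W'" and stay: "v' \<in> W"
  proof
    show "W' \<inter> U \<subseteq> component_of E0 v" using inC v by blast
    show "component_of E0 v \<subseteq> W' \<inter> U"
    proof (rule comp_subset_closed)
      show "E0 `` (W' \<inter> U) \<subseteq> W' \<inter> U"
      proof
        fix b assume "b \<in> E0 `` (W' \<inter> U)"
        then obtain a where a: "a \<in> W'" "(a, b) \<in> E0" by blast
        then have b: "b \<in> U" "(a, b) \<in> E" using E0sub E0E by blast+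
        have "b \<in> W'"
        proof (rule ccontr)
          assume "b \<notin> W'"
          then have "b = v'" using leave[OF b(2) a(1)] b(1) by blast
          with stay b(1) U(3) show False by blast
        qed
        with b(1) show "b \<in> W' \<inter> U" by simp
      qed
    qed (use v U(2) in simp)
  qed
  show ?thesis
  proof (cases "W' \<inter> W = {}")
    case True
    then have W'U: "W' \<subseteq> U" using W'(1) by blast
    show ?thesis
    proof (cases "v' \<in> W")
      case v'W: True
      have "f s = v"
        using fromU[OF cutin(1)] cutin(2) W'U v'W E0sub U(3) by blast
      then have "v \<in> W'" using cutin(2) by simp
      from goal[OF this v'W] show ?thesis ..
    next
      case v'W: False
      \<comment> \<open>The edge leaving \<open>W'\<close> stays in \<open>U\<close>, so
        \<open>W'\<close> would already be a pendant copy in \<open>E0\<close>.\<close>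
      have v'U: "v' \<in> U" using v'W cutin(3) by blast
      have EU: "(x, y) \<in> E \<longleftrightarrow> (x, y) \<in> E0" if "x \<in> U" "y \<in> U" for x y
        using fromU[of x y] that E0E U(3) W(3) by blast
      have "induced E0 W' = induced E W'" using EU W'U by blast
      then have 1: "induced E0 (f ` VH) = map_prod f f ` EH" using f(2,3) by simp
      have "E0 \<inter> W' \<times> (U - W') = {(f s, v')}"
      proof
        have "E0 \<inter> W' \<times> (U - W') \<subseteq> E \<inter> W' \<times> (W \<union> U - W')" using E0E by blast
        then show "E0 \<inter> W' \<times> (U - W') \<subseteq> {(f s, v')}" unfolding cut .
        have "(f s, v') \<in> E0" using EU[of "f s" v'] cutin(1,2) W'U v'U by blast
        then show "{(f s, v')} \<subseteq> E0 \<inter> W' \<times> (U - W')" using cutin(2,4) v'U by simp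
      qed
      then have "pendant VH EH s U E0"
        unfolding pendant_def using f(1,2) 1 W'U v'U cutin(4) by (intro exI[of _ f] exI[of _ v']) simp
      with np show ?thesis ..
    qed
  next
    case False
    then obtain w where w: "w \<in> W'" "w \<in> W" by blast
    \<comment> \<open>\<open>W'\<close> has as many vertices as \<open>W\<close> and meets
      \<open>U\<close>, so it misses a vertex of \<open>W\<close>. As \<open>W\<close> is connected,
      an edge inside \<open>W\<close> leaves \<open>W'\<close>; it must be the unique leaving edge,
      which puts \<open>v'\<close> into \<open>W\<close>.\<close>
    have "\<not> W \<subseteq> W'"
    proof
      assume "W \<subseteq> W'"
      moreover have "finite W'" using W'(1) ugraphD(1)[OF W(1)] ugraphD(1)[OF U(1)] finite_subset by blast
      ultimately have "W = W'" using W'(2) by (simp add: card_subset_eq)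
      with x0 U(3) show False by blast
    qed
    then obtain z where z: "z \<in> W" "z \<notin> W'" by blast
    have "\<not> EW `` (W \<inter> W') \<subseteq> W \<inter> W'"
    proof
      assume "EW `` (W \<inter> W') \<subseteq> W \<inter> W'"
      then have "component_of EW w \<subseteq> W \<inter> W'" by (rule comp_subset_closed) (use w in simp)
      then show False using connD[OF W(2) w(2)] z by blast
    qed
    then obtain a b where ab: "a \<in> W'" "(a, b) \<in> EW" "b \<notin> W \<inter> W'" by blast
    then have b: "b \<in> W" "b \<notin> W'" "(a, b) \<in> E" using EWsub EWE by blast+
    then have v'W: "v' \<in> W" using leave[OF b(3) ab(1)] by blast
    have "v \<in> W'"
    proof (rule ccontr)
      assume v: "v \<notin> W'"
      have "induced E W' `` (W' \<inter> U) \<subseteq> W' \<inter> U"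
      proof
        fix b assume "b \<in> induced E W' `` (W' \<inter> U)"
        then obtain a where a: "a \<in> W'" "a \<in> U" "(a, b) \<in> E" "b \<in> W'" by blast
        then have "(a, b) \<in> E0" using fromU[of a b] v by blast
        then show "b \<in> W' \<inter> U" using a(4) E0sub by blast
      qed
      then have "component_of (induced E W') x0 \<subseteq> W' \<inter> U" by (rule comp_subset_closed) (use x0 in simp)
      then have "W' \<subseteq> U" using connD[OF W'(3) x0(1)] by simp
      with w U(3) show False by blast
    qed
    from goal[OF this v'W] show ?thesis ..
  qed
qed simp

lemma card_fibres_le:
  assumes "finite T" "finite Y" "\<Phi> ` T \<subseteq> Y" "\<And>y. card {t \<in> T. \<Phi> t = y} \<le> b"
  shows "card T \<le> b * card Y"
proof -
  have "card T = (\<Sum>y\<in>Y. card {t \<in> T. \<Phi> t = y})"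
    using sum.group[OF assms(1-3), of "\<lambda>_. 1::nat"] by simp
  also have "\<dots> \<le> (\<Sum>y\<in>Y. b)" by (rule sum_mono) (rule assms(4))
  finally show ?thesis by (simp add: mult.commute)
qed

context addable_class
begin

lemma invariant_no_pendant: "invariant (\<lambda>V E. P V E \<and> \<not> pendant VH EH s V E)"
  unfolding invariant_def
proof (intro conjI allI impI; elim conjE)
  fix V E and f :: "nat \<Rightarrow> nat" assume *: "P V E" "\<not> pendant VH EH s V E" "inj_on f V"
  show "\<not> pendant VH EH s (f ` V) (map_prod f f ` E)"
    using * pendant_image_iff[OF *(3) ugraphD(2)[OF P_ugraph[OF *(1)]]] by blast
qed (erule P_ugraph, erule P_iso)

text \<open>The left side counts the choices of a vertex set \<open>W\<close> for the copy, a vertex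
  \<open>v\<close> and a graph without pendant copies on the rest. By
  \<open>pendant_copy_cases\<close> the other sets \<open>W'\<close> that give the same result
  consist of a subset of \<open>W\<close> and possibly one fixed component, which leaves
  \<open>2 * 2 ^ card VH\<close> candidates. Given \<open>W'\<close>, the attached vertex and the
  rest can be read off from the result.\<close>

lemma pendant_free_count:
  assumes H: "P VH EH" "conn VH EH" "s \<in> VH"
  shows "((n + card VH) choose card VH) * n * cnt (\<lambda>V E. P V E \<and> \<not> pendant VH EH s V E) n \<le>
    2 ^ Suc (card VH) * c (n + card VH)"
proof -
  let ?m = "card VH"
  let ?V = "{1..n + card VH}"
  let ?F = "\<lambda>V E. P V E \<and> \<not> pendant VH EH s V E"
  note gH = P_ugraph[OF H(1)]
  define K where "K = {W. W \<subseteq> ?V \<and> card W = ?m}"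
  have KV: "W \<subseteq> ?V" "card W = ?m" "finite W" if "W \<in> K" for W
    using that finite_subset[of W ?V] by (auto simp: K_def)
  \<comment> \<open>One labelling of \<open>H\<close> is fixed on each vertex set, so that
    \<open>W\<close> alone determines the edges of the copy.\<close>
  have "\<exists>h. bij_betw h VH W" if "W \<in> K" for W
    by (rule finite_same_card_bij[OF ugraphD(1)[OF gH] KV(3)[OF that]]) (simp add: KV(2)[OF that])
  then obtain h where h: "\<And>W. W \<in> K \<Longrightarrow> bij_betw (h W) VH W" by metis
  have h': "inj_on (h W) VH" "h W ` VH = W" if "W \<in> K" for W
    using h[OF that] by (simp_all add: bij_betw_def)
  define EW where "EW W = map_prod (h W) (h W) ` EH" for W
  have PW: "P W (EW W)" "conn W (EW W)" "h W s \<in> W" if "W \<in> K" for W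
    using P_iso[OF H(1) h'(1)[OF that]] conn_image[OF gH H(2), of "h W"] H(3) h'(2)[OF that]
    by (auto simp: EW_def)
  define T where "T = (SIGMA W:K. SIGMA v:?V - W. {E. ?F (?V - W) E})"
  define \<Phi> where "\<Phi> = (\<lambda>(W, v, E0). joinE (EW W) {h W s} E0 {v})"
  have finK: "finite K" by (simp add: K_def)
  have finF: "finite {E. ?F (?V - W) E}" for W
    by (rule finite_invariant[OF invariant_no_pendant]) simp
  have finT: "finite T" unfolding T_def using finK finF by blast
  have cVW: "card (?V - W) = n" if "W \<in> K" for W
    using KV[OF that] by (simp add: card_Diff_subset)
  have cardT: "card T = ((n + ?m) choose ?m) * n * cnt ?F n"
  proof -
    have "card T = (\<Sum>W\<in>K. card (SIGMA v:?V - W. {E. ?F (?V - W) E}))"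
      unfolding T_def by (rule card_SigmaI[OF finK]) (use finF in blast)
    also have "\<dots> = (\<Sum>W\<in>K. n * cnt ?F n)"
    proof (rule sum.cong)
      fix W assume W: "W \<in> K"
      have "card (SIGMA v:?V - W. {E. ?F (?V - W) E}) = card (?V - W) * card {E. ?F (?V - W) E}"
        by (rule card_cartesian_product)
      also have "card {E. ?F (?V - W) E} = cnt ?F n"
        using card_invariant[OF invariant_no_pendant, of "?V - W" VH EH s] by (simp only: cVW[OF W]) simp
      finally show "card (SIGMA v:?V - W. {E. ?F (?V - W) E}) = n * cnt ?F n" by (simp only: cVW[OF W])
    qed simp
    also have "\<dots> = card K * (n * cnt ?F n)" by simp
    also have "card K = (n + ?m) choose ?m" unfolding K_def by (simp add: n_subsets)
    finally show ?thesis by simp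
  qed
  have T: "W \<in> K" "v \<in> ?V" "v \<notin> W" "P (?V - W) E0" "\<not> pendant VH EH s (?V - W) E0"
    if "(W, v, E0) \<in> T" for W v E0
    using that by (auto simp: T_def)
  have \<Phi>P: "P ?V (\<Phi> (W, v, E0))" if "(W, v, E0) \<in> T" for W v E0
  proof -
    note t = T[OF that]
    have "P (W \<union> (?V - W)) (joinE (EW W) {h W s} E0 {v})"
      using t by (intro P_joinE PW(1,3)) auto
    moreover have "W \<union> (?V - W) = ?V" using KV(1)[OF t(1)] by blast
    ultimately show ?thesis by (simp only: \<Phi>_def prod.case)
  qed
  have recover: "induced E (?V - W) = E0" "E \<inter> W \<times> (?V - W) = {(h W s, v)}" "induced E W = EW W"
    if "(W, v, E0) \<in> T" "\<Phi> (W, v, E0) = E" for W v E0 E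
  proof -
    note t = T[OF that(1)]
    have s1: "EW W \<subseteq> W \<times> W" "E0 \<subseteq> (?V - W) \<times> (?V - W)"
      using P_ugraph[OF PW(1)[OF t(1)]] P_ugraph[OF t(4)] by (simp_all add: ugraphD)
    have E: "E = EW W \<union> E0 \<union> {(h W s, v)} \<union> {(v, h W s)}"
      using that(2) by (simp add: \<Phi>_def joinE_def)
    have x: "h W s \<in> W" "v \<notin> W" "v \<in> ?V - W" using PW(3)[OF t(1)] t by auto
    have "EW W \<inter> (?V - W) \<times> (?V - W) = {}" "E0 \<inter> (?V - W) \<times> (?V - W) = E0"
       "EW W \<inter> W \<times> (?V - W) = {}" "E0 \<inter> W \<times> (?V - W) = {}" "EW W \<inter> W \<times> W = EW W" "E0 \<inter> W \<times> W = {}"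
      using s1 by fast+
    then show "induced E (?V - W) = E0" "E \<inter> W \<times> (?V - W) = {(h W s, v)}" "induced E W = EW W"
      unfolding E Int_Un_distrib2 using x by simp_all
  qed
  have fibre: "card {p \<in> T. \<Phi> p = E} \<le> 2 ^ Suc ?m" for E
  proof (cases "{p \<in> T. \<Phi> p = E} = {}")
    case False
    then obtain p where p: "p \<in> T" "\<Phi> p = E" by blast
    obtain W v E0 where "p = (W, v, E0)" by (cases p)
    with p have WT: "(W, v, E0) \<in> T" "\<Phi> (W, v, E0) = E" by simp_all
    note t = T[OF WT(1)] and WK = PW[OF T(1)[OF WT(1)]] and VK = KV[OF T(1)[OF WT(1)]]
    let ?C = "component_of E0 v"
    have V: "W \<union> (?V - W) = ?V" using VK(1) by blast
    have "fst ` {p \<in> T. \<Phi> p = E} \<subseteq> (\<lambda>(X, Y). X \<union> Y) ` ({{}, ?C} \<times> Pow W)"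
    proof (rule image_subsetI)
      fix q assume "q \<in> {p \<in> T. \<Phi> p = E}"
      moreover obtain W' v' E0' where q: "q = (W', v', E0')" by (cases q)
      ultimately have WT': "(W', v', E0') \<in> T" "\<Phi> (W', v', E0') = E" by simp_all
      note t' = T[OF WT'(1)] and W'K = PW[OF T(1)[OF WT'(1)]] and V'K = KV[OF T(1)[OF WT'(1)]]
      note rec = recover[OF WT']
      have "W' \<inter> (?V - W) = {} \<or> W' \<inter> (?V - W) = ?C"
      proof (rule pendant_copy_cases[of W "EW W" "h W s" _ E0 v E VH EH s W' "h W'" v'])
        show "ugraph W (EW W)" "ugraph (?V - W) E0" using P_ugraph WK t by blast+
        show "E = joinE (EW W) {h W s} E0 {v}" using WT(2) by (simp add: \<Phi>_def)
        show "W' \<subseteq> W \<union> (?V - W)" using V V'K(1) by simp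
        show "card W' = card W" using V'K VK by simp
        show "conn W' (induced E W')" using rec(3) W'K by simp
        show "inj_on (h W') VH" "h W' ` VH = W'" using h'[OF t'(1)] by blast+
        show "induced E W' = map_prod (h W') (h W') ` EH" using rec(3) by (simp add: EW_def)
        show "E \<inter> W' \<times> (W \<union> (?V - W) - W') = {(h W' s, v')}" unfolding V by (rule rec(2))
      qed (use t WK in auto)
      then have "W' \<inter> (?V - W) \<in> {{}, ?C}" by simp
      moreover have "W' = (W' \<inter> (?V - W)) \<union> (W' \<inter> W)" using V'K(1) by blast
      ultimately have "W' \<in> (\<lambda>(X, Y). X \<union> Y) ` ({{}, ?C} \<times> Pow W)"
        by (intro image_eqI[of W' _ "(W' \<inter> (?V - W), W' \<inter> W)"]) auto
      then show "fst q \<in> (\<lambda>(X, Y). X \<union> Y) ` ({{}, ?C} \<times> Pow W)" by (simp only: q fst_conv)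
    qed
    then have "card (fst ` {p \<in> T. \<Phi> p = E}) \<le> card ((\<lambda>(X, Y). X \<union> Y) ` ({{}, ?C} \<times> Pow W))"
      by (rule card_mono[rotated]) (use VK(3) in simp)
    also have "\<dots> \<le> card ({{}, ?C} \<times> Pow W)" by (rule card_image_le) (use VK(3) in simp)
    also have "\<dots> \<le> 2 * 2 ^ ?m"
      unfolding card_cartesian_product using VK by (simp add: card_Pow card_insert_if)
    finally have "card (fst ` {p \<in> T. \<Phi> p = E}) \<le> 2 ^ Suc ?m" by simp
    moreover have "inj_on fst {p \<in> T. \<Phi> p = E}"
    proof (rule inj_onI)
      fix q q' assume q: "q \<in> {p \<in> T. \<Phi> p = E}" "q' \<in> {p \<in> T. \<Phi> p = E}" "fst q = fst q'"
      obtain W v E0 v' E0' where qq: "q = (W, v, E0)" "q' = (W, v', E0')" using q(3) by (metis prod.collapse)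
      have 1: "(W, v, E0) \<in> T" "\<Phi> (W, v, E0) = E" "(W, v', E0') \<in> T" "\<Phi> (W, v', E0') = E"
        using q qq by simp_all
      from recover(1)[OF 1(1,2)] recover(1)[OF 1(3,4)] have "E0 = E0'" by simp
      moreover from recover(2)[OF 1(1,2)] recover(2)[OF 1(3,4)] have "v = v'" by simp
      ultimately show "q = q'" by (simp add: qq)
    qed
    ultimately show ?thesis by (simp only: card_image)
  next
    case True
    show ?thesis unfolding True by simp
  qed
  have "card T \<le> 2 ^ Suc ?m * card {E. P ?V E}"
  proof (rule card_fibres_le[OF finT _ _ fibre])
    show "finite {E. P ?V E}" by (rule finite_P) simp
    show "\<Phi> ` T \<subseteq> {E. P ?V E}"
    proof (rule image_subsetI)
      fix p assume "p \<in> T"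
      then show "\<Phi> p \<in> {E. P ?V E}" using \<Phi>P by (cases p) blast
    qed
  qed
  also have "card {E. P ?V E} = c (n + ?m)" using card_P[of ?V] by simp
  finally show ?thesis unfolding cardT .
qed

end

section \<open>Asymptotics of the counts\<close>

text \<open>An exchange of limits: for fixed \<open>t\<close> the error \<open>e t n\<close>
  vanishes as \<open>n\<close> grows, and the error \<delta>, uniform in \<open>n\<close>, vanishes
  as \<open>t\<close> grows.\<close>

lemma limit_by_approximation:
  fixes x :: "nat \<Rightarrow> real"
  assumes "\<And>t. \<forall>\<^sub>F n in sequentially. \<bar>x n - z t n\<bar> \<le> \<delta> t + e t n"
    and "\<And>t. e t \<longlonglongrightarrow> 0" "\<And>t. z t \<longlonglongrightarrow> Y t" "\<delta> \<longlonglongrightarrow> 0" "Y \<longlonglongrightarrow> y"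
  shows "x \<longlonglongrightarrow> y"
proof (rule tendstoI)
  fix r :: real assume r: "0 < r"
  have "\<forall>\<^sub>F t in sequentially. dist (\<delta> t) 0 < r / 4 \<and> dist (Y t) y < r / 4"
    using tendstoD[OF assms(4), of "r / 4"] tendstoD[OF assms(5), of "r / 4"] r
    by (intro eventually_conj) auto
  from eventually_happens'[OF sequentially_bot this]
  obtain t where t: "dist (\<delta> t) 0 < r / 4" "dist (Y t) y < r / 4" by (elim exE conjE)
  have "\<forall>\<^sub>F n in sequentially. dist (e t n) 0 < r / 4"
    by (rule tendstoD[OF assms(2)]) (use r in simp)
  moreover have "\<forall>\<^sub>F n in sequentially. dist (z t n) (Y t) < r / 4"
    by (rule tendstoD[OF assms(3)]) (use r in simp)
  ultimately show "\<forall>\<^sub>F n in sequentially. dist (x n) y < r"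
    using assms(1)[of t]
  proof eventually_elim
    case (elim n)
    then show ?case using t unfolding dist_real_def by linarith
  qed
qed

text \<open>Dominated convergence for series: \<open>u\<close> is bounded, so a multiple of
  \<open>\<bar>v k\<bar>\<close> dominates the terms.\<close>

lemma tendsto_convolution:
  fixes v u :: "nat \<Rightarrow> real"
  assumes v: "summable (\<lambda>k. \<bar>v k\<bar>)" and u: "u \<longlonglongrightarrow> l"
  shows "(\<lambda>n. \<Sum>k\<le>n. v k * u (n - k)) \<longlonglongrightarrow> suminf v * l"
proof -
  have "Bseq u" using u by (intro convergent_imp_Bseq) (auto simp: convergent_def)
  then obtain B where B: "0 < B" "\<And>n. \<bar>u n\<bar> \<le> B" by (auto simp: Bseq_def)
  define f where "f k n = (if k \<le> n then v k * u (n - k) else 0)" for k n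
  have f: "(\<lambda>n. f k n) \<longlonglongrightarrow> v k * l" for k
  proof -
    have "(\<lambda>n. v k * u n) \<longlonglongrightarrow> v k * l" by (intro tendsto_intros u)
    then have "(\<lambda>n. f k (n + k)) \<longlonglongrightarrow> v k * l" by (simp add: f_def)
    then show ?thesis by (rule LIMSEQ_offset)
  qed
  have bound: "norm (f k n) \<le> \<bar>v k\<bar> * B" for k n
    using B(1) B(2)[of "n - k"] by (simp add: f_def abs_mult mult_left_mono)
  have "(\<lambda>n. suminf (\<lambda>k. f k n)) \<longlonglongrightarrow> suminf (\<lambda>k. v k * l)"
  proof -
    have "\<forall>\<^sub>F (k, n) in at_top \<times>\<^sub>F sequentially. norm (f k n) \<le> \<bar>v k\<bar> * B"
      by (rule always_eventually) (clarify, rule bound)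
    from tannerys_theorem[OF f this summable_mult2[OF v] sequentially_bot] show ?thesis by blast
  qed
  moreover have "suminf (\<lambda>k. f k n) = (\<Sum>k\<le>n. v k * u (n - k))" for n
    by (subst suminf_finite[of "{..n}"]) (auto simp: f_def)
  moreover have "suminf (\<lambda>k. v k * l) = suminf v * l"
    by (rule suminf_mult2[OF summable_rabs_cancel[OF v], symmetric])
  ultimately show ?thesis by simp
qed

text \<open>\<open>a\<close> and \<open>\<kappa>\<close> are the coefficients of the exponential generating functions of all graphs and of the
  connected graphs. The equation \<open>vertex_rec\<close> says that \<open>x A'(x) = x K'(x) A(x)\<close>.\<close>

locale smooth_counts =
  fixes a \<kappa> :: "nat \<Rightarrow> real" and L :: real
  assumes nonneg: "0 \<le> a n" "0 \<le> \<kappa> n" and a_0: "a 0 = 1" and \<kappa>_le: "\<kappa> n \<le> a n"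
    and pos: "\<forall>\<^sub>F n in sequentially. 0 < a n"
    and ratio: "(\<lambda>n. a (Suc n) / a n) \<longlonglongrightarrow> L"
    and ex_\<kappa>: "\<exists>m>0. 0 < \<kappa> m"
    and vertex_rec: "real n * a n = (\<Sum>j=1..n. real j * \<kappa> j * a (n - j))"
    and small: "t \<le> n \<Longrightarrow> real (n - t) * (\<Sum>j=1..t. real j * \<kappa> j * a (n - j)) \<le> 2 * real n * a n"
    and tight: "2 * t < n \<Longrightarrow> 0 < t \<Longrightarrow> \<bar>a n - (\<Sum>i\<le>t. a i * \<kappa> (n - i))\<bar> \<le> 2 / real t * a n"
begin

lemma ratio_shift: "(\<lambda>n. a (n + m) / a n) \<longlonglongrightarrow> L ^ m"
proof (induction m)
  case 0
  have "\<forall>\<^sub>F n in sequentially. a (n + 0) / a n = 1" using pos by eventually_elim simp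
  then show ?case by (simp add: tendsto_eventually)
next
  case (Suc m)
  have "(\<lambda>n. a (Suc (n + m)) / a (n + m) * (a (n + m) / a n)) \<longlonglongrightarrow> L * L ^ m"
    by (intro tendsto_mult Suc LIMSEQ_ignore_initial_segment[OF ratio])
  moreover have "\<forall>\<^sub>F n in sequentially. 0 < a (n + m)"
    using pos by (subst (asm) eventually_sequentially_seg[symmetric, of _ m])
  then have "\<forall>\<^sub>F n in sequentially. a (Suc (n + m)) / a (n + m) * (a (n + m) / a n) = a (n + Suc m) / a n"
    by eventually_elim simp
  ultimately show ?case by (simp add: Lim_transform_eventually)
qed

text \<open>Smoothness leaves open that the limit is \<open>0\<close>. Attaching components of a
  fixed order \<open>m\<close> with \<open>\<kappa> m > 0\<close> excludes this:
  \<open>small\<close> with \<open>t = m\<close> bounds \<open>a (n + m) / a n\<close> from below by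
  about \<open>m * \<kappa> m / 2\<close>.\<close>

lemma L_pos: "0 < L"
proof -
  obtain m where m: "0 < m" "0 < \<kappa> m" using ex_\<kappa> by blast
  have le: "real m * \<kappa> m / 2 * (real n / real (n + m)) \<le> a (n + m) / a n" if "0 < a n" for n
  proof -
    have "real m * \<kappa> m * a n \<le> (\<Sum>j=1..m. real j * \<kappa> j * a (n + m - j))"
      using member_le_sum[of m "{1..m}" "\<lambda>j. real j * \<kappa> j * a (n + m - j)"] m(1) nonneg by simp
    then have "real n * (real m * \<kappa> m * a n) \<le> real n * (\<Sum>j=1..m. real j * \<kappa> j * a (n + m - j))"
      by (rule mult_left_mono) simp
    also have "\<dots> \<le> 2 * real (n + m) * a (n + m)" using small[of m "n + m"] by simp
    finally show ?thesis using that m(1) by (simp add: field_simps)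
  qed
  have "(\<lambda>n. real m * \<kappa> m / 2 * (real n / real (n + m))) \<longlonglongrightarrow> real m * \<kappa> m / 2 * 1"
    by (intro tendsto_mult tendsto_const) real_asymp
  moreover have "\<forall>\<^sub>F n in sequentially. real m * \<kappa> m / 2 * (real n / real (n + m)) \<le> a (n + m) / a n"
    using pos by eventually_elim (rule le)
  ultimately have "real m * \<kappa> m / 2 * 1 \<le> L ^ m" by (intro tendsto_le[OF _ ratio_shift[of m]]) auto
  moreover have "0 < real m * \<kappa> m" using m by simp
  ultimately have "0 < L ^ m" by linarith
  moreover have "0 \<le> L" by (rule LIMSEQ_le_const[OF ratio]) (use nonneg in auto)
  ultimately show ?thesis using m(1) by (cases "L = 0") (auto simp: zero_power)
qed

section \<open>Summability at the radius of convergence\<close>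

definition \<rho> :: real where "\<rho> = 1 / L"

lemma \<rho>_pos: "0 < \<rho>"
  by (simp add: \<rho>_def L_pos)

lemma ratio_down: "(\<lambda>n. a (n - i) / a n) \<longlonglongrightarrow> \<rho> ^ i"
proof -
  have "(\<lambda>n. inverse (a (n + i) / a n)) \<longlonglongrightarrow> inverse (L ^ i)"
    using L_pos by (intro tendsto_inverse ratio_shift) simp
  then have "(\<lambda>n. a (n + i - i) / a (n + i)) \<longlonglongrightarrow> \<rho> ^ i"
    by (simp add: \<rho>_def power_one_over inverse_eq_divide)
  then show ?thesis by (rule LIMSEQ_offset)
qed

definition w :: "nat \<Rightarrow> real" where "w i = a i * \<rho> ^ i"

text \<open>The coefficients of \<open>x K'(x)\<close> with \<open>x\<close> scaled by \<rho>, where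
  \<open>K\<close> is the exponential generating function of the connected graphs.\<close>

definition cs :: "nat \<Rightarrow> real" where "cs j = real j * \<kappa> j * \<rho> ^ j"

lemma w_nonneg: "0 \<le> w i" and s_nonneg: "0 \<le> cs i"
  using nonneg \<rho>_pos by (simp_all add: w_def cs_def)

text \<open>Let \<open>n\<close> tend to infinity in \<open>small\<close> with \<open>t\<close>
  fixed: \<open>a (n - j) / a n\<close> becomes \<open>\<rho> ^ j\<close>, and
  \<open>n / (n - t)\<close> becomes \<open>1\<close>.\<close>

lemma s_sum_le: "(\<Sum>j=1..t. cs j) \<le> 2"
proof -
  have lim1: "(\<lambda>n. \<Sum>j=1..t. real j * \<kappa> j * (a (n - j) / a n)) \<longlonglongrightarrow> (\<Sum>j=1..t. real j * \<kappa> j * \<rho> ^ j)"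
    by (intro tendsto_sum tendsto_mult tendsto_const ratio_down)
  have "(\<lambda>n. real n / (real n - real t)) \<longlonglongrightarrow> 1" by real_asymp
  then have lim2: "(\<lambda>n. 2 * (real n / (real n - real t))) \<longlonglongrightarrow> 2 * 1" by (intro tendsto_intros)
  have "\<forall>\<^sub>F n in sequentially. (\<Sum>j=1..t. real j * \<kappa> j * (a (n - j) / a n)) \<le> 2 * (real n / (real n - real t))"
    using pos eventually_gt_at_top[of t]
  proof eventually_elim
    case (elim n)
    have "(\<Sum>j=1..t. real j * \<kappa> j * (a (n - j) / a n)) = (\<Sum>j=1..t. real j * \<kappa> j * a (n - j)) / a n"
      by (simp add: sum_divide_distrib)
    also have "\<dots> \<le> 2 * (real n / (real n - real t))"
      using small[of t n] elim by (simp add: field_simps of_nat_diff)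
    finally show ?case .
  qed
  from tendsto_le[OF _ lim2 lim1 this] show ?thesis by (simp add: cs_def)
qed

lemma w_rec: "real n * w n = (\<Sum>j=1..n. cs j * w (n - j))"
proof -
  have "real n * w n = (\<Sum>j=1..n. real j * \<kappa> j * a (n - j)) * \<rho> ^ n"
    unfolding w_def vertex_rec[symmetric] by simp
  also have "\<dots> = (\<Sum>j=1..n. cs j * w (n - j))"
    unfolding sum_distrib_right
  proof (rule sum.cong)
    fix j assume "j \<in> {1..n}"
    then have "\<rho> ^ n = \<rho> ^ j * \<rho> ^ (n - j)" by (simp flip: power_add)
    then show "real j * \<kappa> j * a (n - j) * \<rho> ^ n = cs j * w (n - j)" by (simp add: cs_def w_def)
  qed simp
  finally show ?thesis .
qed

text \<open>By the recurrence and \<open>s_sum_le\<close>, the mean of \<open>n\<close> under the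
  weights \<open>w n\<close> with \<open>n \<le> N\<close> is at most 2. As 3 exceeds this mean, the
  terms with \<open>n < 3\<close> must carry at least a third of the total weight, which bounds the
  total independently of \<open>N\<close>.\<close>

lemma summable_w: "summable w"
proof (rule bounded_imp_summable[OF w_nonneg])
  fix N
  let ?W = "\<Sum>n\<le>N. w n"
  have "(\<Sum>n\<le>N. real n * w n) = (\<Sum>n\<le>N. \<Sum>j=1..n. cs j * w (n - j))" by (simp add: w_rec)
  also have "\<dots> = (\<Sum>(n, j)\<in>(SIGMA n:{..N}. {1..n}). cs j * w (n - j))"
    by (rule sum.Sigma) auto
  also have "\<dots> = (\<Sum>(j, i)\<in>(\<lambda>(n, j). (j, n - j)) ` (SIGMA n:{..N}. {1..n}). cs j * w i)"
    by (subst sum.reindex) (auto simp: inj_on_def case_prod_beta)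
  also have "\<dots> \<le> (\<Sum>(j, i)\<in>{1..N} \<times> {..N}. cs j * w i)"
    by (rule sum_mono2) (auto simp: s_nonneg w_nonneg)
  also have "\<dots> = (\<Sum>j=1..N. cs j) * ?W"
    by (simp add: sum_product sum.cartesian_product)
  also have "\<dots> \<le> 2 * ?W"
    by (rule mult_right_mono[OF s_sum_le]) (simp add: sum_nonneg w_nonneg)
  finally have up: "(\<Sum>n\<le>N. real n * w n) \<le> 2 * ?W" .
  have "3 * ?W - (\<Sum>n\<le>N. real n * w n) = (\<Sum>n\<le>N. (3 - real n) * w n)"
    by (simp add: sum_distrib_left sum_subtractf left_diff_distrib)
  also have "\<dots> \<le> (\<Sum>n\<le>N. if n < 3 then 3 * w n else 0)"
    by (rule sum_mono) (auto simp: w_nonneg mult_right_mono mult_nonpos_nonneg)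
  also have "\<dots> = (\<Sum>n\<in>{n\<in>{..N}. n < 3}. 3 * w n)" by (rule sum.inter_filter[symmetric]) simp
  also have "\<dots> \<le> (\<Sum>n<3. 3 * w n)" by (rule sum_mono2) (auto simp: w_nonneg)
  finally show "?W \<le> (\<Sum>n<3. 3 * w n)" using up by linarith
qed

section \<open>The convolution inverse and the proportion of connected graphs\<close>

definition v :: "nat \<Rightarrow> real" where "v = fps_nth (inverse (Abs_fps w))"

lemma w_0: "w 0 = 1"
  by (simp add: w_def a_0)

lemma fps_v: "Abs_fps v * Abs_fps w = 1"
proof -
  have "Abs_fps v = inverse (Abs_fps w)" by (simp add: v_def fps_nth_inverse)
  then show ?thesis using inverse_mult_eq_1[of "Abs_fps w"] w_0 by simp
qed

text \<open>Differentiating \<open>V * W = 1\<close> and inserting \<open>x W' = S W\<close> gives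
  \<open>x V' = - S V\<close>. This is the recurrence of \<open>w\<close> up to the sign, which is
  why \<open>w\<close> dominates \<open>\<bar>v\<bar>\<close>.\<close>

lemma v_rec: "real n * v n = - (\<Sum>j=1..n. cs j * v (n - j))"
proof -
  let ?V = "Abs_fps v" and ?W = "Abs_fps w" and ?S = "Abs_fps cs"
  have s0: "cs 0 = 0" by (simp add: cs_def)
  have sum0: "(\<Sum>j=0..n. cs j * f (n - j)) = (\<Sum>j=1..n. cs j * f (n - j))" for n and f :: "nat \<Rightarrow> real"
    by (rule sum.mono_neutral_right) (auto simp: s0 not_less_eq_eq)
  have W: "fps_X * fps_deriv ?W = ?S * ?W"
  proof (rule fps_ext)
    fix n
    have "fps_nth (?S * ?W) n = real n * w n" by (simp only: fps_mult_nth fps_nth_Abs_fps sum0 w_rec)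
    moreover have "fps_nth (fps_X * fps_deriv ?W) n = real n * w n" by (cases n) (simp_all del: of_nat_Suc)
    ultimately show "fps_nth (fps_X * fps_deriv ?W) n = fps_nth (?S * ?W) n" by simp
  qed
  have "fps_deriv (?V * ?W) = 0" by (simp add: fps_v)
  then have "?V * fps_deriv ?W + fps_deriv ?V * ?W = 0" by simp
  \<comment> \<open>With the factor \<open>x V\<close>, every term contains \<open>x W'\<close> or
    \<open>V * W\<close>, and both can be replaced.\<close>
  then have "fps_X * ?V * (?V * fps_deriv ?W + fps_deriv ?V * ?W) = 0" by simp
  moreover have "fps_X * ?V * (?V * fps_deriv ?W + fps_deriv ?V * ?W) =
      ?V * ?V * (fps_X * fps_deriv ?W) + fps_X * fps_deriv ?V * (?V * ?W)" by (simp add: algebra_simps)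
  moreover have "?V * ?V * (?S * ?W) = ?S * ?V * (?V * ?W)" by (simp add: algebra_simps)
  ultimately have "?S * ?V + fps_X * fps_deriv ?V = 0" by (simp add: W fps_v)
  then have "fps_nth (?S * ?V + fps_X * fps_deriv ?V) n = 0" by simp
  moreover have "fps_nth (fps_X * fps_deriv ?V) n = real n * v n" by (cases n) (simp_all del: of_nat_Suc)
  moreover have "fps_nth (?S * ?V) n = (\<Sum>j=1..n. cs j * v (n - j))" by (simp only: fps_mult_nth fps_nth_Abs_fps sum0)
  ultimately show ?thesis by simp
qed

lemma abs_v_le: "\<bar>v n\<bar> \<le> w n"
proof (induction n rule: less_induct)
  case (less n)
  show ?case
  proof (cases "n = 0")
    case True
    have "v 0 * w 0 = 1" using arg_cong[OF fps_v, of "\<lambda>F. fps_nth F 0"] by simp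
    then show ?thesis using True w_0 by simp
  next
    case False
    have "real n * \<bar>v n\<bar> = \<bar>\<Sum>j=1..n. cs j * v (n - j)\<bar>"
      using v_rec[of n] by (metis abs_minus_cancel abs_mult abs_of_nat)
    also have "\<dots> \<le> (\<Sum>j=1..n. \<bar>cs j * v (n - j)\<bar>)" by (rule sum_abs)
    also have "\<dots> \<le> (\<Sum>j=1..n. cs j * w (n - j))"
      by (rule sum_mono) (auto simp: abs_mult s_nonneg intro!: mult_left_mono less)
    also have "\<dots> = real n * w n" by (rule w_rec[symmetric])
    finally show ?thesis using False by simp
  qed
qed

text \<open>If \<open>a n = 0\<close>, the value is \<open>0\<close>, so the bounds below hold for
  all \<open>n\<close>.\<close>

definition q :: "nat \<Rightarrow> real" where "q n = \<kappa> n / a n"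

lemma q_bounds: "0 \<le> q n" "q n \<le> 1"
  using nonneg[of n] \<kappa>_le[of n] by (simp_all add: q_def divide_le_eq)

text \<open>The quotient \<open>h (n - i) / a (n - i)\<close> need not converge. Being bounded by
  \<open>1\<close>, it still allows \<open>a (n - i) / a n\<close> to be replaced by its
  limit.\<close>

lemma weighted_split:
  assumes "\<And>i. 0 \<le> g i" "\<And>n. 0 \<le> h n" "\<And>n. h n \<le> a n"
  shows "(\<lambda>n. (\<Sum>i\<le>t. g i * h (n - i) / a n) - (\<Sum>i\<le>t. g i * \<rho> ^ i * (h (n - i) / a (n - i)))) \<longlonglongrightarrow> 0"
proof -
  have "(\<lambda>n. g i * h (n - i) / a n - g i * \<rho> ^ i * (h (n - i) / a (n - i))) \<longlonglongrightarrow> 0" for i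
  proof (rule Lim_null_comparison)
    have "\<forall>\<^sub>F n in sequentially. 0 < a (n + i - i)" using pos by simp
    then have "\<forall>\<^sub>F n in sequentially. 0 < a (n - i)" by (rule eventually_sequentially_seg[THEN iffD1])
    then show "\<forall>\<^sub>F n in sequentially. norm (g i * h (n - i) / a n - g i * \<rho> ^ i * (h (n - i) / a (n - i))) \<le>
        g i * \<bar>a (n - i) / a n - \<rho> ^ i\<bar>"
    proof eventually_elim
      case (elim n)
      have "g i * h (n - i) / a n - g i * \<rho> ^ i * (h (n - i) / a (n - i)) =
          g i * (h (n - i) / a (n - i)) * (a (n - i) / a n - \<rho> ^ i)"
        using elim by (simp add: field_simps)
      also have "norm \<dots> = g i * (h (n - i) / a (n - i)) * \<bar>a (n - i) / a n - \<rho> ^ i\<bar>"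
        using assms(1,2) nonneg by (simp add: abs_mult)
      also have "\<dots> \<le> g i * 1 * \<bar>a (n - i) / a n - \<rho> ^ i\<bar>"
        using assms elim by (intro mult_right_mono mult_left_mono) (simp_all add: divide_le_eq)
      finally show ?case by simp
    qed
    have "(\<lambda>n. g i * \<bar>a (n - i) / a n - \<rho> ^ i\<bar>) \<longlonglongrightarrow> g i * \<bar>\<rho> ^ i - \<rho> ^ i\<bar>"
      by (intro tendsto_intros ratio_down)
    then show "(\<lambda>n. g i * \<bar>a (n - i) / a n - \<rho> ^ i\<bar>) \<longlonglongrightarrow> 0" by simp
  qed
  then have "(\<lambda>n. \<Sum>i\<le>t. g i * h (n - i) / a n - g i * \<rho> ^ i * (h (n - i) / a (n - i))) \<longlonglongrightarrow> (\<Sum>i\<le>t. 0)"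
    by (intro tendsto_sum)
  then show ?thesis by (simp add: sum_subtractf)
qed

lemma tail_w: "(\<lambda>t. suminf w - (\<Sum>i\<le>t. w i)) \<longlonglongrightarrow> 0"
proof -
  have "(\<lambda>t. suminf w - (\<Sum>i\<le>t. w i)) \<longlonglongrightarrow> suminf w - suminf w"
    by (intro tendsto_intros summable_LIMSEQ'[OF summable_w])
  then show ?thesis by simp
qed

lemma two_over: "(\<lambda>t. 2 / real t) \<longlonglongrightarrow> 0"
  by real_asymp

text \<open>Up to the ratio limits, the terms with \<open>i \<le> t\<close> give the probability
  that a large component misses at most \<open>t\<close> vertices, which is \<open>1\<close> up to
  \<open>2 / t\<close> by \<open>tight\<close>. The remaining terms are bounded by the tail of
  \<open>w\<close>.\<close>

lemma convolution_limit: "(\<lambda>n. \<Sum>i\<le>n. w i * q (n - i)) \<longlonglongrightarrow> 1"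
proof (rule limit_by_approximation)
  define z :: "nat \<Rightarrow> nat \<Rightarrow> real" where "z = (\<lambda>t n. 1)"
  \<comment> \<open>The cut-off is \<open>Suc t\<close>, since \<open>tight\<close> asks for a
    positive one.\<close>
  define e where "e = (\<lambda>t n. \<bar>(\<Sum>i\<le>Suc t. a i * \<kappa> (n - i) / a n) - (\<Sum>i\<le>Suc t. a i * \<rho> ^ i * (\<kappa> (n - i) / a (n - i)))\<bar>)"
  define \<delta> where "\<delta> = (\<lambda>t. (suminf w - (\<Sum>i\<le>Suc t. w i)) + 2 / real (Suc t))"
  show "e t \<longlonglongrightarrow> 0" for t
    unfolding e_def using weighted_split[of a \<kappa> "Suc t"] nonneg \<kappa>_le by (intro tendsto_rabs_zero) simp
  show "z t \<longlonglongrightarrow> 1" for t by (simp add: z_def)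
  show "\<delta> \<longlonglongrightarrow> 0"
    unfolding \<delta>_def using tendsto_add[OF LIMSEQ_Suc[OF tail_w] LIMSEQ_Suc[OF two_over]] by simp
  show "(\<lambda>_::nat. 1) \<longlonglongrightarrow> (1::real)" by simp
  show "\<forall>\<^sub>F n in sequentially. \<bar>(\<Sum>i\<le>n. w i * q (n - i)) - z t n\<bar> \<le> \<delta> t + e t n" for t
    using pos eventually_gt_at_top[of "2 * Suc t"]
  proof eventually_elim
    case (elim n)
    have "(\<Sum>i\<le>n. w i * q (n - i)) = (\<Sum>i\<le>Suc t. w i * q (n - i)) + (\<Sum>i\<in>{Suc t<..n}. w i * q (n - i))"
      by (subst sum.union_disjoint[symmetric]) (use elim in \<open>auto intro!: sum.cong\<close>)
    moreover have "0 \<le> (\<Sum>i\<in>{Suc t<..n}. w i * q (n - i))"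
      by (simp add: sum_nonneg w_nonneg q_bounds)
    moreover have "(\<Sum>i\<in>{Suc t<..n}. w i * q (n - i)) \<le> suminf w - (\<Sum>i\<le>Suc t. w i)"
    proof -
      have "(\<Sum>i\<in>{Suc t<..n}. w i * q (n - i)) \<le> (\<Sum>i\<in>{Suc t<..n}. w i)"
        by (rule sum_mono) (simp add: mult_left_le w_nonneg q_bounds)
      moreover have "(\<Sum>i\<le>Suc t. w i) + (\<Sum>i\<in>{Suc t<..n}. w i) = (\<Sum>i\<le>n. w i)"
        by (subst sum.union_disjoint[symmetric]) (use elim in \<open>auto intro!: sum.cong\<close>)
      moreover have "(\<Sum>i\<le>n. w i) \<le> suminf w"
        by (rule sum_le_suminf[OF summable_w]) (simp_all add: w_nonneg)
      ultimately show ?thesis by linarith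
    qed
    moreover have "(\<Sum>i\<le>Suc t. w i * q (n - i)) = (\<Sum>i\<le>Suc t. a i * \<rho> ^ i * (\<kappa> (n - i) / a (n - i)))"
      by (simp add: w_def q_def)
    moreover have "\<bar>1 - (\<Sum>i\<le>Suc t. a i * \<kappa> (n - i) / a n)\<bar> \<le> 2 / real (Suc t)"
    proof -
      have "\<bar>a n - (\<Sum>i\<le>Suc t. a i * \<kappa> (n - i))\<bar> / a n \<le> 2 / real (Suc t)"
        using tight[of "Suc t" n] elim by (simp add: divide_le_eq)
      moreover have "1 - (\<Sum>i\<le>Suc t. a i * \<kappa> (n - i) / a n) = (a n - (\<Sum>i\<le>Suc t. a i * \<kappa> (n - i))) / a n"
        unfolding sum_divide_distrib[symmetric] diff_divide_distrib using elim by simp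
      ultimately have "\<bar>1 - (\<Sum>i\<le>Suc t. a i * \<kappa> (n - i) / a n)\<bar> \<le> 2 / real (Suc t)"
        using elim by (simp only: abs_divide abs_of_pos)
      then show ?thesis .
    qed
    ultimately show ?case unfolding z_def \<delta>_def e_def by linarith
  qed
qed

text \<open>Convolving \<open>u = w * q\<close> with \<open>v\<close> recovers \<open>q\<close>, and
  \<open>u\<close> tends to \<open>1\<close>. The limit is the value of \<open>1 / A\<close> at
  \<rho>.\<close>

lemma q_limit: "q \<longlonglongrightarrow> suminf v"
proof -
  define u where "u n = (\<Sum>i\<le>n. w i * q (n - i))" for n
  have "Abs_fps w * Abs_fps q = Abs_fps u"
    by (rule fps_ext) (simp add: fps_mult_nth u_def atLeast0AtMost)
  then have qvu: "Abs_fps q = Abs_fps v * Abs_fps u"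
    using fps_v by (metis mult.assoc mult_1)
  have "q n = (\<Sum>k\<le>n. v k * u (n - k))" for n
  proof -
    have "q n = fps_nth (Abs_fps q) n" by simp
    also have "\<dots> = fps_nth (Abs_fps v * Abs_fps u) n" by (simp only: qvu)
    also have "\<dots> = (\<Sum>k\<le>n. v k * u (n - k))" by (simp only: fps_mult_nth fps_nth_Abs_fps atLeast0AtMost)
    finally show ?thesis .
  qed
  moreover have "(\<lambda>n. \<Sum>k\<le>n. v k * u (n - k)) \<longlonglongrightarrow> suminf v * 1"
  proof (rule tendsto_convolution)
    show "summable (\<lambda>k. \<bar>v k\<bar>)"
      by (rule summable_comparison_test[OF _ summable_w]) (simp add: abs_v_le)
    show "u \<longlonglongrightarrow> 1" unfolding u_def by (rule convolution_limit)
  qed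
  ultimately have "(\<lambda>n. q n) \<longlonglongrightarrow> suminf v" by simp
  then show ?thesis .
qed

text \<open>In the application \<open>x\<close> counts the graphs that satisfy the sentence,
  \<open>g\<close> the fragments with which a large component of the common type satisfies it, and
  \<open>b\<close> the connected graphs whose type is not known; all three are divided by
  factorials.\<close>

lemma convergent_weighted:
  assumes g: "\<And>i. 0 \<le> g i" "\<And>i. g i \<le> a i" and b: "\<And>n. 0 \<le> b n" "\<And>n. b n \<le> a n" "(\<lambda>n. b n / a n) \<longlonglongrightarrow> 0"
    and x: "\<And>t n. 2 * t < n \<Longrightarrow> 0 < t \<Longrightarrow>
      \<bar>x n - (\<Sum>i\<le>t. g i * \<kappa> (n - i))\<bar> \<le> 2 / real t * a n + (\<Sum>i\<le>t. a i * b (n - i))"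
  shows "convergent (\<lambda>n. x n / a n)"
proof -
  define z where "z = (\<lambda>t n. (\<Sum>i\<le>Suc t. g i * \<kappa> (n - i) / a n))"
  define e where "e = (\<lambda>t n. (\<Sum>i\<le>Suc t. a i * b (n - i) / a n))"
  define Y where "Y = (\<lambda>t. (\<Sum>i\<le>Suc t. g i * \<rho> ^ i * suminf v))"
  have shift: "(\<lambda>n. f (n - i)) \<longlonglongrightarrow> l" if "f \<longlonglongrightarrow> l" for f :: "nat \<Rightarrow> real" and l i
    by (rule LIMSEQ_offset[of _ i]) (simp add: that)
  have "(\<lambda>n. x n / a n) \<longlonglongrightarrow> (\<Sum>i. g i * \<rho> ^ i * suminf v)"
  proof (rule limit_by_approximation)
    show "z t \<longlonglongrightarrow> Y t" for t
    proof -
      have "(\<lambda>n. \<Sum>i\<le>Suc t. g i * \<rho> ^ i * (\<kappa> (n - i) / a (n - i))) \<longlonglongrightarrow> Y t"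
        unfolding Y_def by (intro tendsto_sum tendsto_mult tendsto_const shift[OF q_limit[unfolded q_def]])
      from tendsto_add[OF weighted_split[of g \<kappa> "Suc t"] this] show ?thesis
        using g(1) nonneg \<kappa>_le by (simp add: z_def del: sum.atMost_Suc)
    qed
    show "e t \<longlonglongrightarrow> 0" for t
    proof -
      have "(\<lambda>n. \<Sum>i\<le>Suc t. a i * \<rho> ^ i * (b (n - i) / a (n - i))) \<longlonglongrightarrow> (\<Sum>i\<le>Suc t. a i * \<rho> ^ i * 0)"
        by (intro tendsto_sum tendsto_mult tendsto_const shift[OF b(3)])
      from tendsto_add[OF weighted_split[of a b "Suc t"] this] show ?thesis
        using nonneg b(1,2) by (simp add: e_def del: sum.atMost_Suc)
    qed
    show "(\<lambda>t. 2 / real (Suc t)) \<longlonglongrightarrow> 0" by (rule LIMSEQ_Suc[OF two_over])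
    have "summable (\<lambda>i. g i * \<rho> ^ i)"
    proof (rule summable_comparison_test[OF _ summable_w], intro exI[of _ 0] allI impI)
      show "norm (g i * \<rho> ^ i) \<le> w i" for i
        using g \<rho>_pos by (simp add: w_def mult_right_mono)
    qed
    then have "summable (\<lambda>i. g i * \<rho> ^ i * suminf v)" by (rule summable_mult2)
    from LIMSEQ_Suc[OF summable_LIMSEQ'[OF this]] show "Y \<longlonglongrightarrow> (\<Sum>i. g i * \<rho> ^ i * suminf v)"
      by (simp only: Y_def)
    show "\<forall>\<^sub>F n in sequentially. \<bar>x n / a n - z t n\<bar> \<le> 2 / real (Suc t) + e t n" for t
      using pos eventually_gt_at_top[of "2 * Suc t"]
    proof eventually_elim
      case (elim n)
      have "\<bar>x n / a n - z t n\<bar> = \<bar>x n - (\<Sum>i\<le>Suc t. g i * \<kappa> (n - i))\<bar> / a n"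
        unfolding z_def sum_divide_distrib[symmetric] diff_divide_distrib[symmetric] abs_divide using elim by simp
      also have "\<dots> \<le> (2 / real (Suc t) * a n + (\<Sum>i\<le>Suc t. a i * b (n - i))) / a n"
        using x[of "Suc t" n] elim by (intro divide_right_mono) simp_all
      also have "\<dots> = 2 / real (Suc t) + e t n"
        unfolding e_def sum_divide_distrib[symmetric] add_divide_distrib using elim by simp
      finally show ?case .
    qed
  qed
  then show ?thesis by (auto simp: convergent_def)
qed

end

section \<open>The limit law\<close>

text \<open>Truth as a property of types, so that it can be evaluated on the sum of the type of the
  large component and that of the fragment.\<close>

definition sat_type :: "nat \<Rightarrow> mso \<Rightarrow> nat \<Rightarrow> bool" where
  "sat_type k \<phi> \<tau> \<longleftrightarrow> (\<exists>V E. ugraph V E \<and> rtp k V E {} = \<tau> \<and> satisfies \<lparr>pverts = V, parcs = E\<rparr> \<phi>)"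

lemma satisfies_iff_sat_type:
  assumes "sentence \<phi>" "ugraph V E"
  shows "satisfies \<lparr>pverts = V, parcs = E\<rparr> \<phi> \<longleftrightarrow> sat_type (qr \<phi>) \<phi> (rtp (qr \<phi>) V E {})"
proof
  assume "sat_type (qr \<phi>) \<phi> (rtp (qr \<phi>) V E {})"
  then obtain V' E' where V': "ugraph V' E'" "rtp (qr \<phi>) V' E' {} = rtp (qr \<phi>) V E {}"
      "satisfies \<lparr>pverts = V', parcs = E'\<rparr> \<phi>"
    unfolding sat_type_def by (elim exE conjE)
  have "coded \<phi> 1 (\<lambda>_. {}) e s ix jx" for e s ix jx
    using assms(1) by (simp add: coded_def sentence_def)
  from sat_tp_eq[OF ugraphD(1)[OF V'(1)] ugraphD(1)[OF assms(2)] V'(2)[unfolded rtp_def] order_refl this this]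
  show "satisfies \<lparr>pverts = V, parcs = E\<rparr> \<phi>"
    using V'(3) satisfies_sentence[OF assms(1)] by blast
qed (use assms in \<open>auto simp: sat_type_def\<close>)

lemma (in addable_class) card_no_big_component_real:
  assumes "0 < n" "0 < t"
  shows "real (card {E. P {1..n} E \<and> (\<forall>x\<in>{1..n}. card (component_of E x) + t < n)}) \<le> 2 / real t * real (c n)"
proof -
  have "real (t * n * card {E. P {1..n} E \<and> (\<forall>x\<in>{1..n}. card (component_of E x) + t < n)}) \<le> real (2 * n * c n)"
    using card_no_big_component[of t n] by (simp only: of_nat_le_iff)
  then show ?thesis using assms by (simp add: field_simps)
qed

lemma choose_over_fact:
  assumes "j \<le> n"
  shows "real (n choose j) * x / fact n = x / (fact j * fact (n - j))"
  using binomial_fact[OF assms, where 'a = real] by (simp add: field_simps)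

locale smooth_addable_class = addable_class +
  fixes L :: real
  assumes c_pos: "\<forall>\<^sub>F n in sequentially. 0 < c n"
    and c_ratio: "(\<lambda>n. real (c (Suc n)) / (real (Suc n) * real (c n))) \<longlonglongrightarrow> L"
begin

definition a :: "nat \<Rightarrow> real" where "a n = real (c n) / fact n"

definition \<kappa> :: "nat \<Rightarrow> real" where "\<kappa> n = real (kc n) / fact n"

lemma ex_connected: "\<exists>V E. P V E \<and> conn V E"
proof -
  have "\<forall>\<^sub>F n in sequentially. 0 < c n \<and> 0 < n"
    using c_pos eventually_gt_at_top[of 0] by eventually_elim simp
  from eventually_happens'[OF sequentially_bot this] obtain n where n: "0 < c n" "0 < n" by (elim exE conjE)
  have "{E. P {1..n} E} \<noteq> {}" using n(1) unfolding c_def cnt_def by (metis card.empty less_irrefl)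
  then obtain E where E: "P {1..n} E" by blast
  have "1 \<in> {1..n}" using n(2) by simp
  from P_comp[OF E this] conn_comp[OF ugraphD(3)[OF P_ugraph[OF E]], of 1] show ?thesis by blast
qed

text \<open>The case of \<open>card_by_big_component\<close> with \<Phi> and \<Psi> true and
  \<open>B\<close> false: the only error left comes from the graphs without a large
  component.\<close>

lemma tight_sum:
  assumes "2 * t < n" "0 < t"
  shows "\<bar>a n - (\<Sum>i\<le>t. a i * \<kappa> (n - i))\<bar> \<le> 2 / real t * a n"
proof -
  have inv: "invariant (\<lambda>V E. P V E \<and> True)" "invariant (\<lambda>V E. P V E \<and> conn V E \<and> False)"
    using invariant_P by (simp_all add: invariant_def)
  have cT: "cnt (\<lambda>V E. P V E \<and> True) i = c i" "cnt (\<lambda>V E. P V E \<and> conn V E \<and> False) i = 0" for i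
    by (simp_all add: cnt_def c_def)
  have eqc: "card {E. P {1..n} E \<and> True} = c n" by (simp add: cnt_def c_def)
  have "\<bar>real (c n) - (\<Sum>i\<le>t. (n choose i) * (real (kc (n - i)) * c i))\<bar> \<le>
      real (card {E. P {1..n} E \<and> (\<forall>x\<in>{1..n}. card (component_of E x) + t < n)})"
    using card_by_big_component[OF assms(1) inv, of "\<lambda>_. True", unfolded cT eqc] by simp
  also have "\<dots> \<le> 2 / real t * real (c n)"
    by (rule card_no_big_component_real) (use assms in auto)
  finally have "\<bar>real (c n) - (\<Sum>i\<le>t. (n choose i) * (real (kc (n - i)) * c i))\<bar> / fact n \<le> 2 / real t * real (c n) / fact n"
    by (rule divide_right_mono) simp
  moreover have "a n - (\<Sum>i\<le>t. a i * \<kappa> (n - i)) =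
      (real (c n) - (\<Sum>i\<le>t. (n choose i) * (real (kc (n - i)) * c i))) / fact n"
  proof -
    have "(\<Sum>i\<le>t. a i * \<kappa> (n - i)) = (\<Sum>i\<le>t. (n choose i) * (real (kc (n - i)) * c i) / fact n)"
      using assms by (intro sum.cong refl) (simp add: choose_over_fact a_def \<kappa>_def)
    then show ?thesis by (simp add: a_def diff_divide_distrib sum_divide_distrib)
  qed
  ultimately show ?thesis by (simp add: a_def abs_divide)
qed

sublocale smooth_counts a \<kappa> L
proof
  show "0 \<le> a n" "0 \<le> \<kappa> n" for n by (simp_all add: a_def \<kappa>_def)
  show "a 0 = 1" by (simp add: a_def c_0)
  show "\<kappa> n \<le> a n" for n using kc_le by (simp add: a_def \<kappa>_def divide_right_mono)
  show "\<forall>\<^sub>F n in sequentially. 0 < a n" using c_pos by eventually_elim (simp add: a_def)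
  have "real (c (Suc n)) / (real (Suc n) * real (c n)) = a (Suc n) / a n" for n
    by (simp add: a_def fact_Suc del: of_nat_Suc)
  then show "(\<lambda>n. a (Suc n) / a n) \<longlonglongrightarrow> L" using c_ratio by simp
  show "\<exists>m>0. 0 < \<kappa> m"
  proof -
    obtain V E where VE: "P V E" "conn V E" using ex_connected by blast
    note fin = ugraphD(1)[OF P_ugraph[OF VE(1)]]
    have "finite {E. P V E \<and> conn V E}" by (rule finite_subset[OF _ finite_P[OF fin]]) auto
    then have "0 < kc (card V)" unfolding card_conn[OF fin, symmetric] using VE by (auto simp: card_gt_0_iff)
    moreover have "0 < card V" using VE(2) fin by (auto simp: conn_def card_gt_0_iff)
    ultimately show ?thesis by (intro exI[of _ "card V"]) (simp add: \<kappa>_def)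
  qed
  have summand: "real j * \<kappa> j * a (n - j) = real ((n choose j) * (j * kc j * c (n - j))) / fact n"
    if "j \<le> n" for j n
    using choose_over_fact[OF that, of "real (j * kc j * c (n - j))"] by (simp add: a_def \<kappa>_def)
  show "real n * a n = (\<Sum>j=1..n. real j * \<kappa> j * a (n - j))" for n
  proof -
    have "real n * a n = real (n * c n) / fact n" by (simp add: a_def)
    also have "\<dots> = (\<Sum>j=1..n. real ((n choose j) * (j * kc j * c (n - j))) / fact n)"
      unfolding vertex_recurrence by (simp add: sum_divide_distrib)
    also have "\<dots> = (\<Sum>j=1..n. real j * \<kappa> j * a (n - j))"
      by (intro sum.cong refl summand[symmetric]) simp
    finally show ?thesis .
  qed
  show "real (n - t) * (\<Sum>j=1..t. real j * \<kappa> j * a (n - j)) \<le> 2 * real n * a n" if "t \<le> n" for t n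
  proof -
    have "real (n - t) * (\<Sum>j=1..t. real j * \<kappa> j * a (n - j)) =
        real (n - t) * (\<Sum>j=1..t. real ((n choose j) * (j * kc j * c (n - j))) / fact n)"
      by (intro arg_cong2[where f = times] refl sum.cong summand) (use that in simp)
    also have "\<dots> = real ((n - t) * (\<Sum>j=1..t. (n choose j) * (j * kc j * c (n - j)))) / fact n"
      by (simp add: sum_divide_distrib sum_distrib_left)
    also have "\<dots> \<le> real (2 * n * c n) / fact n"
      using small_components[OF that] by (intro divide_right_mono) (simp_all only: of_nat_le_iff fact_ge_zero)
    also have "\<dots> = 2 * real n * a n" by (simp add: a_def)
    finally show ?thesis .
  qed
qed (rule tight_sum)

text \<open>There are \<open>n\<close> places of attachment but boundedly many origins of each
  result, so \<open>pendant_free_count\<close> leaves a factor \<open>1 / n\<close>. Smoothness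
  keeps the growth from order \<open>n\<close> to \<open>n + card VH\<close> bounded after division
  by the factorials.\<close>

lemma pendant_free_limit:
  assumes "P VH EH" "conn VH EH" "s \<in> VH"
  shows "(\<lambda>n. real (cnt (\<lambda>V E. P V E \<and> conn V E \<and> \<not> pendant VH EH s V E) n) / fact n / a n) \<longlonglongrightarrow> 0"
proof (rule Lim_null_comparison)
  let ?m = "card VH"
  let ?N = "cnt (\<lambda>V E. P V E \<and> \<not> pendant VH EH s V E)"
  let ?B = "cnt (\<lambda>V E. P V E \<and> conn V E \<and> \<not> pendant VH EH s V E)"
  show "\<forall>\<^sub>F n in sequentially. norm (real (?B n) / fact n / a n) \<le> 2 ^ Suc ?m * fact ?m * (a (n + ?m) / a n) * (1 / real n)"
    using pos eventually_gt_at_top[of 0]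
  proof eventually_elim
    case (elim n)
    have "?B n \<le> ?N n"
      unfolding cnt_def by (rule card_mono[OF finite_invariant[OF invariant_no_pendant]]) auto
    then have "real (?B n) / fact n \<le> real (?N n) / fact n" by (simp add: divide_right_mono)
    have "real (((n + ?m) choose ?m) * n * ?N n) / fact (n + ?m) \<le> real (2 ^ Suc ?m * c (n + ?m)) / fact (n + ?m)"
      using pendant_free_count[OF assms, of n] by (intro divide_right_mono) (simp_all only: of_nat_le_iff fact_ge_zero)
    moreover have "real (((n + ?m) choose ?m) * n * ?N n) / fact (n + ?m) = real n * real (?N n) / (fact ?m * fact n)"
      using choose_over_fact[of ?m "n + ?m" "real n * real (?N n)"] by (simp add: mult.assoc)
    ultimately have "real n * real (?N n) / (fact ?m * fact n) \<le> 2 ^ Suc ?m * a (n + ?m)"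
      by (simp add: a_def)
    then have "real (?N n) / fact n \<le> 2 ^ Suc ?m * fact ?m * a (n + ?m) * (1 / real n)"
      using elim(2) by (simp add: field_simps)
    with \<open>real (?B n) / fact n \<le> real (?N n) / fact n\<close>
    have "real (?B n) / fact n \<le> 2 ^ Suc ?m * fact ?m * a (n + ?m) * (1 / real n)" by (rule order_trans)
    then have "real (?B n) / fact n / a n \<le> 2 ^ Suc ?m * fact ?m * a (n + ?m) * (1 / real n) / a n"
      using elim(1) by (intro divide_right_mono) simp_all
    then show ?case using elim(1) by (simp add: mult.commute mult.left_commute)
  qed
  have "(\<lambda>n. 2 ^ Suc ?m * fact ?m * (a (n + ?m) / a n) * (1 / real n)) \<longlonglongrightarrow> 2 ^ Suc ?m * fact ?m * L ^ ?m * 0"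
    by (intro tendsto_mult tendsto_const ratio_shift lim_1_over_n)
  then show "(\<lambda>n. 2 ^ Suc ?m * fact ?m * (a (n + ?m) / a n) * (1 / real n)) \<longlonglongrightarrow> 0" by simp
qed

lemma convergent_satisfying:
  assumes "sentence \<phi>"
  shows "convergent (\<lambda>n. real (card {E. P {1..n} E \<and> satisfies \<lparr>pverts = {1..n}, parcs = E\<rparr> \<phi>}) / real (c n))"
proof -
  define k where "k = qr \<phi>"
  obtain VK EK where "P VK EK" "conn VK EK" using ex_connected by blast
  then obtain VH EH s where H: "P VH EH" "conn VH EH" "s \<in> VH"
    and univ: "\<And>V E. P V E \<Longrightarrow> conn V E \<Longrightarrow> pendant VH EH s V E \<Longrightarrow> rtp k V E {} = rtp k VH EH {}"
    by (rule ex_universal_pendant[where k = k]) blast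
  \<comment> \<open>\<Phi> judges a fragment as if the large component had the type of
    \<open>H\<close>; \<open>B\<close> marks the large components for which this is not
    known.\<close>
  define \<Phi> where "\<Phi> V E = sat_type k \<phi> (tadd k (rtp k VH EH {}) (rtp k V E {}))" for V E
  define B where "B V E = (\<not> pendant VH EH s V E)" for V E
  define X where "X n = {E. P {1..n} E \<and> satisfies \<lparr>pverts = {1..n}, parcs = E\<rparr> \<phi>}" for n
  define x where "x n = real (card (X n)) / fact n" for n
  define g where "g i = real (cnt (\<lambda>V E. P V E \<and> \<Phi> V E) i) / fact i" for i
  define b where "b i = real (cnt (\<lambda>V E. P V E \<and> conn V E \<and> B V E) i) / fact i" for i
  have inv1: "invariant (\<lambda>V E. P V E \<and> \<Phi> V E)"
    unfolding invariant_def
  proof (intro conjI allI impI; elim conjE)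
    fix V E and f :: "nat \<Rightarrow> nat" assume *: "P V E" "\<Phi> V E" "inj_on f V"
    show "\<Phi> (f ` V) (map_prod f f ` E)"
      using *(2) rtp_iso[OF *(3) P_ugraph[OF *(1)] empty_subsetI] by (simp add: \<Phi>_def)
  qed (erule P_ugraph, erule P_iso)
  have inv2: "invariant (\<lambda>V E. P V E \<and> conn V E \<and> B V E)"
    using invariant_conn invariant_no_pendant[of VH EH s] unfolding invariant_def B_def by simp
  have key: "\<bar>real (card (X n)) - (\<Sum>i\<le>t. (n choose i) * (real (kc (n - i)) * cnt (\<lambda>V E. P V E \<and> \<Phi> V E) i))\<bar> \<le>
      card {E. P {1..n} E \<and> (\<forall>x\<in>{1..n}. card (component_of E x) + t < n)} +
      (\<Sum>i\<le>t. (n choose i) * (real (cnt (\<lambda>V E. P V E \<and> conn V E \<and> B V E) (n - i)) * c i))"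
    if t: "2 * t < n" for t n
    unfolding X_def
  proof (rule card_by_big_component[OF t inv1 inv2])
    fix S E assume E: "P {1..n} E" "S \<subseteq> {1..n}" "has_comp E S" "\<not> B S (induced E S)"
    note g = P_ugraph[OF E(1)]
    note parts = P_has_comp[OF E(1-3)]
    have "rtp k (S \<union> ({1..n} - S)) (induced E S \<union> induced E ({1..n} - S)) ({} \<union> {}) =
        tadd k (rtp k S (induced E S) {}) (rtp k ({1..n} - S) (induced E ({1..n} - S)) {})"
      by (rule rtp_Un[OF P_ugraph[OF parts(1)] P_ugraph[OF parts(3)]]) auto
    moreover have "S \<union> ({1..n} - S) = {1..n}" using E(2) by blast
    moreover have "induced E S \<union> induced E ({1..n} - S) = E" using has_comp_split[OF g E(3)] ..
    moreover have "rtp k S (induced E S) {} = rtp k VH EH {}"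
      using univ[OF parts(1,2)] E(4) by (simp add: B_def)
    ultimately have "rtp k {1..n} E {} = tadd k (rtp k VH EH {}) (rtp k ({1..n} - S) (induced E ({1..n} - S)) {})"
      by simp
    then show "satisfies \<lparr>pverts = {1..n}, parcs = E\<rparr> \<phi> \<longleftrightarrow> \<Phi> ({1..n} - S) (induced E ({1..n} - S))"
      unfolding satisfies_iff_sat_type[OF assms g] \<Phi>_def k_def by simp
  qed
  have "convergent (\<lambda>n. x n / a n)"
  proof (rule convergent_weighted)
    show "0 \<le> g i" "0 \<le> b i" for i by (simp_all add: g_def b_def)
    have "cnt (\<lambda>V E. P V E \<and> \<Phi> V E) i \<le> c i" "cnt (\<lambda>V E. P V E \<and> conn V E \<and> B V E) i \<le> c i" for i
      unfolding cnt_def c_def by (rule card_mono[OF finite_P]; auto)+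
    then show "g i \<le> a i" "b i \<le> a i" for i by (simp_all add: g_def b_def a_def divide_right_mono)
    show "(\<lambda>n. b n / a n) \<longlonglongrightarrow> 0" unfolding b_def B_def by (rule pendant_free_limit[OF H])
    fix t n :: nat assume t: "2 * t < n" "0 < t"
    have s1: "(\<Sum>i\<le>t. (n choose i) * (real (kc (n - i)) * cnt (\<lambda>V E. P V E \<and> \<Phi> V E) i)) / fact n = (\<Sum>i\<le>t. g i * \<kappa> (n - i))"
      unfolding sum_divide_distrib
      using t by (intro sum.cong refl) (simp add: choose_over_fact g_def \<kappa>_def)
    have s2: "(\<Sum>i\<le>t. (n choose i) * (real (cnt (\<lambda>V E. P V E \<and> conn V E \<and> B V E) (n - i)) * c i)) / fact n =
        (\<Sum>i\<le>t. a i * b (n - i))"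
      unfolding sum_divide_distrib
      using t by (intro sum.cong refl) (simp add: choose_over_fact b_def a_def)
    have "\<bar>real (card (X n)) - (\<Sum>i\<le>t. (n choose i) * (real (kc (n - i)) * cnt (\<lambda>V E. P V E \<and> \<Phi> V E) i))\<bar> \<le>
      2 / real t * real (c n) + (\<Sum>i\<le>t. (n choose i) * (real (cnt (\<lambda>V E. P V E \<and> conn V E \<and> B V E) (n - i)) * c i))"
      using key[OF t(1)] card_no_big_component_real[of n t] t by linarith
    then have "\<bar>real (card (X n)) - (\<Sum>i\<le>t. (n choose i) * (real (kc (n - i)) * cnt (\<lambda>V E. P V E \<and> \<Phi> V E) i))\<bar> / fact n \<le>
      (2 / real t * real (c n) + (\<Sum>i\<le>t. (n choose i) * (real (cnt (\<lambda>V E. P V E \<and> conn V E \<and> B V E) (n - i)) * c i))) / fact n"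
      by (rule divide_right_mono) simp
    also have "\<dots> = 2 / real t * a n + (\<Sum>i\<le>t. a i * b (n - i))"
      unfolding add_divide_distrib s2 by (simp add: a_def)
    finally have "\<bar>(real (card (X n)) - (\<Sum>i\<le>t. (n choose i) * (real (kc (n - i)) * cnt (\<lambda>V E. P V E \<and> \<Phi> V E) i))) / fact n\<bar> \<le>
       2 / real t * a n + (\<Sum>i\<le>t. a i * b (n - i))"
      by (simp add: abs_divide)
    then show "\<bar>x n - (\<Sum>i\<le>t. g i * \<kappa> (n - i))\<bar> \<le> 2 / real t * a n + (\<Sum>i\<le>t. a i * b (n - i))"
      unfolding diff_divide_distrib s1 x_def .
  qed
  moreover have "x n / a n = real (card (X n)) / real (c n)" for n by (simp add: x_def a_def)
  ultimately show ?thesis by (simp add: X_def)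
qed

end

section \<open>Translation from records of the graph library to pairs of sets\<close>

lemma pair_graph_iff: "pair_graph \<lparr>pverts = V, parcs = E\<rparr> \<longleftrightarrow> ugraph V E"
proof
  assume "pair_graph \<lparr>pverts = V, parcs = E\<rparr>"
  then interpret pair_graph "\<lparr>pverts = V, parcs = E\<rparr>" .
  show "ugraph V E"
    unfolding ugraph_def
  proof (intro conjI)
    show "irrefl E" unfolding irrefl_def using pair_no_loops[of "(a, a)" for a] by auto
  qed (use pair_finite_verts pair_sym_arcs in_arcsD1 in_arcsD2 in \<open>auto simp: symmetric_def\<close>)
next
  assume "ugraph V E"
  note g = ugraphD[OF this]
  show "pair_graph \<lparr>pverts = V, parcs = E\<rparr>"
    by unfold_locales (use g in \<open>auto simp: symmetric_def irrefl_def\<close>)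
qed

lemma reachable_iff:
  assumes "ugraph V E" "u \<in> V"
  shows "reachable (with_proj \<lparr>pverts = V, parcs = E\<rparr>) u v \<longleftrightarrow> v \<in> component_of E u"
proof -
  interpret pair_graph "\<lparr>pverts = V, parcs = E\<rparr>" using assms(1) by (simp add: pair_graph_iff)
  show ?thesis using reachable_conv'[of u v] assms(2) by (simp add: in_comp_iff)
qed

text \<open>By symmetry reachability is mutual, so the maximal strongly connected vertex sets are
  the classes of \<open>component_of\<close>.\<close>

lemma components_eq:
  assumes "ugraph V E"
  shows "components \<lparr>pverts = V, parcs = E\<rparr> =
    (\<lambda>x. \<lparr>pverts = component_of E x, parcs = induced E (component_of E x)\<rparr>) ` V"
proof -
  let ?G = "\<lparr>pverts = V, parcs = E\<rparr>"
  interpret pair_graph ?G using assms by (simp add: pair_graph_iff)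
  note g = ugraphD[OF assms]
  have verts: "pre_digraph.sccs_verts (with_proj ?G) = component_of E ` V"
  proof (intro equalityI subsetI)
    fix S assume "S \<in> pre_digraph.sccs_verts (with_proj ?G)"
    then have S: "S \<noteq> {}" "\<And>u v. u \<in> S \<Longrightarrow> v \<in> S \<Longrightarrow> reachable (with_proj ?G) u v"
      "\<And>u v. u \<in> S \<Longrightarrow> v \<notin> S \<Longrightarrow> \<not> reachable (with_proj ?G) u v \<or> \<not> reachable (with_proj ?G) v u"
      unfolding pre_digraph.sccs_verts_def by blast+
    then obtain u where u: "u \<in> S" by blast
    have uV: "u \<in> V" using reachable_in_verts(1)[OF S(2)[OF u u]] by simp
    have sub: "component_of E u \<subseteq> V" by (rule comp_subset[OF g(2) uV])
    have "S = component_of E u"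
    proof (intro equalityI subsetI)
      show "v \<in> component_of E u" if "v \<in> S" for v
        using S(2)[OF u that] reachable_iff[OF assms uV] by simp
      show "v \<in> S" if "v \<in> component_of E u" for v
      proof (rule ccontr)
        assume "v \<notin> S"
        moreover have "reachable (with_proj ?G) u v" using reachable_iff[OF assms uV] that by simp
        moreover have "v \<in> V" using that sub by blast
        then have "reachable (with_proj ?G) v u"
          using reachable_iff[OF assms] comp_sym[OF g(3) that] by simp
        ultimately show False using S(3)[OF u] by blast
      qed
    qed
    with uV show "S \<in> component_of E ` V" by blast
  next
    fix S assume "S \<in> component_of E ` V"
    then obtain x where x: "x \<in> V" "S = component_of E x" by blast
    have sub: "S \<subseteq> V" unfolding x(2) by (rule comp_subset[OF g(2) x(1)])
    have eq: "component_of E u = S" if "u \<in> S" for u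
      using comp_eq[OF g(3)] that unfolding x(2) .
    have r: "reachable (with_proj ?G) u v \<longleftrightarrow> v \<in> S" if "u \<in> S" for u v
      using reachable_iff[OF assms, of u v] that sub eq[OF that] by auto
    have "S \<noteq> {}" using self_in_comp[of x E] unfolding x(2) by blast
    then show "S \<in> pre_digraph.sccs_verts (with_proj ?G)"
      unfolding pre_digraph.sccs_verts_def using r by blast
  qed
  have "with_proj H = induce_subgraph (with_proj ?G) S \<longleftrightarrow> H = \<lparr>pverts = S, parcs = induced E S\<rparr>" for H S
    by (cases H) (auto simp: with_proj_def induce_subgraph_def)
  then have "components ?G = (\<lambda>S. \<lparr>pverts = S, parcs = induced E S\<rparr>) ` pre_digraph.sccs_verts (with_proj ?G)"
    unfolding components_def sccs_conv_sccs_verts by auto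
  then show ?thesis unfolding verts by (simp add: image_image)
qed

lemma smooth_addable_class_intro:
  assumes C: "graph_class C" "addable C" "smooth C"
  defines "P \<equiv> \<lambda>V E. \<lparr>pverts = V, parcs = E\<rparr> \<in> C"
  obtains L where "smooth_addable_class P L" "\<And>n. card (on_vertices C n) = cnt P n"
proof -
  have C_iso: "H \<in> C" if "G \<in> C" "pair_graph H" "graph_iso f G H" for G H f
    using C(1) that unfolding graph_class_def by blast
  have ug: "ugraph V E" if "P V E" for V E
    using C(1) that pair_graph_iff unfolding graph_class_def P_def by blast
  have cls: "addable_class P"
  proof
    show "ugraph V E" if "P V E" for V E by (rule ug[OF that])
    show "P (f ` V) (map_prod f f ` E)" if P: "P V E" and f: "inj_on f V" for V E f
    proof -
      have "graph_iso f \<lparr>pverts = V, parcs = E\<rparr> \<lparr>pverts = f ` V, parcs = map_prod f f ` E\<rparr>"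
        unfolding graph_iso_def
      proof (intro conjI ballI)
        show "bij_betw f (pverts \<lparr>pverts = V, parcs = E\<rparr>) (pverts \<lparr>pverts = f ` V, parcs = map_prod f f ` E\<rparr>)"
          using f by (simp add: bij_betw_def)
        fix u v assume "u \<in> pverts \<lparr>pverts = V, parcs = E\<rparr>" "v \<in> pverts \<lparr>pverts = V, parcs = E\<rparr>"
        then have uv: "u \<in> V" "v \<in> V" by simp_all
        have "(f u, f v) \<in> map_prod f f ` E \<longleftrightarrow> (u, v) \<in> E"
        proof
          assume "(f u, f v) \<in> map_prod f f ` E"
          then obtain a b where ab: "(a, b) \<in> E" "f a = f u" "f b = f v" by auto
          then have "a \<in> V" "b \<in> V" using ugraphD(2)[OF ug[OF P]] by auto
          then have "a = u" "b = v" using f ab uv by (simp_all add: inj_on_def)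
          with ab show "(u, v) \<in> E" by simp
        qed force
        then show "(u, v) \<in> parcs \<lparr>pverts = V, parcs = E\<rparr> \<longleftrightarrow>
            (f u, f v) \<in> parcs \<lparr>pverts = f ` V, parcs = map_prod f f ` E\<rparr>" by simp
      qed
      then show ?thesis
        using C_iso P ugraph_image[OF ug[OF P] f] unfolding P_def pair_graph_iff[symmetric] by blast
    qed
    show "P V E \<longleftrightarrow> (\<forall>x\<in>V. P (component_of E x) (induced E (component_of E x)))" if "ugraph V E" for V E
    proof -
      have "\<lparr>pverts = V, parcs = E\<rparr> \<in> C \<longleftrightarrow> (\<forall>H\<in>components \<lparr>pverts = V, parcs = E\<rparr>. H \<in> C)"
        using C(2) that unfolding addable_def decomposable_def pair_graph_iff[symmetric] by blast
      then show ?thesis unfolding components_eq[OF that] P_def by simp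
    qed
    show "P V (E \<union> {(x, y), (y, x)})" if P: "P V E" and xy: "x \<in> V" "y \<in> V" "y \<notin> component_of E x" for V E x y
    proof -
      let ?H = "\<lambda>x. \<lparr>pverts = component_of E x, parcs = induced E (component_of E x)\<rparr>"
      have H: "?H x \<in> components \<lparr>pverts = V, parcs = E\<rparr>" "?H y \<in> components \<lparr>pverts = V, parcs = E\<rparr>"
        unfolding components_eq[OF ug[OF P]] using xy by blast+
      have "?H x \<noteq> ?H y" using xy(3) self_in_comp[of y E] by auto
      moreover have "x \<in> pverts (?H x)" "y \<in> pverts (?H y)" by simp_all
      ultimately have "add_edge x y \<lparr>pverts = V, parcs = E\<rparr> \<in> C"
        using C(2) P H unfolding addable_def bridge_addable_def P_def by blast
      then show ?thesis by (simp add: P_def add_edge_def)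
    qed
  qed
  interpret addable_class P by (rule cls)
  have card_on: "card (on_vertices C n) = cnt P n" for n
  proof -
    have "on_vertices C n = (\<lambda>E. \<lparr>pverts = {1..n}, parcs = E\<rparr>) ` {E. P {1..n} E}"
      unfolding on_vertices_def P_def
    proof (intro equalityI subsetI)
      fix G assume "G \<in> {G \<in> C. pverts G = {1..n}}"
      then show "G \<in> (\<lambda>E. \<lparr>pverts = {1..n}, parcs = E\<rparr>) ` {E. \<lparr>pverts = {1..n}, parcs = E\<rparr> \<in> C}"
        by (intro image_eqI[of _ _ "parcs G"]) (cases G; simp)+
    qed auto
    then show ?thesis by (simp add: card_image inj_on_def cnt_def)
  qed
  obtain L where L: "(\<lambda>n. real (c n) / (real n * real (c (n - 1)))) \<longlonglongrightarrow> L"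
    using C(3) unfolding smooth_def card_on c_def[symmetric] convergent_def by blast
  have "smooth_addable_class P L"
  proof
    have "\<forall>\<^sub>F n in sequentially. on_vertices C n \<noteq> {}" using C(3) by (simp add: smooth_def)
    then show "\<forall>\<^sub>F n in sequentially. 0 < c n"
      unfolding c_def card_on[symmetric]
      by eventually_elim (simp add: card_gt_0_iff finite_on_vertices[OF C(1)])
    show "(\<lambda>n. real (c (Suc n)) / (real (Suc n) * real (c n))) \<longlonglongrightarrow> L"
      using LIMSEQ_Suc[OF L] by simp
  qed
  with card_on that show ?thesis by blast
qed

theorem theorem24:
  fixes C :: "nat pair_pre_digraph set" and \<phi> :: mso
  assumes "graph_class C" and "smooth C" and "addable C" and "sentence \<phi>"
  shows "convergent (\<lambda>n. measure_pmf.prob (random_graph C n) {G. satisfies G \<phi>})"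
proof -
  define P where "P V E \<longleftrightarrow> \<lparr>pverts = V, parcs = E\<rparr> \<in> C" for V E
  obtain L where L: "smooth_addable_class P L" and card_on: "\<And>n. card (on_vertices C n) = cnt P n"
    using smooth_addable_class_intro[OF assms(1,3,2)] unfolding P_def[abs_def] by metis
  interpret smooth_addable_class P L by (rule L)
  \<comment> \<open>For \<open>c n = 0\<close> the random graph is unspecified; for convergence it
    is enough to have the equation eventually.\<close>
  have prob: "measure_pmf.prob (random_graph C n) {G. satisfies G \<phi>} =
      real (card {E. P {1..n} E \<and> satisfies \<lparr>pverts = {1..n}, parcs = E\<rparr> \<phi>}) / real (c n)"
    if n: "0 < c n" for n
  proof -
    have ne: "on_vertices C n \<noteq> {}" using n by (metis card_on c_def card.empty less_irrefl)
    have "on_vertices C n \<inter> {G. satisfies G \<phi>} =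
        (\<lambda>E. \<lparr>pverts = {1..n}, parcs = E\<rparr>) ` {E. P {1..n} E \<and> satisfies \<lparr>pverts = {1..n}, parcs = E\<rparr> \<phi>}"
      unfolding on_vertices_def P_def
    proof (intro equalityI subsetI)
      fix G assume "G \<in> {G \<in> C. pverts G = {1..n}} \<inter> {G. satisfies G \<phi>}"
      then show "G \<in> (\<lambda>E. \<lparr>pverts = {1..n}, parcs = E\<rparr>) `
          {E. \<lparr>pverts = {1..n}, parcs = E\<rparr> \<in> C \<and> satisfies \<lparr>pverts = {1..n}, parcs = E\<rparr> \<phi>}"
        by (intro image_eqI[of _ _ "parcs G"]) (cases G; simp)+
    qed auto
    then have "card (on_vertices C n \<inter> {G. satisfies G \<phi>}) =
        card {E. P {1..n} E \<and> satisfies \<lparr>pverts = {1..n}, parcs = E\<rparr> \<phi>}"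
      by (simp add: card_image inj_on_def)
    then show ?thesis
      unfolding random_graph_def measure_pmf_of_set[OF ne finite_on_vertices[OF assms(1)]]
      by (simp add: card_on c_def)
  qed
  have "\<forall>\<^sub>F n in sequentially. measure_pmf.prob (random_graph C n) {G. satisfies G \<phi>} =
      real (card {E. P {1..n} E \<and> satisfies \<lparr>pverts = {1..n}, parcs = E\<rparr> \<phi>}) / real (c n)"
    using c_pos by eventually_elim (rule prob)
  from convergent_cong[OF this] show ?thesis using convergent_satisfying[OF assms(4)] by simp
qed

end
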